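(* Let $T>0$, let $\beta$ be an m-accretive graph on $\mathbb{R}$ for which there exists $c>0$ such that $w\in\beta(u)\Rightarrow|w|\le c|u|$, and let $u_0\in L^1(\mathbb{R})\cap L^\infty(\mathbb{R})$. Then there is a unique solution $u\in(L^1\cap L^\infty)([0,T]\times\mathbb{R})$ in the sense of distributions of $$\partial_t u\in\tfrac12\,\partial^2_{xx}(\beta(u)),\qquad u(0,x)=u_0(x),$$ that is, there exists a unique couple $(u,\eta_u)\in\big((L^1\cap L^\infty)([0,T]\times\mathbb{R})\big)^2$ such that, for a.e. $t\in[0,T]$, $$\int_{\mathbb{R}} u(t,x)\varphi(x)\,dx=\int_{\mathbb{R}} u_0(x)\varphi(x)\,dx+\frac12\int_0^t ds\int_{\mathbb{R}}\eta_u(s,x)\varphi''(x)\,dx\qquad\forall\varphi\in\mathcal S(\mathbb{R}),$$ and $\eta_u(t,x)\in\beta(u(t,x))$ for $dt\otimes dx$-a.e. $(t,x)\in[0,T]\times\mathbb{R}$. Furthermore, there is a unique version of $u$ such that $u\in C([0,T];L^1(\mathbb{R}))$ $(\subset L^1([0,T]\times\mathbb{R}))$, and $\|u(t,\cdot)\|_\infty\le\|u_0\|_\infty$ for every $t\in[0,T]$.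
   Context: A graph (multivalued function) $\beta$ on $\mathbb{R}$ is a subset of $\mathbb{R}\times\mathbb{R}$, viewed as a map $\beta:\mathbb{R}\to 2^{\mathbb{R}}$. It is monotone if $(x_1-x_2)(y_1-y_2)\ge0$ whenever $y_i\in\beta(x_i)$, $i=1,2$. It is maximal monotone (= m-accretive) if it is monotone and there exists $\lambda>0$ such that $\beta+\lambda\,\mathrm{id}$ is surjective, i.e. $\bigcup_{x\in\mathbb{R}}(\beta(x)+\lambda x)=\mathbb{R}$. $\mathcal S(\mathbb{R})$ denotes the Schwartz space of rapidly decreasing smooth functions. *)

theory Defs
  imports "HOL-Probability.Essential_Supremum"
begin

text \<open>A graph is a relation on the reals; its value at x is the image \<open>\<beta> `` {x}\<close>.\<close>

definition monotone_graph :: "(real \<times> real) set \<Rightarrow> bool" where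
  "monotone_graph \<beta> \<longleftrightarrow>
     (\<forall>x1 x2 y1 y2. y1 \<in> \<beta> `` {x1} \<longrightarrow> y2 \<in> \<beta> `` {x2} \<longrightarrow> (x1 - x2) * (y1 - y2) \<ge> 0)"

definition m_accretive :: "(real \<times> real) set \<Rightarrow> bool" where
  "m_accretive \<beta> \<longleftrightarrow> monotone_graph \<beta> \<and>
     (\<exists>r>0. (\<Union>x. (\<lambda>y. y + r * x) ` (\<beta> `` {x})) = UNIV)"

definition Linf_norm :: "'a measure \<Rightarrow> ('a \<Rightarrow> real) \<Rightarrow> ereal" where
  "Linf_norm M f = esssup M (\<lambda>x. ereal \<bar>f x\<bar>)"

text \<open>Elements of L1 and L-infinity are represented by measurable functions; equality of
  elements is equality almost everywhere.\<close>

definition L1_Linf :: "'a measure \<Rightarrow> ('a \<Rightarrow> real) set" where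
  "L1_Linf M = {f. integrable M f \<and> Linf_norm M f < \<infinity>}"

definition schwartz :: "(real \<Rightarrow> real) set" where
  "schwartz = {\<phi>. (\<forall>k x. (deriv ^^ k) \<phi> field_differentiable (at x)) \<and>
                  (\<forall>m k. bounded (range (\<lambda>x. x ^ m * (deriv ^^ k) \<phi> x)))}"

text \<open>The product measure dt dx on \<open>[0,T] \<times> \<real>\<close>.\<close>

definition strip :: "real \<Rightarrow> (real \<times> real) measure" where
  "strip T = restrict_space lborel {0..T} \<Otimes>\<^sub>M lborel"

definition distributional_solution ::
  "real \<Rightarrow> (real \<times> real) set \<Rightarrow> (real \<Rightarrow> real) \<Rightarrow> (real \<times> real \<Rightarrow> real) \<Rightarrow> (real \<times> real \<Rightarrow> real) \<Rightarrow> bool"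
where
  "distributional_solution T \<beta> u0 u \<eta> \<longleftrightarrow>
     u \<in> L1_Linf (strip T) \<and> \<eta> \<in> L1_Linf (strip T) \<and>
     (AE t in restrict_space lborel {0..T}. \<forall>\<phi>\<in>schwartz.
        (LINT x|lborel. u (t, x) * \<phi> x) =
        (LINT x|lborel. u0 x * \<phi> x)
          + 1 / 2 * (LINT s:{0..t}|lborel. (LINT x|lborel. \<eta> (s, x) * (deriv ^^ 2) \<phi> x))) \<and>
     (AE p in strip T. \<eta> p \<in> \<beta> `` {u p})"

text \<open>Continuity of \<open>t \<mapsto> v (t, \<cdot>)\<close> from \<open>[0,T]\<close> into L1 of the real line.\<close>

definition continuous_L1 :: "real \<Rightarrow> (real \<times> real \<Rightarrow> real) \<Rightarrow> bool" where
  "continuous_L1 T v \<longleftrightarrow>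
     (\<forall>t\<in>{0..T}. integrable lborel (\<lambda>x. v (t, x))) \<and>
     (\<forall>t\<in>{0..T}. ((\<lambda>s. LINT x|lborel. \<bar>v (s, x) - v (t, x)\<bar>) \<longlongrightarrow> 0) (at t within {0..T}))"

text \<open>A version of u is only required to agree with u outside a null set of the strip; it need not
  itself be jointly Borel measurable, but is then measurable for the completed measure.\<close>

definition continuous_L1_version ::
  "real \<Rightarrow> (real \<times> real \<Rightarrow> real) \<Rightarrow> (real \<times> real \<Rightarrow> real) \<Rightarrow> bool" where
  "continuous_L1_version T u v \<longleftrightarrow> continuous_L1 T v \<and> (AE p in strip T. v p = u p)"

end

theory Submission
  imports Defs "HOL-Probability.Sinc_Integral"
begin

text \<open>Everything rests on an energy identity. Put \<open>W(t,x) = \<integral>\<^sub>0\<^sup>t \<eta>(s,x) ds\<close>. If \<open>z(t) = W(t)''/2\<close> weakly for a.e. \<open>t\<close>,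
  then the integral of \<open>z \<eta>\<close> over \<open>[0,t] \<times> \<real>\<close> is minus a quarter of the limit of the squared \<open>L\<^sup>2\<close> norms of the
  difference quotients of \<open>W(t)\<close>. For the difference of two solutions monotonicity makes this integral
  nonnegative, so \<open>W(t)\<close> is invariant under translations and therefore zero.

  For existence, replace \<open>\<beta>\<close> by its Yosida approximation and use the explicit finite difference scheme.
  Under a CFL condition it preserves order, which yields the bounds in \<open>L\<^sup>1\<close> and \<open>L\<^sup>\<infinity>\<close> and the contraction
  property. Convex combinations of tails of the approximations converge almost everywhere; the
  linear equation is stable under this procedure, and the graph inclusion follows from Minty's
  monotonicity argument, because the energy identity is a concavity statement for the integral of
  \<open>u \<eta>\<close> on the set of solutions of the linear equation.

  For continuity in time, \<open>u(t)\<close> inherits the \<open>L\<^sup>1\<close> modulus of translation of \<open>u\<^sub>0\<close>, so \<open>u(t) - u(s)\<close> is close to its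
  average at a small scale \<open>d\<close>, and that average is a second difference of \<open>(W(t) - W(s))/2\<close>, of order
  \<open>|t - s|/d\<^sup>2\<close>.\<close>

section \<open>Translation continuity and averages in L1\<close>

text \<open>The functions have no derivatives in x, so the identities are proved for difference
  quotients before the step tends to zero: two Steklov averages in opposite directions turn a weak
  second derivative into an exact second difference. The factor 1/4 in the energy is the 1/2 of the
  equation times the 1/2 from integrating W against its own time derivative. The squared norm of a
  difference quotient does not increase when the step is replaced by a multiple of it. This carries
  smallness from steps tending to zero to all translations in the uniqueness proof, and it is why
  the mesh sizes in the existence proof are dyadic. Convex combinations do not preserve a nonlinear
  relation, so the inclusion in the graph must come from an upper bound for the integrals of u
  \<eta>; the energy on a fixed coarse mesh, linearized at the limit, gives bounds that are affine
  in the approximations. The growth condition makes \<eta> as integrable and as bounded as u, and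
  together with maximality it puts (0,0) into the graph, so that the scheme fixes the zero function
  and does not increase L1 norms.\<close>

lemma abs_mult_le:
  fixes a b :: real
  assumes "\<bar>b\<bar> \<le> K"
  shows "\<bar>a * b\<bar> \<le> K * \<bar>a\<bar>"
  using mult_left_mono[OF assms abs_ge_zero[of a]] by (simp add: abs_mult mult.commute)

lemma integrable_mult_bdd:
  fixes f g :: "'a \<Rightarrow> real"
  assumes f: "integrable N f" and [measurable]: "g \<in> borel_measurable N" and B: "\<And>x. \<bar>g x\<bar> \<le> B"
  shows "integrable N (\<lambda>x. f x * g x)"
proof (rule Bochner_Integration.integrable_bound)
  show "integrable N (\<lambda>x. B * \<bar>f x\<bar>)" using f by auto
  show "(\<lambda>x. f x * g x) \<in> borel_measurable N" using f by measurable
  show "AE x in N. norm (f x * g x) \<le> norm (B * \<bar>f x\<bar>)"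
    using order_trans[OF abs_mult_le[OF B] abs_ge_self] by (intro AE_I2) (simp only: real_norm_def)
qed

lemma integral_shift:
  fixes f :: "real \<Rightarrow> real"
  shows "(LBINT x. f (x + a)) = (LBINT x. f x)"
  using lborel_integral_real_affine[of 1 f a] by (simp add: add.commute)

lemma integrable_shift:
  fixes f :: "real \<Rightarrow> real"
  assumes "integrable lborel f"
  shows "integrable lborel (\<lambda>x. f (x + a))"
  using lborel_integrable_real_affine[OF assms, of 1 a] by (simp add: add.commute)

lemma AE_shift:
  fixes a :: real
  assumes "AE x in lborel. P x"
  shows "AE x in lborel. P (x + a)"
proof -
  from assms obtain N where N: "N \<in> null_sets lborel" "{x. \<not> P x} \<subseteq> N"
    by (auto elim!: AE_E simp: null_sets_def)
  have [measurable]: "N \<in> sets borel" using N by auto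
  have "emeasure (distr lborel borel ((+) a)) N = 0"
    using N lborel_distr_plus[of a] by auto
  then have "emeasure lborel {x. a + x \<in> N} = 0"
    by (subst (asm) emeasure_distr) (auto simp: vimage_def)
  then have "{x. a + x \<in> N} \<in> null_sets lborel"
    by (auto simp: null_sets_def)
  then show ?thesis
    by (rule AE_I') (use N in \<open>auto simp: add.commute\<close>)
qed

definition L1_shift :: "(real \<Rightarrow> real) \<Rightarrow> real \<Rightarrow> real" where
  "L1_shift f y = (LBINT x. \<bar>f (x + y) - f x\<bar>)"

lemma L1_shift_nonneg: "L1_shift f y \<ge> 0"
  by (simp add: L1_shift_def)

lemma L1_shift_le:
  assumes f: "integrable lborel f"
  shows "L1_shift f y \<le> 2 * (LBINT x. \<bar>f x\<bar>)"
proof -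
  have "L1_shift f y \<le> (LBINT x. \<bar>f (x + y)\<bar> + \<bar>f x\<bar>)"
    unfolding L1_shift_def using f integrable_shift[OF f]
    by (intro integral_mono) auto
  also have "\<dots> = 2 * (LBINT x. \<bar>f x\<bar>)"
    using f integrable_shift[OF f] integral_shift[of "\<lambda>x. \<bar>f x\<bar>" y]
    by (subst Bochner_Integration.integral_add) auto
  finally show ?thesis .
qed

lemma L1_shift_add:
  assumes "integrable lborel f" "integrable lborel g"
  shows "L1_shift (\<lambda>x. f x + g x) y \<le> L1_shift f y + L1_shift g y"
proof -
  have "L1_shift (\<lambda>x. f x + g x) y \<le> (LBINT x. \<bar>f (x + y) - f x\<bar> + \<bar>g (x + y) - g x\<bar>)"
    unfolding L1_shift_def using assms integrable_shift[OF assms(1)] integrable_shift[OF assms(2)]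
    by (intro integral_mono) auto
  also have "\<dots> = L1_shift f y + L1_shift g y"
    unfolding L1_shift_def using assms integrable_shift[OF assms(1)] integrable_shift[OF assms(2)]
    by (intro Bochner_Integration.integral_add) auto
  finally show ?thesis .
qed

text \<open>An indicator and its translate have the same integral, so their L1 distance is twice the
  measure of the points of \<open>U\<close> that the shift moves out of \<open>U\<close>. Openness
  makes this tend to zero pointwise: a point of \<open>U\<close> stays in \<open>U\<close> under
  small shifts.\<close>

lemma L1_shift_tendsto_open:
  assumes U: "open U" "emeasure lborel U < \<infinity>" and Y: "Y \<longlonglongrightarrow> (0::real)"
  shows "(\<lambda>n. L1_shift (indicator U) (Y n)) \<longlonglongrightarrow> 0"
proof -
  have [measurable]: "U \<in> sets borel" using U by auto
  let ?I = "indicator U :: real \<Rightarrow> real"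
  have I: "integrable lborel ?I" using U by (auto intro: integrable_real_indicator)
  have pr: "integrable lborel (\<lambda>x. ?I x * (1 - ?I (x + y)))" for y
    by (rule Bochner_Integration.integrable_bound[OF I]) (auto split: split_indicator)
  have eq: "L1_shift ?I y = 2 * (LBINT x. ?I x * (1 - ?I (x + y)))" for y
  proof -
    have "L1_shift ?I y = (LBINT x. (?I (x + y) - ?I x) + 2 * (?I x * (1 - ?I (x + y))))"
      unfolding L1_shift_def by (intro Bochner_Integration.integral_cong) (auto split: split_indicator)
    also have "\<dots> = (LBINT x. ?I (x + y) - ?I x) + (LBINT x. 2 * (?I x * (1 - ?I (x + y))))"
      using I integrable_shift[OF I, of y] pr[of y]
      by (intro Bochner_Integration.integral_add integrable_mult_right Bochner_Integration.integrable_diff) auto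
    also have "(LBINT x. ?I (x + y) - ?I x) = 0"
      using I integrable_shift[OF I, of y] integral_shift[of ?I y] by (subst Bochner_Integration.integral_diff) auto
    finally show ?thesis by simp
  qed
  have "(\<lambda>n. LBINT x. ?I x * (1 - ?I (x + Y n))) \<longlonglongrightarrow> (LINT x::real|lborel. (0::real))"
  proof (rule integral_dominated_convergence[where w="?I"])
    show "AE x in lborel. (\<lambda>n. ?I x * (1 - ?I (x + Y n))) \<longlonglongrightarrow> 0"
    proof (intro AE_I2)
      fix x :: real
      show "(\<lambda>n. ?I x * (1 - ?I (x + Y n))) \<longlonglongrightarrow> 0"
      proof (cases "x \<in> U")
        case True
        have "(\<lambda>n. x + Y n) \<longlonglongrightarrow> x" using tendsto_add[OF tendsto_const Y, of x] by simp
        then have "eventually (\<lambda>n. x + Y n \<in> U) sequentially"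
          using U(1) True by (rule topological_tendstoD)
        then have "eventually (\<lambda>n. ?I x * (1 - ?I (x + Y n)) = 0) sequentially"
          by eventually_elim auto
        then show ?thesis by (rule tendsto_eventually)
      qed auto
    qed
  qed (use I in \<open>auto split: split_indicator\<close>)
  then have "(\<lambda>n. 2 * (LBINT x. ?I x * (1 - ?I (x + Y n)))) \<longlonglongrightarrow> 2 * 0"
    by (intro tendsto_mult tendsto_const) simp
  then show ?thesis by (simp add: eq)
qed

lemma tendsto_zero_approx:
  fixes a :: "nat \<Rightarrow> real"
  assumes "\<And>n. a n \<ge> 0"
    and "\<And>e. e > 0 \<Longrightarrow> \<exists>b. b \<longlonglongrightarrow> 0 \<and> (\<forall>n. a n \<le> b n + e)"
  shows "a \<longlonglongrightarrow> 0"
proof (rule LIMSEQ_I)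
  fix r :: real assume "r > 0"
  then obtain b where b: "b \<longlonglongrightarrow> 0" "\<forall>n. a n \<le> b n + r/2" using assms(2)[of "r/2"] by auto
  then obtain N where "\<forall>n\<ge>N. norm (b n - 0) < r/2" using LIMSEQ_D[OF b(1), of "r/2"] \<open>r > 0\<close> by auto
  then show "\<exists>no. \<forall>n\<ge>no. norm (a n - 0) < r"
    using b(2) assms(1) by (intro exI[of _ N]) (smt (verit) real_norm_def field_sum_of_halves)
qed

text \<open>Continuity of translations in L1. Measurable sets of finite measure are approximated
  from outside by open sets, by outer regularity; this and the passage to limits of simple functions
  rest on \<open>L1_shift_le\<close>, by which an L1 error costs at most twice its size.\<close>

theorem L1_shift_tendsto:
  assumes "integrable lborel f" "Y \<longlonglongrightarrow> (0::real)"
  shows "(\<lambda>n. L1_shift f (Y n)) \<longlonglongrightarrow> 0"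
  using assms(1)
proof (induction rule: integrable_induct)
  case (base A c)
  have [measurable]: "A \<in> sets borel" using base by auto
  let ?A = "indicator A :: real \<Rightarrow> real"
  have "(\<lambda>n. L1_shift ?A (Y n)) \<longlonglongrightarrow> 0"
  proof (rule tendsto_zero_approx)
    fix e :: real assume e: "e > 0"
    obtain U where U: "open U" "A \<subseteq> U" "emeasure lborel (U - A) < e / 2"
      using outer_regular_lborel[of A "e/2"] base e by auto
    let ?U = "indicator U :: real \<Rightarrow> real"
    let ?D = "indicator (U - A) :: real \<Rightarrow> real"
    have [measurable]: "U \<in> sets borel" using U by auto
    have fin: "emeasure lborel (U - A) < \<infinity>"
      using U(3) by (auto elim: less_trans simp: ennreal_less_top)
    have "emeasure lborel U \<le> emeasure lborel A + emeasure lborel (U - A)"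
      using emeasure_subadditive[of A lborel "U - A"] U(2) by (simp add: Un_absorb1)
    also have "\<dots> < \<infinity>" using base fin by (simp add: ennreal_add_less_top)
    finally have fU: "emeasure lborel U < \<infinity>" .
    have iU: "integrable lborel ?U" and iD: "integrable lborel ?D"
      using fU fin by (auto intro: integrable_real_indicator)
    have D: "(LBINT x. \<bar>?D x\<bar>) < e / 2"
      using U(3) fin e by (simp add: emeasure_eq_ennreal_measure ennreal_less_iff)
    have "L1_shift ?A y \<le> L1_shift ?U y + e" for y
    proof -
      have "?A = (\<lambda>x. ?U x + (- ?D x))" using U(2) by (auto simp: fun_eq_iff split: split_indicator)
      then have "L1_shift ?A y \<le> L1_shift ?U y + L1_shift (\<lambda>x. - ?D x) y"
        using L1_shift_add[OF iU, of "\<lambda>x. - ?D x"] iD by auto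
      also have "L1_shift (\<lambda>x. - ?D x) y \<le> 2 * (LBINT x. \<bar>?D x\<bar>)"
        using L1_shift_le[of "\<lambda>x. - ?D x" y] iD by auto
      finally show ?thesis using D by linarith
    qed
    then show "\<exists>b. b \<longlonglongrightarrow> 0 \<and> (\<forall>n. L1_shift ?A (Y n) \<le> b n + e)"
      using L1_shift_tendsto_open[OF U(1) fU assms(2)] by blast
  qed (rule L1_shift_nonneg)
  then have "(\<lambda>n. L1_shift ?A (Y n) * \<bar>c\<bar>) \<longlonglongrightarrow> 0 * \<bar>c\<bar>"
    by (intro tendsto_mult tendsto_const)
  moreover have "L1_shift (\<lambda>x. ?A x *\<^sub>R c) y = L1_shift ?A y * \<bar>c\<bar>" for y
    unfolding L1_shift_def by (simp flip: left_diff_distrib add: abs_mult)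
  ultimately show ?case by simp
next
  case (add f g)
  have "(\<lambda>n. L1_shift f (Y n) + L1_shift g (Y n)) \<longlonglongrightarrow> 0"
    using tendsto_add[OF add(3,4)] by simp
  then show ?case
    by (rule tendsto_sandwich[OF _ _ tendsto_const, rotated 2])
       (use L1_shift_add[OF add(1,2)] in \<open>auto simp: L1_shift_nonneg\<close>)
next
  case (lim f s)
  have [measurable]: "f \<in> borel_measurable lborel" "\<And>i. s i \<in> borel_measurable lborel" using lim by auto
  have conv: "(\<lambda>i. LBINT x. \<bar>f x - s i x\<bar>) \<longlonglongrightarrow> (LINT x::real|lborel. (0::real))"
  \<comment> \<open>The simple functions are bounded by twice the limit function, hence the
    3.\<close>
  proof (rule integral_dominated_convergence[where w="\<lambda>x. 3 * \<bar>f x\<bar>"])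
    show "AE x in lborel. (\<lambda>i. \<bar>f x - s i x\<bar>) \<longlonglongrightarrow> 0"
      using lim(2) by (auto intro!: AE_I2 tendsto_eq_intros)
    show "AE x in lborel. norm \<bar>f x - s i x\<bar> \<le> 3 * \<bar>f x\<bar>" for i
      using lim(3)[of _ i] by (intro AE_I2) (smt (verit) real_norm_def space_lborel UNIV_I)
  qed (use lim in auto)
  show ?case
  proof (rule tendsto_zero_approx)
    fix e :: real assume e: "e > 0"
    obtain i where i: "(LBINT x. \<bar>f x - s i x\<bar>) < e / 2"
      using LIMSEQ_D[OF conv, of "e/2"] e by auto
    have "L1_shift f y \<le> L1_shift (s i) y + e" for y
    proof -
      have "L1_shift f y = L1_shift (\<lambda>x. s i x + (f x - s i x)) y" by simp
      also have "\<dots> \<le> L1_shift (s i) y + L1_shift (\<lambda>x. f x - s i x) y"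
        using lim by (intro L1_shift_add) auto
      also have "L1_shift (\<lambda>x. f x - s i x) y \<le> 2 * (LBINT x. \<bar>f x - s i x\<bar>)"
        using lim by (intro L1_shift_le) auto
      finally show ?thesis using i by linarith
    qed
    then show "\<exists>b. b \<longlonglongrightarrow> 0 \<and> (\<forall>n. L1_shift f (Y n) \<le> b n + e)"
      using lim(5)[of i] by blast
  qed (rule L1_shift_nonneg)
qed

text \<open>The mean of \<open>f\<close> over displacements \<open>d * r\<close>, with
  \<open>r\<close> distributed by \<nu>. Leaving \<nu> open lets the Gaussian law, which yields
  Schwartz kernels, and the uniform law, which yields Steklov averages, share all estimates.\<close>

definition avg :: "real measure \<Rightarrow> real \<Rightarrow> (real \<Rightarrow> real) \<Rightarrow> real \<Rightarrow> real" where
  "avg \<nu> d f x = (LINT r|\<nu>. f (x + d * r))"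

context
  fixes \<nu> :: "real measure"
  assumes prob: "prob_space \<nu>" and sets_nu [measurable_cong]: "sets \<nu> = sets borel"
begin

interpretation \<nu>: prob_space \<nu> by (rule prob)
interpretation pair_sigma_finite \<nu> "lborel :: real measure" ..

lemma avg_measurable [measurable]:
  assumes [measurable]: "f \<in> borel_measurable borel"
  shows "avg \<nu> d f \<in> borel_measurable borel"
  unfolding avg_def by measurable

lemma integrable_avg_pair:
  fixes f :: "real \<Rightarrow> real"
  assumes f: "integrable lborel f"
  shows "integrable (\<nu> \<Otimes>\<^sub>M lborel) (\<lambda>(r, x). f (x + d * r))"
proof (rule pair_sigma_finite.Fubini_integrable)
  have [measurable]: "f \<in> borel_measurable borel" using f by auto
  show "pair_sigma_finite \<nu> (lborel :: real measure)" ..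
  show "(\<lambda>(r, x). f (x + d * r)) \<in> borel_measurable (\<nu> \<Otimes>\<^sub>M lborel)"
    by measurable
  have "(\<lambda>r. LBINT x. norm (f (x + d * r))) = (\<lambda>r. LBINT x. \<bar>f x\<bar>)"
    using integral_shift[of "\<lambda>x. \<bar>f x\<bar>"] by auto
  then show "integrable \<nu> (\<lambda>r. LBINT x. norm (case (r, x) of (r, x) \<Rightarrow> f (x + d * r)))"
    by simp
  show "AE r in \<nu>. integrable lborel (\<lambda>x. case (r, x) of (r, x) \<Rightarrow> f (x + d * r))"
    using integrable_shift[OF f] by auto
qed

lemma integrable_avg:
  assumes f: "integrable lborel f"
  shows "integrable lborel (avg \<nu> d f)"
  using integrable_snd[OF integrable_avg_pair[OF f, of d]] unfolding avg_def by simp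

lemma avg_bound:
  assumes [measurable]: "f \<in> borel_measurable borel" and "\<And>x. \<bar>f x\<bar> \<le> K"
  shows "\<bar>avg \<nu> d f x\<bar> \<le> K"
proof -
  have i: "integrable \<nu> (\<lambda>r. f (x + d * r))"
    by (rule \<nu>.integrable_const_bound[where B=K]) (use assms in auto)
  have "\<bar>avg \<nu> d f x\<bar> \<le> (LINT r|\<nu>. \<bar>f (x + d * r)\<bar>)"
    unfolding avg_def by (rule integral_abs_bound)
  also have "\<dots> \<le> (LINT r|\<nu>. K)"
    using i assms by (intro integral_mono) auto
  finally show ?thesis by (simp add: \<nu>.prob_space)
qed

lemma avg_minus_L1:
  assumes f: "integrable lborel f"
  shows "(LBINT x. \<bar>avg \<nu> d f x - f x\<bar>) \<le> (LINT r|\<nu>. L1_shift f (d * r))"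
proof -
  have [measurable]: "f \<in> borel_measurable borel" using f by auto
  note ip = integrable_avg_pair[OF f, of d]
  have f0: "integrable (\<nu> \<Otimes>\<^sub>M lborel) (\<lambda>(r, x). f x)"
    using integrable_avg_pair[OF f, of 0] by simp
  have id: "integrable (\<nu> \<Otimes>\<^sub>M lborel) (\<lambda>(r, x). \<bar>f (x + d * r) - f x\<bar>)"
    using Bochner_Integration.integrable_diff[OF ip f0] integrable_abs[of "\<nu> \<Otimes>\<^sub>M lborel" "\<lambda>(r, x). f (x + d * r) - f x"] by (simp add: case_prod_beta')
  have "AE x in lborel. integrable \<nu> (\<lambda>r. f (x + d * r))"
    using AE_integrable_snd[OF ip] by simp
  then have "AE x in lborel. \<bar>avg \<nu> d f x - f x\<bar> \<le> (LINT r|\<nu>. \<bar>f (x + d * r) - f x\<bar>)"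
  proof eventually_elim
    case (elim x)
    have "avg \<nu> d f x - f x = (LINT r|\<nu>. f (x + d * r) - f x)"
      unfolding avg_def using elim by (subst Bochner_Integration.integral_diff) (auto simp: \<nu>.prob_space)
    then show ?case using integral_abs_bound[of \<nu> "\<lambda>r. f (x + d * r) - f x"] by simp
  qed
  then have "(LBINT x. \<bar>avg \<nu> d f x - f x\<bar>) \<le> (LBINT x. (LINT r|\<nu>. \<bar>f (x + d * r) - f x\<bar>))"
    using integrable_avg[OF f, of d] f integrable_snd[OF id]
    by (intro integral_mono_AE) auto
  also have "\<dots> = (LINT r|\<nu>. L1_shift f (d * r))"
    unfolding L1_shift_def using Fubini_integral[OF id] by simp
  finally show ?thesis .
qed

lemma avg_minus_L1_le:
  assumes f: "integrable lborel f" and b: "AE r in \<nu>. L1_shift f (d * r) \<le> B"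
  shows "(LBINT x. \<bar>avg \<nu> d f x - f x\<bar>) \<le> B"
proof -
  have [measurable]: "f \<in> borel_measurable borel" using f by auto
  have "(LINT r|\<nu>. L1_shift f (d * r)) \<le> (LINT r|\<nu>. B)"
  proof (rule integral_mono_AE[OF _ _ b])
    show "integrable \<nu> (\<lambda>r. L1_shift f (d * r))"
      by (rule \<nu>.integrable_const_bound[where B="2 * (LBINT x. \<bar>f x\<bar>)"])
         (use L1_shift_le[OF f] L1_shift_nonneg[of f] in \<open>auto simp: L1_shift_def\<close>)
  qed simp
  then show ?thesis using avg_minus_L1[OF f, of d] by (simp add: \<nu>.prob_space)
qed

lemma avg_tendsto_L1:
  assumes f: "integrable lborel f" and Y: "Y \<longlonglongrightarrow> 0"
  shows "(\<lambda>n. LBINT x. \<bar>avg \<nu> (Y n) f x - f x\<bar>) \<longlonglongrightarrow> 0"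
proof -
  have [measurable]: "f \<in> borel_measurable borel" using f by auto
  have "(\<lambda>n. LINT r|\<nu>. L1_shift f (Y n * r)) \<longlonglongrightarrow> (LINT r|\<nu>. 0)"
  proof (rule integral_dominated_convergence[where w="\<lambda>_. 2 * (LBINT x. \<bar>f x\<bar>)"])
    show "AE r in \<nu>. (\<lambda>n. L1_shift f (Y n * r)) \<longlonglongrightarrow> 0"
      using Y by (intro AE_I2 L1_shift_tendsto[OF f]) (auto intro!: tendsto_eq_intros)
  qed (use L1_shift_le[OF f] L1_shift_nonneg[of f] in \<open>auto simp: L1_shift_def\<close>)
  then have "(\<lambda>n. LINT r|\<nu>. L1_shift f (Y n * r)) \<longlonglongrightarrow> 0" by simp
  then show ?thesis
    by (rule tendsto_sandwich[OF _ _ tendsto_const, rotated 2])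
       (use avg_minus_L1[OF f] in auto)
qed

lemma avg_L1_le:
  assumes f: "integrable lborel f"
  shows "(LBINT x. \<bar>avg \<nu> d f x\<bar>) \<le> (LBINT x. \<bar>f x\<bar>)"
proof -
  have id: "integrable (\<nu> \<Otimes>\<^sub>M lborel) (\<lambda>(r, x). \<bar>f (x + d * r)\<bar>)"
    using integrable_avg_pair[OF integrable_abs[OF f], of d] by (simp add: case_prod_beta)
  have "(LBINT x. \<bar>avg \<nu> d f x\<bar>) \<le> (LBINT x. (LINT r|\<nu>. \<bar>f (x + d * r)\<bar>))"
    using integrable_abs[OF integrable_avg[OF f, of d]] integrable_snd[OF id]
    by (intro integral_mono) (auto simp: avg_def intro!: integrable_abs integral_abs_bound)
  also have "\<dots> = (LINT r|\<nu>. (LBINT x. \<bar>f (x + d * r)\<bar>))"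
    using Fubini_integral[OF id] by simp
  also have "\<dots> = (LBINT x. \<bar>f x\<bar>)"
    using integral_shift[of "\<lambda>x. \<bar>f x\<bar>"] by (simp add: \<nu>.prob_space)
  finally show ?thesis .
qed

text \<open>The adjoint of averaging over the displacements \<open>d * r\<close> averages over the
  opposite ones: a substitution moves the shift from one factor to the other.\<close>

lemma avg_dual:
  assumes f: "integrable lborel f" and g [measurable]: "g \<in> borel_measurable borel"
    and K: "\<And>x. \<bar>g x\<bar> \<le> K"
  shows "(LBINT x. avg \<nu> d f x * g x) = (LBINT x. f x * avg \<nu> (- d) g x)"
proof -
  have [measurable]: "f \<in> borel_measurable borel" using f by auto
  have K0: "K \<ge> 0" using K[of 0] by auto
  have i1: "integrable (\<nu> \<Otimes>\<^sub>M lborel) (\<lambda>(r, x). f (x + d * r) * g x)"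
    by (rule Bochner_Integration.integrable_bound[OF integrable_mult_left[OF integrable_avg_pair[OF f, of d], of K]])
       (use K K0 in \<open>auto simp: abs_mult mult_left_mono\<close>)
  have i2: "integrable (\<nu> \<Otimes>\<^sub>M lborel) (\<lambda>(r, x). f x * g (x + - d * r))"
    by (rule Bochner_Integration.integrable_bound[OF integrable_mult_left[OF integrable_avg_pair[OF f, of 0], of K]])
       (use K K0 in \<open>auto simp: abs_mult mult_left_mono\<close>)
  have "(LBINT x. avg \<nu> d f x * g x) = (LBINT x. (LINT r|\<nu>. f (x + d * r) * g x))"
    by (simp add: avg_def)
  also have "\<dots> = (LINT r|\<nu>. (LBINT x. f (x + d * r) * g x))"
    using Fubini_integral[OF i1] by simp
  also have "\<dots> = (LINT r|\<nu>. (LBINT x. f x * g (x + - d * r)))"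
    using integral_shift[of "\<lambda>x. f (x + d * r) * g x" "- d * r" for r] by simp
  also have "\<dots> = (LBINT x. (LINT r|\<nu>. f x * g (x + - d * r)))"
    using Fubini_integral[OF i2] by simp
  also have "\<dots> = (LBINT x. f x * avg \<nu> (- d) g x)"
    by (simp add: avg_def)
  finally show ?thesis .
qed

lemma avg_zero_imp_zero:
  assumes f: "integrable lborel f" and Y: "Y \<longlonglongrightarrow> 0"
    and 0: "\<And>n. AE x in lborel. avg \<nu> (Y n) f x = 0"
  shows "AE x in lborel. f x = 0"
proof -
  have [measurable]: "f \<in> borel_measurable borel" using f by auto
  have "(LBINT x. \<bar>avg \<nu> (Y n) f x - f x\<bar>) = (LBINT x. \<bar>f x\<bar>)" for n
    using 0[of n] by (intro integral_cong_AE) auto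
  then have "(LBINT x. \<bar>f x\<bar>) = 0"
    using avg_tendsto_L1[OF f Y] by (simp add: LIMSEQ_const_iff)
  then show ?thesis using f by (subst (asm) integral_nonneg_eq_0_iff_AE) auto
qed

end

section \<open>Schwartz functions and Steklov averages\<close>

definition second_diff :: "real \<Rightarrow> (real \<Rightarrow> real) \<Rightarrow> real \<Rightarrow> real" where
  "second_diff d f x = (f (x + d) + f (x - d) - 2 * f x) / d\<^sup>2"

lemma schwartz_differentiable:
  "\<phi> \<in> schwartz \<Longrightarrow> (\<phi> has_real_derivative deriv \<phi> x) (at x)"
  unfolding schwartz_def
  by (drule CollectD, drule conjunct1, drule spec[of _ 0]) (auto simp: DERIV_deriv_iff_field_differentiable)

lemma schwartz_deriv:
  assumes "\<phi> \<in> schwartz"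
  shows "deriv \<phi> \<in> schwartz"
proof -
  have eq: "(deriv ^^ k) (deriv \<phi>) = (deriv ^^ Suc k) \<phi>" for k
    by (simp add: funpow_swap1)
  have "(\<forall>k x. (deriv ^^ k) \<phi> field_differentiable (at x)) \<and>
      (\<forall>m k. bounded (range (\<lambda>x. x ^ m * (deriv ^^ k) \<phi> x)))"
    using assms unfolding schwartz_def by (rule CollectD)
  then have "(\<forall>k x. (deriv ^^ Suc k) \<phi> field_differentiable (at x)) \<and>
      (\<forall>m k. bounded (range (\<lambda>x. x ^ m * (deriv ^^ Suc k) \<phi> x)))"
    by (intro conjI allI) (erule conjE, elim allE, assumption)+
  then show ?thesis
    unfolding schwartz_def mem_Collect_eq eq .
qed

lemma schwartz_funpow_deriv: "\<phi> \<in> schwartz \<Longrightarrow> (deriv ^^ k) \<phi> \<in> schwartz"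
  by (induction k) (simp_all add: schwartz_deriv)

lemma schwartz_continuous: "\<phi> \<in> schwartz \<Longrightarrow> continuous_on UNIV \<phi>"
  using schwartz_differentiable DERIV_isCont continuous_at_imp_continuous_on by blast

lemma schwartz_measurable [measurable_dest]: "\<phi> \<in> schwartz \<Longrightarrow> \<phi> \<in> borel_measurable borel"
  by (rule borel_measurable_continuous_onI[OF schwartz_continuous])

lemma one_plus_abs_power_le: "(1 + \<bar>x::real\<bar>) ^ m \<le> 2 ^ m * (1 + \<bar>x\<bar> ^ m)"
proof (cases "\<bar>x\<bar> \<le> 1")
  case True
  then have "(1 + \<bar>x\<bar>) ^ m \<le> 2 ^ m" by (intro power_mono) auto
  also have "\<dots> \<le> 2 ^ m * (1 + \<bar>x\<bar> ^ m)" by simp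
  finally show ?thesis .
next
  case False
  then have "(1 + \<bar>x\<bar>) ^ m \<le> (2 * \<bar>x\<bar>) ^ m" by (intro power_mono) auto
  also have "\<dots> \<le> 2 ^ m * (1 + \<bar>x\<bar> ^ m)" by (simp add: power_mult_distrib)
  finally show ?thesis .
qed

lemma schwartz_decay:
  assumes "\<phi> \<in> schwartz"
  shows "\<exists>K\<ge>0. \<forall>x. (1 + \<bar>x\<bar>) ^ m * \<bar>\<phi> x\<bar> \<le> K"
proof -
  have B: "bounded (range (\<lambda>x. x ^ m * \<phi> x))" for m
    using assms unfolding schwartz_def by (auto dest: spec[of _ 0] spec2[of _ m 0])
  obtain K0 Km where K: "\<And>x. \<bar>\<phi> x\<bar> \<le> K0" "\<And>x. \<bar>x ^ m * \<phi> x\<bar> \<le> Km"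
    using B[of 0] B[of m] unfolding bounded_iff by auto
  have "(1 + \<bar>x\<bar>) ^ m * \<bar>\<phi> x\<bar> \<le> 2 ^ m * (K0 + Km)" for x
  proof -
    have "(1 + \<bar>x\<bar>) ^ m * \<bar>\<phi> x\<bar> \<le> 2 ^ m * (1 + \<bar>x\<bar> ^ m) * \<bar>\<phi> x\<bar>"
      by (intro mult_right_mono one_plus_abs_power_le) auto
    also have "\<dots> = 2 ^ m * (\<bar>\<phi> x\<bar> + \<bar>x ^ m * \<phi> x\<bar>)"
      by (simp add: algebra_simps abs_mult power_abs)
    also have "\<dots> \<le> 2 ^ m * (K0 + Km)" using K[of x] by (intro mult_left_mono add_mono) auto
    finally show ?thesis .
  qed
  moreover have "0 \<le> 2 ^ m * (K0 + Km)"
    using K[of 0] by (intro mult_nonneg_nonneg) (auto intro: order_trans[OF abs_ge_zero])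
  ultimately show ?thesis by blast
qed

lemma schwartz_bounded:
  assumes "\<phi> \<in> schwartz"
  obtains K where "K \<ge> 0" "\<And>x. \<bar>\<phi> x\<bar> \<le> K"
  using schwartz_decay[OF assms, of 0] by auto

text \<open>Spares the computation of higher derivatives: all iterated derivatives stay in a family
  closed under differentiation, so decay need only be shown for the members themselves. The weights
  \<open>(1 + |x|) ^ m\<close> replace \<open>x ^ m\<close> because they behave well under
  translations.\<close>

lemma schwartz_coinduct:
  assumes "\<phi> \<in> F"
    and diff: "\<And>f. f \<in> F \<Longrightarrow> \<exists>g\<in>F. \<forall>x. (f has_real_derivative g x) (at x)"
    and decay: "\<And>f m. f \<in> F \<Longrightarrow> \<exists>K. \<forall>x. (1 + \<bar>x\<bar>) ^ m * \<bar>f x\<bar> \<le> K"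
  shows "\<phi> \<in> schwartz"
proof -
  have F: "(deriv ^^ k) \<phi> \<in> F" for k
  proof (induction k)
    case (Suc k)
    then obtain g where "g \<in> F" "\<forall>x. ((deriv ^^ k) \<phi> has_real_derivative g x) (at x)"
      using diff by blast
    then have "deriv ((deriv ^^ k) \<phi>) = g" by (intro ext DERIV_imp_deriv) auto
    then show ?case using \<open>g \<in> F\<close> by simp
  qed (use assms in simp)
  have "bounded (range (\<lambda>x. x ^ m * f x))" if f: "f \<in> F" for f m
  proof -
    obtain K where K: "\<And>x. (1 + \<bar>x\<bar>) ^ m * \<bar>f x\<bar> \<le> K" using decay[OF f, of m] by auto
    have "\<bar>x ^ m * f x\<bar> \<le> K" for x
    proof -
      have "\<bar>x ^ m * f x\<bar> \<le> (1 + \<bar>x\<bar>) ^ m * \<bar>f x\<bar>"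
        by (auto simp: abs_mult power_abs intro!: mult_right_mono power_mono)
      then show ?thesis using K[of x] by linarith
    qed
    then show ?thesis unfolding bounded_iff by auto
  qed
  then show ?thesis using F diff
    unfolding schwartz_def by (auto simp: field_differentiable_def) (meson F diff)
qed

text \<open>Peetre's inequality, which lets decay estimates survive a shift of the argument.\<close>

lemma one_plus_abs_shift: "(1 + \<bar>x::real\<bar>) ^ m \<le> (1 + \<bar>a\<bar>) ^ m * (1 + \<bar>x + a\<bar>) ^ m"
proof -
  have "1 + \<bar>x\<bar> \<le> (1 + \<bar>a\<bar>) * (1 + \<bar>x + a\<bar>)"
  proof -
    have "1 + \<bar>x\<bar> \<le> 1 + \<bar>a\<bar> + \<bar>x + a\<bar>" by linarith
    also have "\<dots> \<le> (1 + \<bar>a\<bar>) * (1 + \<bar>x + a\<bar>)" by (simp add: algebra_simps)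
    finally show ?thesis .
  qed
  from power_mono[OF this, of m] show ?thesis by (simp add: power_mult_distrib)
qed

lemma schwartz_shift:
  assumes "\<phi> \<in> schwartz"
  shows "(\<lambda>x. \<phi> (x + a)) \<in> schwartz"
proof (rule schwartz_coinduct[of _ "{(\<lambda>x. \<phi> (x + a)) |\<phi>. \<phi> \<in> schwartz}"])
  fix f assume "f \<in> {(\<lambda>x. \<phi> (x + a)) |\<phi>. \<phi> \<in> schwartz}"
  then obtain \<phi> where \<phi>: "\<phi> \<in> schwartz" and f: "f = (\<lambda>x. \<phi> (x + a))" by auto
  show "\<exists>g\<in>{(\<lambda>x. \<phi> (x + a)) |\<phi>. \<phi> \<in> schwartz}. \<forall>x. (f has_real_derivative g x) (at x)"
    using schwartz_deriv[OF \<phi>] DERIV_shift[THEN iffD1, OF schwartz_differentiable[OF \<phi>]] unfolding f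
    by (intro bexI[of _ "\<lambda>x. deriv \<phi> (x + a)"]) auto
  fix m
  obtain K where K: "\<And>x. (1 + \<bar>x\<bar>) ^ m * \<bar>\<phi> x\<bar> \<le> K" using schwartz_decay[OF \<phi>] by blast
  have "(1 + \<bar>x\<bar>) ^ m * \<bar>f x\<bar> \<le> (1 + \<bar>a\<bar>) ^ m * K" for x
  proof -
    have "(1 + \<bar>x\<bar>) ^ m * \<bar>f x\<bar> \<le> ((1 + \<bar>a\<bar>) ^ m * (1 + \<bar>x + a\<bar>) ^ m) * \<bar>\<phi> (x + a)\<bar>"
      unfolding f by (intro mult_right_mono one_plus_abs_shift) auto
    also have "\<dots> \<le> (1 + \<bar>a\<bar>) ^ m * K"
      using K[of "x + a"] by (simp add: mult.assoc mult_left_mono)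
    finally show ?thesis .
  qed
  then show "\<exists>K. \<forall>x. (1 + \<bar>x\<bar>) ^ m * \<bar>f x\<bar> \<le> K" by blast
qed (use assms in auto)

lemma schwartz_scale:
  assumes "\<phi> \<in> schwartz" "c \<noteq> 0"
  shows "(\<lambda>x. b * \<phi> (c * x)) \<in> schwartz"
\<comment> \<open>The prefactor belongs to the family because each differentiation multiplies it by
  \<open>c\<close>.\<close>
proof (rule schwartz_coinduct[of _ "{(\<lambda>x. b * \<phi> (c * x)) |b \<phi>. \<phi> \<in> schwartz}"])
  fix f assume "f \<in> {(\<lambda>x. b * \<phi> (c * x)) |b \<phi>. \<phi> \<in> schwartz}"
  then obtain b \<phi> where \<phi>: "\<phi> \<in> schwartz" and f: "f = (\<lambda>x. b * \<phi> (c * x))" by auto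
  have "(f has_real_derivative (b * c) * deriv \<phi> (c * x)) (at x)" for x
  proof -
    have "((\<lambda>x. \<phi> (c * x)) has_real_derivative deriv \<phi> (c * x) * c) (at x)"
      by (rule DERIV_chain2[OF schwartz_differentiable[OF \<phi>]])
         (auto intro!: derivative_eq_intros)
    from DERIV_cmult[OF this, of b] show ?thesis unfolding f by (simp add: ac_simps)
  qed
  then show "\<exists>g\<in>{(\<lambda>x. b * \<phi> (c * x)) |b \<phi>. \<phi> \<in> schwartz}. \<forall>x. (f has_real_derivative g x) (at x)"
    using schwartz_deriv[OF \<phi>]
    by (intro bexI[of _ "\<lambda>x. (b * c) * deriv \<phi> (c * x)"]) auto
  fix m
  obtain K where K: "\<And>x. (1 + \<bar>x\<bar>) ^ m * \<bar>\<phi> x\<bar> \<le> K" using schwartz_decay[OF \<phi>] by blast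
  have "(1 + \<bar>x\<bar>) ^ m * \<bar>f x\<bar> \<le> (1 + \<bar>1 / c\<bar>) ^ m * (\<bar>b\<bar> * K)" for x
  proof -
    have "1 + \<bar>x\<bar> \<le> (1 + \<bar>1 / c\<bar>) * (1 + \<bar>c * x\<bar>)"
    proof -
      have "\<bar>x\<bar> = \<bar>1 / c\<bar> * \<bar>c * x\<bar>" using assms(2) by (simp add: abs_mult)
      then show ?thesis by (simp add: algebra_simps)
    qed
    from power_mono[OF this, of m]
    have "(1 + \<bar>x\<bar>) ^ m \<le> (1 + \<bar>1 / c\<bar>) ^ m * (1 + \<bar>c * x\<bar>) ^ m"
      unfolding power_mult_distrib by simp
    then have "(1 + \<bar>x\<bar>) ^ m * \<bar>f x\<bar> \<le> ((1 + \<bar>1 / c\<bar>) ^ m * (1 + \<bar>c * x\<bar>) ^ m) * \<bar>f x\<bar>"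
      by (intro mult_right_mono) auto
    also have "\<dots> = (1 + \<bar>1 / c\<bar>) ^ m * (\<bar>b\<bar> * ((1 + \<bar>c * x\<bar>) ^ m * \<bar>\<phi> (c * x)\<bar>))"
      by (simp add: f abs_mult)
    also have "\<dots> \<le> (1 + \<bar>1 / c\<bar>) ^ m * (\<bar>b\<bar> * K)"
      by (intro mult_left_mono K) auto
    finally show ?thesis .
  qed
  then show "\<exists>K. \<forall>x. (1 + \<bar>x\<bar>) ^ m * \<bar>f x\<bar> \<le> K" by blast
qed (use assms in auto)

lemma schwartz_integrable:
  assumes "\<phi> \<in> schwartz"
  shows "integrable lborel \<phi>"
proof -
  have [measurable]: "\<phi> \<in> borel_measurable borel" using assms by measurable
  obtain K where K: "K \<ge> 0" "\<And>x. (1 + \<bar>x\<bar>)\<^sup>2 * \<bar>\<phi> x\<bar> \<le> K" using schwartz_decay[OF assms, of 2] by blast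
  have "integrable lborel (\<lambda>x::real. inverse (1 + x\<^sup>2))"
    using integrable_inverse_1_plus_square by (simp add: set_integrable_def)
  then have i: "integrable lborel (\<lambda>x::real. K * inverse (1 + x\<^sup>2))" by auto
  show ?thesis
  proof (rule Bochner_Integration.integrable_bound[OF i])
    show "AE x in lborel. norm (\<phi> x) \<le> norm (K * inverse (1 + x\<^sup>2))"
    proof (intro AE_I2)
      fix x :: real
      have "(1 + x\<^sup>2) * \<bar>\<phi> x\<bar> \<le> (1 + \<bar>x\<bar>)\<^sup>2 * \<bar>\<phi> x\<bar>"
        by (intro mult_right_mono) (auto simp: power2_eq_square algebra_simps)
      then have "(1 + x\<^sup>2) * \<bar>\<phi> x\<bar> \<le> K" using K(2)[of x] by linarith
      moreover have "1 + x\<^sup>2 > 0" by (smt (verit) zero_le_power2)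
      ultimately have "\<bar>\<phi> x\<bar> \<le> K * inverse (1 + x\<^sup>2)" by (simp add: field_simps)
      then show "norm (\<phi> x) \<le> norm (K * inverse (1 + x\<^sup>2))" by simp
    qed
  qed simp
qed

lemma poly_gaussian_bounded:
  "\<exists>K. \<forall>x. \<bar>poly p x * exp (- x\<^sup>2 / 2)\<bar> \<le> (K::real)"
proof -
  have mono: "\<exists>K. \<forall>x::real. \<bar>x\<bar> ^ n * exp (- x\<^sup>2 / 2) \<le> K" for n
  proof (intro exI allI)
    fix x :: real
    \<comment> \<open>The bound exp y >= (1 + y / m) ^ m is used with y half the square of
      \<open>x\<close>. The exponent \<open>Suc n\<close> is nonzero also for \<open>n = 0\<close>,
      and the higher power still dominates \<open>|x| ^ n\<close>.\<close>
    let ?m = "Suc n"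
    have "(1 + (x\<^sup>2 / 2) / ?m) ^ ?m \<le> exp (x\<^sup>2 / 2)"
      by (rule exp_ge_one_plus_x_over_n_power_n) (auto intro: order_trans[of _ 0])
    moreover have "(1 / (2 * ?m)) ^ ?m * \<bar>x\<bar> ^ n \<le> (1 + (x\<^sup>2 / 2) / ?m) ^ ?m"
    proof -
      have "(1 / (2 * ?m)) ^ ?m * \<bar>x\<bar> ^ n \<le> (1 / (2 * ?m)) ^ ?m * (1 + x\<^sup>2) ^ ?m"
      proof (intro mult_left_mono)
        have "\<bar>x\<bar> \<le> 1 + x\<^sup>2" using sum_squares_ge_zero[of "\<bar>x\<bar> - 1" 0]
          by (smt (verit) power2_eq_square power2_abs zero_le_power2 power2_diff mult_cancel_left1)
        then have "\<bar>x\<bar> ^ n \<le> (1 + x\<^sup>2) ^ n" by (intro power_mono) auto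
        also have "\<dots> \<le> (1 + x\<^sup>2) ^ ?m" by (intro power_increasing) auto
        finally show "\<bar>x\<bar> ^ n \<le> (1 + x\<^sup>2) ^ ?m" .
      qed auto
      also have "\<dots> = ((1 + x\<^sup>2) / (2 * ?m)) ^ ?m" by (simp flip: power_mult_distrib)
      also have "\<dots> \<le> (1 + (x\<^sup>2 / 2) / ?m) ^ ?m"
      proof (intro power_mono)
        have "1 / (2 * real ?m) \<le> 1" by simp
        then show "(1 + x\<^sup>2) / (2 * ?m) \<le> 1 + (x\<^sup>2 / 2) / ?m" by (simp add: add_divide_distrib)
      qed auto
      finally show ?thesis .
    qed
    ultimately have "(1 / (2 * ?m)) ^ ?m * \<bar>x\<bar> ^ n \<le> exp (x\<^sup>2 / 2)" by linarith
    then have "(1 / (2 * ?m)) ^ ?m * (\<bar>x\<bar> ^ n * exp (- x\<^sup>2 / 2)) \<le> 1"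
      by (simp add: exp_minus mult.assoc[symmetric] divide_inverse[symmetric] pos_divide_le_eq del: of_nat_Suc power_Suc)
    then show "\<bar>x\<bar> ^ n * exp (- x\<^sup>2 / 2) \<le> (2 * ?m) ^ ?m"
      by (simp add: power_divide pos_divide_le_eq del: of_nat_Suc power_Suc of_nat_mult)
  qed
  show ?thesis
  proof -
    obtain K where K: "\<And>n x. \<bar>x::real\<bar> ^ n * exp (- x\<^sup>2 / 2) \<le> K n" using mono by metis
    have "\<bar>poly p x * exp (- x\<^sup>2 / 2)\<bar> \<le> (\<Sum>i\<le>degree p. \<bar>coeff p i\<bar> * K i)" for x
    proof -
      have "\<bar>poly p x * exp (- x\<^sup>2 / 2)\<bar> = \<bar>\<Sum>i\<le>degree p. coeff p i * (x ^ i * exp (- x\<^sup>2 / 2))\<bar>"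
        by (simp add: poly_altdef sum_distrib_right mult.assoc)
      also have "\<dots> \<le> (\<Sum>i\<le>degree p. \<bar>coeff p i * (x ^ i * exp (- x\<^sup>2 / 2))\<bar>)" by (rule sum_abs)
      also have "\<dots> \<le> (\<Sum>i\<le>degree p. \<bar>coeff p i\<bar> * K i)"
        using K[of x] by (intro sum_mono) (simp add: abs_mult power_abs mult_left_mono)
      finally show ?thesis .
    qed
    then show ?thesis by blast
  qed
qed

lemma schwartz_gaussian: "(\<lambda>x. exp (- x\<^sup>2 / 2)) \<in> schwartz"
proof (rule schwartz_coinduct[of _ "{(\<lambda>x. poly p x * exp (- x\<^sup>2 / 2)) |p. True}"])
  show "(\<lambda>x::real. exp (- x\<^sup>2 / 2)) \<in> {(\<lambda>x. poly p x * exp (- x\<^sup>2 / 2)) |p. True}"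
    by (auto intro!: exI[of _ 1])
  fix f :: "real \<Rightarrow> real" assume "f \<in> {(\<lambda>x. poly p x * exp (- x\<^sup>2 / 2)) |p. True}"
  then obtain p where f: "f = (\<lambda>x. poly p x * exp (- x\<^sup>2 / 2))" by auto
  show "\<exists>g\<in>{(\<lambda>x. poly p x * exp (- x\<^sup>2 / 2)) |p. True}. \<forall>x. (f has_real_derivative g x) (at x)"
    unfolding f
  proof (rule bexI[of _ "\<lambda>x. poly (pderiv p - [:0, 1:] * p) x * exp (- x\<^sup>2 / 2)"])
    show "\<forall>x. ((\<lambda>x. poly p x * exp (- x\<^sup>2 / 2)) has_real_derivative
        poly (pderiv p - [:0, 1:] * p) x * exp (- x\<^sup>2 / 2)) (at x)"
      by (auto intro!: derivative_eq_intros simp: algebra_simps power2_eq_square)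
  qed blast
  fix m
  have "\<exists>K. \<forall>x. \<bar>poly (monom 1 k * p) x * exp (- x\<^sup>2 / 2)\<bar> \<le> K" for k
    by (rule poly_gaussian_bounded)
  then obtain K where K: "\<And>k x. \<bar>x ^ k * poly p x * exp (- x\<^sup>2 / 2)\<bar> \<le> K k"
    by (auto simp: poly_monom) metis
  have "(1 + \<bar>x\<bar>) ^ m * \<bar>f x\<bar> \<le> 2 ^ m * (K 0 + K m)" for x
  proof -
    have "(1 + \<bar>x\<bar>) ^ m * \<bar>f x\<bar> \<le> 2 ^ m * (1 + \<bar>x\<bar> ^ m) * \<bar>f x\<bar>"
      by (intro mult_right_mono one_plus_abs_power_le) auto
    also have "\<dots> = 2 ^ m * (\<bar>x ^ 0 * f x\<bar> + \<bar>x ^ m * f x\<bar>)"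
      by (simp add: algebra_simps abs_mult power_abs)
    also have "\<dots> \<le> 2 ^ m * (K 0 + K m)" using K[of x] unfolding f mult.assoc
      by (intro mult_left_mono add_mono) (auto simp del: power_0)
    finally show ?thesis .
  qed
  then show "\<exists>K. \<forall>x. (1 + \<bar>x\<bar>) ^ m * \<bar>f x\<bar> \<le> K" by blast
qed

section \<open>Gaussian kernels and the fundamental lemma\<close>

abbreviation std_normal :: "real measure" where
  "std_normal \<equiv> density lborel (\<lambda>x. ennreal (std_normal_density x))"

lemma prob_space_std_normal: "prob_space std_normal"
  by (rule prob_space_normal_density) simp

text \<open>The Gaussian average of \<open>H\<close> at \<open>x\<close> is the pairing of
  \<open>H\<close> with a scaled and translated Gaussian, hence with a Schwartz function, so it
  vanishes at every scale; and the averages tend to \<open>H\<close> in L1.\<close>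

lemma schwartz_fundamental:
  assumes H: "integrable lborel H" and 0: "\<And>\<psi>. \<psi> \<in> schwartz \<Longrightarrow> (LBINT x. H x * \<psi> x) = 0"
  shows "AE x in lborel. H x = 0"
proof (rule avg_zero_imp_zero[OF prob_space_std_normal _ H, of "\<lambda>n. 1 / real (Suc n)"])
  have [measurable]: "H \<in> borel_measurable borel" using H by auto
  show "(\<lambda>n. 1 / real (Suc n)) \<longlonglongrightarrow> 0" by (rule LIMSEQ_Suc) (rule lim_1_over_n)
  fix n
  define d where "d = 1 / real (Suc n)"
  have d: "d > 0" by (simp add: d_def)
  have "avg std_normal d H x = 0" for x
  proof -
    let ?\<psi> = "\<lambda>y. (1 / sqrt (2 * pi)) * exp (- ((1 / d) * (y + - x))\<^sup>2 / 2)"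
    have "(\<lambda>y. (1 / sqrt (2 * pi)) * exp (- ((1 / d) * y)\<^sup>2 / 2)) \<in> schwartz"
      using schwartz_scale[OF schwartz_gaussian, of "1 / d" "1 / sqrt (2 * pi)"] d by auto
    from schwartz_shift[OF this, of "- x"] have \<psi>: "?\<psi> \<in> schwartz" .
    have "avg std_normal d H x = (LBINT r. std_normal_density r * H (x + d * r))"
      unfolding avg_def by (subst integral_density) auto
    also have "\<dots> = (LBINT r. H (x + d * r) * ?\<psi> (x + d * r))"
      using d by (intro Bochner_Integration.integral_cong) (auto simp: normal_density_def)
    also have "\<dots> = (1 / d) * (LBINT y. H y * ?\<psi> y)"
      using lborel_integral_real_affine[of d "\<lambda>y. H y * ?\<psi> y" x] d by simp
    also have "\<dots> = 0" using 0[OF \<psi>] by simp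
    finally show ?thesis .
  qed
  then show "AE x in lborel. avg std_normal (1 / real (Suc n)) H x = 0" by (simp add: d_def)
qed simp

section \<open>Steklov averages\<close>

definition unit_uniform :: "real measure" where
  "unit_uniform = density lborel (\<lambda>x. ennreal (indicator {0..1} x))"

lemma sets_unit_uniform: "sets unit_uniform = sets borel"
  by (simp add: unit_uniform_def)

lemma prob_space_unit_uniform: "prob_space unit_uniform"
proof
  have "emeasure unit_uniform (space unit_uniform) = (\<integral>\<^sup>+x. indicator {0..1::real} x \<partial>lborel)"
    unfolding unit_uniform_def by (subst emeasure_density) (auto simp: ennreal_indicator)
  also have "\<dots> = emeasure lborel {0..1::real}" by (rule nn_integral_indicator) simp
  finally show "emeasure unit_uniform (space unit_uniform) = 1" by simp
qed

lemma AE_unit_uniform: "AE r in unit_uniform. 0 \<le> r \<and> r \<le> 1"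
  unfolding unit_uniform_def by (subst AE_density) (auto split: split_indicator)

lemma avg_unit_uniform:
  assumes [measurable]: "f \<in> borel_measurable borel"
  shows "avg unit_uniform d f x = (LINT r:{0..1}|lborel. f (x + d * r))"
  unfolding avg_def unit_uniform_def set_lebesgue_integral_def
  by (subst integral_density) auto

text \<open>The mean of \<open>f\<close> over the interval between \<open>x\<close> and
  \<open>x + d\<close>. Negative \<open>d\<close> is allowed, which makes \<open>stek (- d)\<close>
  the adjoint of \<open>stek d\<close>.\<close>

definition stek :: "real \<Rightarrow> (real \<Rightarrow> real) \<Rightarrow> real \<Rightarrow> real" where
  "stek = avg unit_uniform"

lemmas stek_measurable [measurable] = avg_measurable[OF prob_space_unit_uniform sets_unit_uniform, folded stek_def]
  and integrable_stek = integrable_avg[OF prob_space_unit_uniform sets_unit_uniform, folded stek_def]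
  and stek_bound = avg_bound[OF prob_space_unit_uniform sets_unit_uniform, folded stek_def]
  and stek_minus_L1_le = avg_minus_L1_le[OF prob_space_unit_uniform sets_unit_uniform, folded stek_def]
  and stek_tendsto_L1 = avg_tendsto_L1[OF prob_space_unit_uniform sets_unit_uniform, folded stek_def]
  and stek_L1_le = avg_L1_le[OF prob_space_unit_uniform sets_unit_uniform, folded stek_def]
  and stek_dual = avg_dual[OF prob_space_unit_uniform sets_unit_uniform, folded stek_def]
  and stek_zero_imp_zero = avg_zero_imp_zero[OF prob_space_unit_uniform sets_unit_uniform, folded stek_def]

lemma stek_deriv:
  assumes f: "continuous_on UNIV f" and F: "\<And>x. (F has_real_derivative f x) (at x)" and d: "d \<noteq> 0"
  shows "stek d f x = (F (x + d) - F x) / d"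
proof -
  have [measurable]: "f \<in> borel_measurable borel" by (rule borel_measurable_continuous_onI[OF f])
  have "(LBINT r=ereal 0..ereal 1. f (x + d * r)) = F (x + d * 1) / d - F (x + d * 0) / d"
  proof (rule interval_integral_FTC_finite[where F="\<lambda>r. F (x + d * r) / d"])
    show "continuous_on {min 0 1..max 0 1} (\<lambda>r. f (x + d * r))"
      by (intro continuous_on_compose2[OF f] continuous_intros) auto
    fix r :: real
    have "((\<lambda>r. F (x + d * r)) has_real_derivative f (x + d * r) * d) (at r)"
      by (rule DERIV_chain2[OF F])
         (auto intro!: derivative_eq_intros)
    from DERIV_cdivide[OF this, of d]
    have "((\<lambda>r. F (x + d * r) / d) has_real_derivative f (x + d * r)) (at r)" using d by simp
    then show "((\<lambda>r. F (x + d * r) / d) has_vector_derivative f (x + d * r)) (at r within {min 0 1..max 0 1})"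
      by (simp add: has_real_derivative_iff_has_vector_derivative has_vector_derivative_at_within)
  qed
  then show ?thesis
    unfolding stek_def by (simp add: avg_unit_uniform diff_divide_distrib interval_integral_Icc)
qed

lemma stek_schwartz_deriv:
  assumes \<phi>: "\<phi> \<in> schwartz" and d: "d \<noteq> 0"
  shows "stek d (deriv \<phi>) x = (\<phi> (x + d) - \<phi> x) / d"
  by (rule stek_deriv[OF schwartz_continuous[OF schwartz_deriv[OF \<phi>]] schwartz_differentiable[OF \<phi>] d])

text \<open>An antiderivative \<open>F\<close> of \<phi> exhibits the average as a difference
  quotient of \<open>F\<close>, which replaces differentiation under the integral sign.\<close>

lemma has_derivative_stek:
  assumes \<phi>: "\<phi> \<in> schwartz" and d: "d \<noteq> 0"
  shows "(stek d \<phi> has_real_derivative stek d (deriv \<phi>) x) (at x)"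
proof -
  have "\<exists>F. \<forall>x. -\<infinity> < ereal x \<longrightarrow> ereal x < \<infinity> \<longrightarrow> (F has_vector_derivative \<phi> x) (at x)"
    by (rule einterval_antiderivative)
       (use schwartz_continuous[OF \<phi>] in \<open>auto simp: continuous_on_eq_continuous_at\<close>)
  then obtain F where F: "\<And>x. (F has_real_derivative \<phi> x) (at x)"
    by (auto simp: has_real_derivative_iff_has_vector_derivative)
  have eq: "stek d \<phi> = (\<lambda>x. (F (x + d) - F x) / d)"
    using stek_deriv[OF schwartz_continuous[OF \<phi>] F d] by auto
  have "((\<lambda>x. F (x + d)) has_real_derivative \<phi> (x + d)) (at x)"
    using DERIV_shift[THEN iffD1, OF F] .
  from DERIV_cdivide[OF DERIV_diff[OF this F[of x]], of d]
  show ?thesis unfolding eq stek_schwartz_deriv[OF \<phi> d] .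
qed

lemma schwartz_stek:
  assumes \<phi>: "\<phi> \<in> schwartz" and d: "d \<noteq> 0"
  shows "stek d \<phi> \<in> schwartz"
proof (rule schwartz_coinduct[of _ "stek d ` schwartz"])
  fix f assume "f \<in> stek d ` schwartz"
  then obtain \<phi> where \<phi>: "\<phi> \<in> schwartz" and f: "f = stek d \<phi>" by auto
  note [measurable] = schwartz_measurable[OF \<phi>]
  show "\<exists>g\<in>stek d ` schwartz. \<forall>x. (f has_real_derivative g x) (at x)"
    unfolding f using has_derivative_stek[OF \<phi> d] schwartz_deriv[OF \<phi>] by blast
  fix m
  obtain K where K: "K \<ge> 0" "\<And>x. (1 + \<bar>x\<bar>) ^ m * \<bar>\<phi> x\<bar> \<le> K" using schwartz_decay[OF \<phi>] by blast
  have "(1 + \<bar>x\<bar>) ^ m * \<bar>f x\<bar> \<le> (1 + \<bar>d\<bar>) ^ m * K" for x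
  proof -
    interpret U: prob_space unit_uniform by (rule prob_space_unit_uniform)
    note [measurable_cong] = sets_unit_uniform
    have b: "AE r in unit_uniform. \<bar>(1 + \<bar>x\<bar>) ^ m * \<phi> (x + d * r)\<bar> \<le> (1 + \<bar>d\<bar>) ^ m * K"
      using AE_unit_uniform
    proof eventually_elim
      case (elim r)
      have "\<bar>(1 + \<bar>x\<bar>) ^ m * \<phi> (x + d * r)\<bar> = (1 + \<bar>x\<bar>) ^ m * \<bar>\<phi> (x + d * r)\<bar>" by (simp add: abs_mult)
      also have "\<dots> \<le> ((1 + \<bar>d * r\<bar>) ^ m * (1 + \<bar>x + d * r\<bar>) ^ m) * \<bar>\<phi> (x + d * r)\<bar>"
        by (intro mult_right_mono one_plus_abs_shift) auto
      also have "\<dots> \<le> (1 + \<bar>d * r\<bar>) ^ m * K"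
        using K(2)[of "x + d * r"] by (simp add: mult.assoc mult_left_mono)
      also have "\<dots> \<le> (1 + \<bar>d\<bar>) ^ m * K"
        using elim K(1) by (intro mult_right_mono power_mono add_mono) (auto simp: abs_mult mult_left_le)
      finally show ?case .
    qed
    have "(1 + \<bar>x\<bar>) ^ m * \<bar>f x\<bar> = \<bar>LINT r|unit_uniform. (1 + \<bar>x\<bar>) ^ m * \<phi> (x + d * r)\<bar>"
      by (simp add: f stek_def avg_def abs_mult)
    also have "\<dots> \<le> (LINT r|unit_uniform. \<bar>(1 + \<bar>x\<bar>) ^ m * \<phi> (x + d * r)\<bar>)"
      by (rule integral_abs_bound)
    also have "\<dots> \<le> (LINT r|unit_uniform. (1 + \<bar>d\<bar>) ^ m * K)"
    proof (rule integral_mono_AE[OF _ _ b])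
      have [measurable]: "(\<lambda>r. (1 + \<bar>x\<bar>) ^ m * \<phi> (x + d * r)) \<in> borel_measurable unit_uniform" by measurable
      show "integrable unit_uniform (\<lambda>r. \<bar>(1 + \<bar>x\<bar>) ^ m * \<phi> (x + d * r)\<bar>)"
        by (rule U.integrable_const_bound[where B="(1 + \<bar>d\<bar>) ^ m * K"]) (use b in auto)
    qed auto
    also have "\<dots> = (1 + \<bar>d\<bar>) ^ m * K" by (simp add: U.prob_space)
    finally show ?thesis .
  qed
  then show "\<exists>K. \<forall>x. (1 + \<bar>x\<bar>) ^ m * \<bar>f x\<bar> \<le> K" by blast
qed (use assms in auto)

lemma deriv_stek: "\<phi> \<in> schwartz \<Longrightarrow> d \<noteq> 0 \<Longrightarrow> deriv (stek d \<phi>) = stek d (deriv \<phi>)"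
  by (intro ext DERIV_imp_deriv has_derivative_stek)

text \<open>Each average trades one derivative for a difference quotient; a forward and a backward
  quotient combine to the centred second difference.\<close>

lemma stek_stek_deriv2:
  assumes \<phi>: "\<phi> \<in> schwartz" and d: "d \<noteq> 0"
  shows "stek d (stek (- d) ((deriv ^^ 2) \<phi>)) x = second_diff d \<phi> x"
proof -
  have "stek d (stek (- d) (deriv (deriv \<phi>))) x = (stek (- d) (deriv \<phi>) (x + d) - stek (- d) (deriv \<phi>) x) / d"
    using stek_schwartz_deriv[OF schwartz_stek[OF schwartz_deriv[OF \<phi>]], of "- d" d] d
    by (simp add: deriv_stek[OF schwartz_deriv[OF \<phi>]])
  also have "\<dots> = second_diff d \<phi> x"
    using d by (simp add: stek_schwartz_deriv[OF \<phi>] second_diff_def field_simps power2_eq_square)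
  finally show ?thesis by (simp add: numeral_2_eq_2)
qed

lemma deriv2_stek_stek:
  assumes \<phi>: "\<phi> \<in> schwartz" and d: "d \<noteq> 0"
  shows "(deriv ^^ 2) (stek d (stek (- d) \<phi>)) x = second_diff d \<phi> x"
  using stek_stek_deriv2[OF assms] d
  by (simp add: numeral_2_eq_2 deriv_stek schwartz_stek schwartz_deriv \<phi>)

lemma integral_second_diff:
  assumes f: "integrable lborel f" and g [measurable]: "g \<in> borel_measurable borel"
    and K: "\<And>x. \<bar>g x\<bar> \<le> K"
  shows "(LBINT x. second_diff d f x * g x) = (LBINT x. f x * second_diff d g x)"
proof -
  have [measurable]: "f \<in> borel_measurable borel" using f by auto
  have i: "integrable lborel (\<lambda>x. f (x + a) * g (x + b))" for a b
    by (rule integrable_mult_bdd[OF integrable_shift[OF f], where B = K]) (use K in auto)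
  have e: "(LBINT x. f (x + a) * g x) = (LBINT x. f x * g (x + - a))" for a
    using integral_shift[of "\<lambda>x. f (x + a) * g x" "- a"] by simp
  have i2: "integrable lborel (\<lambda>x. f (x + a) * g x)" "integrable lborel (\<lambda>x. f x * g (x + a))" for a
    using i[of a 0] i[of 0 a] by auto
  have i3: "integrable lborel (\<lambda>x. f x * g x)" using i[of 0 0] by auto
  have "(LBINT x. second_diff d f x * g x)
      = (LBINT x. (f (x + d) * g x + f (x + - d) * g x - 2 * (f x * g x)) / d\<^sup>2)"
    by (simp add: second_diff_def algebra_simps)
  also have "\<dots> = ((LBINT x. f (x + d) * g x) + (LBINT x. f (x + - d) * g x)
      - 2 * (LBINT x. f x * g x)) / d\<^sup>2"
    using i2[of d] i2[of "- d"] i3 by simp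
  also have "\<dots> = ((LBINT x. f x * g (x + - d)) + (LBINT x. f x * g (x + d))
      - 2 * (LBINT x. f x * g x)) / d\<^sup>2"
    using e[of d] e[of "- d"] by simp
  also have "\<dots> = (LBINT x. (f x * g (x + - d) + f x * g (x + d) - 2 * (f x * g x)) / d\<^sup>2)"
    using i2[of d] i2[of "- d"] i3 by simp
  also have "\<dots> = (LBINT x. f x * second_diff d g x)"
    by (simp add: second_diff_def algebra_simps)
  finally show ?thesis .
qed

lemma integrable_second_diff:
  assumes "integrable lborel f"
  shows "integrable lborel (second_diff d f)"
  unfolding second_diff_def using assms integrable_shift[OF assms, of d] integrable_shift[OF assms, of "- d"]
  by auto

text \<open>Instead of a mollifier, test with \<open>stek d (stek (- d) \<psi>)\<close>: its second derivative is an exact second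
  difference, so no derivative of \<open>g\<close> is needed.\<close>

theorem weak_second_derivative_stek:
  assumes f: "integrable lborel f" and g: "integrable lborel g"
    and eq: "\<And>\<phi>. \<phi> \<in> schwartz \<Longrightarrow> (LBINT x. f x * \<phi> x) = (LBINT x. g x * (deriv ^^ 2) \<phi> x)"
    and d: "d \<noteq> 0"
  shows "AE x in lborel. stek d (stek (- d) f) x = second_diff d g x"
proof -
  have "AE x in lborel. stek d (stek (- d) f) x - second_diff d g x = 0"
  proof (rule schwartz_fundamental)
    note iff = integrable_stek[OF integrable_stek[OF f], of d "- d"] and ig = integrable_second_diff[OF g, of d]
    show "integrable lborel (\<lambda>x. stek d (stek (- d) f) x - second_diff d g x)"
      using iff ig by auto
    fix \<psi> :: "real \<Rightarrow> real" assume \<psi>: "\<psi> \<in> schwartz"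
    note [measurable] = schwartz_measurable[OF \<psi>]
    obtain K where K: "\<And>x. \<bar>\<psi> x\<bar> \<le> K" using schwartz_bounded[OF \<psi>] by blast
    have s: "stek d (stek (- d) \<psi>) \<in> schwartz" using \<psi> d by (intro schwartz_stek) auto
    have i: "integrable lborel (\<lambda>x. h x * \<psi> x)" if h: "integrable lborel h" for h
      by (rule integrable_mult_bdd[OF h _ K]) simp
    have "(LBINT x. (stek d (stek (- d) f) x - second_diff d g x) * \<psi> x)
      = (LBINT x. stek d (stek (- d) f) x * \<psi> x) - (LBINT x. second_diff d g x * \<psi> x)"
      using i[OF iff] i[OF ig] by (simp add: left_diff_distrib)
    also have "(LBINT x. stek d (stek (- d) f) x * \<psi> x) = (LBINT x. stek (- d) f x * stek (- d) \<psi> x)"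
      by (rule stek_dual[OF integrable_stek[OF f] _ K]) simp
    also have "\<dots> = (LBINT x. f x * stek d (stek (- d) \<psi>) x)"
      by (subst stek_dual[OF f _ stek_bound[OF _ K]]) simp_all
    also have "\<dots> = (LBINT x. g x * second_diff d \<psi> x)"
      using eq[OF s] by (simp add: deriv2_stek_stek[OF \<psi> d])
    also have "\<dots> = (LBINT x. second_diff d g x * \<psi> x)"
      by (rule integral_second_diff[OF g _ K, symmetric]) simp
    finally show "(LBINT x. (stek d (stek (- d) f) x - second_diff d g x) * \<psi> x) = 0" by simp
  qed
  then show ?thesis by simp
qed

text \<open>The second difference is the second derivative averaged twice. An average over an
  interval of length \<open>|d|\<close> moves a \<open>K\<close>-Lipschitz function by at most
  \<open>K * |d|\<close> and keeps the Lipschitz constant, whence \<open>2 * K\<close> with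
  \<open>K\<close> a bound for the third derivative.\<close>

lemma second_diff_approx:
  assumes \<phi>: "\<phi> \<in> schwartz"
  obtains K where "K \<ge> 0" "\<And>d x. d \<noteq> 0 \<Longrightarrow> \<bar>second_diff d \<phi> x - (deriv ^^ 2) \<phi> x\<bar> \<le> K * \<bar>d\<bar>"
proof -
  interpret U: prob_space unit_uniform by (rule prob_space_unit_uniform)
  note [measurable_cong] = sets_unit_uniform
  have \<phi>2: "(deriv ^^ 2) \<phi> \<in> schwartz" using \<phi> by (rule schwartz_funpow_deriv)
  obtain K where K: "K \<ge> 0" "\<And>x. \<bar>deriv ((deriv ^^ 2) \<phi>) x\<bar> \<le> K"
    using schwartz_bounded[OF schwartz_deriv[OF \<phi>2]] by blast
  have lip: "\<bar>(deriv ^^ 2) \<phi> x - (deriv ^^ 2) \<phi> y\<bar> \<le> K * \<bar>x - y\<bar>" for x y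
    using field_differentiable_bound[of UNIV "(deriv ^^ 2) \<phi>" "deriv ((deriv ^^ 2) \<phi>)" K x y] K(2)
      schwartz_differentiable[OF \<phi>2] by auto
  have step: "\<bar>stek d f x - f x\<bar> \<le> L * \<bar>d\<bar>"
    if f: "f \<in> schwartz" and L: "L \<ge> 0" "\<And>x y. \<bar>f x - f y\<bar> \<le> L * \<bar>x - y\<bar>" for d f x L
  proof -
    note [measurable] = schwartz_measurable[OF f]
    obtain B where B: "\<And>x. \<bar>f x\<bar> \<le> B" using schwartz_bounded[OF f] by blast
    have i: "integrable unit_uniform (\<lambda>r. f (x + d * r))"
      by (rule U.integrable_const_bound[where B=B]) (use B in auto)
    have "stek d f x - f x = (LINT r|unit_uniform. f (x + d * r) - f x)"
      unfolding stek_def avg_def using i by (subst Bochner_Integration.integral_diff) (auto simp: U.prob_space)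
    then have "\<bar>stek d f x - f x\<bar> \<le> (LINT r|unit_uniform. \<bar>f (x + d * r) - f x\<bar>)"
      using integral_abs_bound[of unit_uniform "\<lambda>r. f (x + d * r) - f x"] by simp
    also have "\<dots> \<le> (LINT r|unit_uniform. L * \<bar>d\<bar>)"
    proof (rule integral_mono_AE)
      show "AE r in unit_uniform. \<bar>f (x + d * r) - f x\<bar> \<le> L * \<bar>d\<bar>"
        using AE_unit_uniform
      proof eventually_elim
        case (elim r)
        have "\<bar>f (x + d * r) - f x\<bar> \<le> L * \<bar>d * r\<bar>" using L(2)[of "x + d * r" x] by simp
        also have "\<dots> \<le> L * \<bar>d\<bar>" using elim L(1) by (intro mult_left_mono) (auto simp: abs_mult mult_left_le)
        finally show ?case .
      qed
    qed (use i in auto)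
    finally show ?thesis by (simp add: U.prob_space)
  qed
  have "\<bar>second_diff d \<phi> x - (deriv ^^ 2) \<phi> x\<bar> \<le> (2 * K) * \<bar>d\<bar>" if d: "d \<noteq> 0" for d x
  proof -
    let ?f = "(deriv ^^ 2) \<phi>"
    have s: "stek (- d) ?f \<in> schwartz" using \<phi>2 d by (intro schwartz_stek) auto
    have Ks: "\<bar>deriv (stek (- d) ?f) x\<bar> \<le> K" for x
      using d by (simp add: deriv_stek[OF \<phi>2] stek_bound[OF schwartz_measurable[OF schwartz_deriv[OF \<phi>2]] K(2)])
    have lip': "\<bar>stek (- d) ?f x - stek (- d) ?f y\<bar> \<le> K * \<bar>x - y\<bar>" for x y
      using field_differentiable_bound[of UNIV "stek (- d) ?f" "deriv (stek (- d) ?f)" K x y] Ks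
        schwartz_differentiable[OF s] by auto
    show ?thesis
      using step[OF \<phi>2 K(1) lip, of "- d" x] step[OF s K(1) lip', of d x] stek_stek_deriv2[OF \<phi> d, of x] by auto
  qed
  then show ?thesis using K(1) by (intro that[of "2 * K"]) auto
qed

section \<open>The energy identity\<close>

abbreviation plane :: "(real \<times> real) measure" where
  "plane \<equiv> lborel \<Otimes>\<^sub>M lborel"

text \<open>Elements of \<open>L\<^sup>1 \<inter> L\<^sup>\<infinity>\<close> of the strip are represented by functions on the whole plane that are bounded
  everywhere and vanish off the strip, so that Fubini's theorem applies without restricted measures.\<close>

definition bdd_integrable :: "real \<Rightarrow> real \<Rightarrow> (real \<times> real \<Rightarrow> real) \<Rightarrow> bool" where
  "bdd_integrable T K f \<longleftrightarrow> integrable plane f \<and> (\<forall>p. \<bar>f p\<bar> \<le> K) \<and>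
     (\<forall>t x. t \<notin> {0..T} \<longrightarrow> f (t, x) = 0)"

definition prim :: "(real \<times> real \<Rightarrow> real) \<Rightarrow> real \<Rightarrow> real \<Rightarrow> real" where
  "prim f t x = (LBINT s. indicator {0..t} s * f (s, x))"

definition diff_quot :: "real \<Rightarrow> (real \<Rightarrow> real) \<Rightarrow> real \<Rightarrow> real" where
  "diff_quot d f x = (f (x + d) - f x) / d"

lemma bdd_integrableD:
  assumes "bdd_integrable T K f"
  shows "integrable plane f" "f \<in> borel_measurable plane"
    "\<bar>f p\<bar> \<le> K" "t \<notin> {0..T} \<Longrightarrow> f (t, x) = 0" "K \<ge> 0"
proof -
  show "\<bar>f p\<bar> \<le> K" for p using assms unfolding bdd_integrable_def by blast
  from order_trans[OF abs_ge_zero this] show "K \<ge> 0" .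
qed (use assms in \<open>auto simp: bdd_integrable_def\<close>)

lemma integrable_indicator_Icc: "integrable lborel (indicator {0..T} :: real \<Rightarrow> real)"
  by (rule integrable_real_indicator) (auto simp: emeasure_lborel_Icc_eq)

lemma bdd_integrable_section:
  assumes "bdd_integrable T K f"
  shows "AE t in lborel. integrable lborel (\<lambda>x. f (t, x))"
  using lborel_pair.AE_integrable_fst'[OF bdd_integrableD(1)[OF assms]] by simp

lemma integrable_time_section:
  assumes f: "bdd_integrable T K f"
  shows "integrable lborel (\<lambda>s. f (s, x))"
proof (rule Bochner_Integration.integrable_bound)
  note [measurable] = bdd_integrableD(2)[OF f]
  show "integrable lborel (\<lambda>s. K * indicator {0..T} s :: real)"
    using integrable_indicator_Icc by auto
  show "AE s in lborel. norm (f (s, x)) \<le> norm (K * indicator {0..T} s :: real)"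
    using bdd_integrableD[OF f] by (auto split: split_indicator)
  show "(\<lambda>s. f (s, x)) \<in> borel_measurable lborel" by measurable
qed

lemma integrable_time_section_ind:
  assumes f: "bdd_integrable T K f"
  shows "integrable lborel (\<lambda>s. indicator {0..t} s * f (s, x))"
  using integrable_mult_indicator[OF _ integrable_time_section[OF f], of "{0..t}"] by auto

lemma integrable_ind:
  assumes f: "integrable plane (f :: real \<times> real \<Rightarrow> real)"
  shows "integrable plane (\<lambda>(s, x). indicator {0..t::real} s * f (s, x))"
proof -
  have [measurable]: "f \<in> borel_measurable plane" using f by auto
  show ?thesis
    by (rule Bochner_Integration.integrable_bound[OF f]) (auto split: split_indicator)
qed

lemma bdd_integrable_ind:
  assumes f: "bdd_integrable T K f"
  shows "integrable plane (\<lambda>(s, x). indicator {0..t} s * f (s, x))"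
  by (rule integrable_ind[OF bdd_integrableD(1)[OF f]])

lemma integrable_prim:
  assumes f: "bdd_integrable T K f"
  shows "integrable lborel (prim f t)"
  using lborel_pair.integrable_snd[OF bdd_integrable_ind[OF f, of t]] unfolding prim_def by simp

lemma prim_measurable:
  assumes f: "bdd_integrable T K f"
  shows "(\<lambda>(t, x). prim f t x) \<in> borel_measurable plane"
proof -
  note [measurable] = bdd_integrableD(2)[OF f]
  have "(\<lambda>(t, x). prim f t x) = (\<lambda>(t, x). LBINT s. (if 0 \<le> s \<and> s \<le> t then f (s, x) else 0))"
    unfolding prim_def by (intro ext) (auto intro!: Bochner_Integration.integral_cong split: split_indicator)
  also have "\<dots> \<in> borel_measurable plane" by measurable
  finally show ?thesis .
qed

lemma prim_bound:
  assumes f: "bdd_integrable T K f" and T: "T \<ge> 0"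
  shows "\<bar>prim f t x\<bar> \<le> T * K"
proof -
  have "\<bar>prim f t x\<bar> \<le> (LBINT s. \<bar>indicator {0..t} s * f (s, x)\<bar>)"
    unfolding prim_def by (rule integral_abs_bound)
  also have "\<dots> \<le> (LBINT s. K * indicator {0..T} s)"
    using integrable_time_section_ind[OF f] bdd_integrableD[OF f] integrable_indicator_Icc
    by (intro integral_mono) (auto split: split_indicator)
  also have "\<dots> = T * K" using T by simp
  finally show ?thesis .
qed

text \<open>The integral of F F' for the primitive F of \<open>a\<close>, which need not be
  differentiable everywhere. Instead the square of side \<open>t\<close> is cut along its diagonal,
  a null set, into two triangles that carry the same integral because \<open>b s * b r\<close> is
  symmetric.\<close>

lemma triangle_integral:
  fixes a :: "real \<Rightarrow> real"
  assumes a: "integrable lborel a"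
  shows "(LBINT s. indicator {0..t} s * ((LBINT r. indicator {0..s} r * a r) * a s))
    = (LBINT s. indicator {0..t} s * a s)\<^sup>2 / 2"
proof -
  have [measurable]: "a \<in> borel_measurable borel" using a by auto
  define b where "b s = indicator {0..t} s * a s" for s
  have b: "integrable lborel b"
    using integrable_mult_indicator[OF _ a, of "{0..t}"] by (simp add: b_def[abs_def])
  have [measurable]: "b \<in> borel_measurable borel" using b by auto
  have bb: "integrable plane (\<lambda>(s, r). b s * b r)"
  proof (rule lborel_pair.Fubini_integrable)
    show "integrable lborel (\<lambda>x. LBINT y. norm (case (x, y) of (s, r) \<Rightarrow> b s * b r))"
      using b by (auto simp: abs_mult)
  qed (use b in auto)
  let ?g = "\<lambda>s r. if r \<le> s then b s * b r else 0"
  have g: "integrable plane (\<lambda>(s, r). ?g s r)"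
    by (rule Bochner_Integration.integrable_bound[OF bb]) auto
  define I where "I = (LBINT s. LBINT r. ?g s r)"
  have I2: "I = (LBINT s. LBINT r. ?g r s)"
    unfolding I_def using lborel_pair.Fubini_integral[OF g] by simp
  have ig: "integrable lborel (\<lambda>s. LBINT r. ?g s r)" "integrable lborel (\<lambda>r. LBINT s. ?g s r)"
    using lborel_pair.integrable_fst[OF g] lborel_pair.integrable_snd[OF g] by simp_all
  have igr: "integrable lborel (\<lambda>r. ?g s r)" "integrable lborel (\<lambda>r. ?g r s)" for s
    by (rule Bochner_Integration.integrable_bound[OF integrable_mult_right[OF b, of "b s"]]; auto simp: mult.commute)+
  have "I + I = (LBINT s. (LBINT r. ?g s r) + (LBINT r. ?g r s))"
    using ig by (subst Bochner_Integration.integral_add) (simp_all flip: I_def I2)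
  also have "\<dots> = (LBINT s. LBINT r. b s * b r)"
  proof (rule Bochner_Integration.integral_cong[OF refl])
    fix s
    have "(LBINT r. ?g s r) + (LBINT r. ?g r s) = (LBINT r. ?g s r + ?g r s)"
      using igr[of s] by simp
    also have "\<dots> = (LBINT r. b s * b r)"
    proof (rule integral_cong_AE)
      show "AE r in lborel. ?g s r + ?g r s = b s * b r"
        using AE_lborel_singleton[of s] by eventually_elim auto
    qed measurable
    finally show "(LBINT r. ?g s r) + (LBINT r. ?g r s) = (LBINT r. b s * b r)" .
  qed
  also have "\<dots> = (LBINT s. b s)\<^sup>2" by (simp add: power2_eq_square)
  finally have "I = (LBINT s. b s)\<^sup>2 / 2" by simp
  moreover have "I = (LBINT s. indicator {0..t} s * ((LBINT r. indicator {0..s} r * a r) * a s))"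
    unfolding I_def
  proof (rule Bochner_Integration.integral_cong[OF refl])
    fix s
    have "(LBINT r. ?g s r) = (LBINT r. (indicator {0..t} s * a s) * (indicator {0..s} r * a r))"
      by (intro Bochner_Integration.integral_cong) (auto simp: b_def split: split_indicator)
    then show "(LBINT r. ?g s r) = indicator {0..t} s * ((LBINT r. indicator {0..s} r * a r) * a s)"
      by simp
  qed
  ultimately show ?thesis by (simp add: b_def)
qed

lemma second_diff_diff_quot:
  "second_diff d g x = (diff_quot d g x - diff_quot d g (x + - d)) / d"
  by (simp add: second_diff_def diff_quot_def power2_eq_square flip: diff_divide_distrib)

text \<open>Summation by parts: the second difference is a backward quotient of the forward
  quotient, and translation invariance moves one of the quotients onto \<open>h\<close> with a
  change of sign.\<close>

lemma integral_second_diff_diff_quot: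
  assumes g: "integrable lborel g" and h: "integrable lborel h" and K: "\<And>x. \<bar>g x\<bar> \<le> K" and d: "d \<noteq> 0"
  shows "(LBINT x. second_diff d g x * h x) = - (LBINT x. diff_quot d g x * diff_quot d h x)"
proof -
  have [measurable]: "g \<in> borel_measurable borel" "h \<in> borel_measurable borel" using g h by auto
  have K0: "K \<ge> 0" using K[of 0] by auto
  have Dg: "\<bar>diff_quot d g x\<bar> \<le> 2 * K / \<bar>d\<bar>" for x
    using K[of x] K[of "x + d"] by (auto simp: diff_quot_def abs_divide intro!: divide_right_mono)
  have [measurable]: "diff_quot d g \<in> borel_measurable borel" unfolding diff_quot_def by measurable
  have i: "integrable lborel (\<lambda>x. diff_quot d g (x + a) * h (x + b))" for a b
  proof (rule Bochner_Integration.integrable_bound)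
    show "integrable lborel (\<lambda>x. (2 * K / \<bar>d\<bar>) * h (x + b))" using integrable_shift[OF h] by auto
    show "AE x in lborel. norm (diff_quot d g (x + a) * h (x + b)) \<le> norm ((2 * K / \<bar>d\<bar>) * h (x + b))"
      using Dg K0 by (auto simp: abs_mult intro!: mult_right_mono simp del: times_divide_eq_left)
  qed measurable
  have "(LBINT x. second_diff d g x * h x)
    = (LBINT x. (diff_quot d g x * h x - diff_quot d g (x + - d) * h x) / d)"
    by (simp add: second_diff_diff_quot left_diff_distrib)
  also have "\<dots> = ((LBINT x. diff_quot d g x * h x) - (LBINT x. diff_quot d g (x + - d) * h x)) / d"
    using i[of 0 0] i[of "- d" 0] by simp
  also have "(LBINT x. diff_quot d g (x + - d) * h x) = (LBINT x. diff_quot d g x * h (x + d))"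
    using integral_shift[of "\<lambda>x. diff_quot d g (x + - d) * h x" d] by simp
  also have "((LBINT x. diff_quot d g x * h x) - (LBINT x. diff_quot d g x * h (x + d))) / d
    = (LBINT x. (diff_quot d g x * h x - diff_quot d g x * h (x + d)) / d)"
    using i[of 0 0] i[of 0 d] by simp
  also have "\<dots> = (LBINT x. - (diff_quot d g x * diff_quot d h x))"
  proof -
    have "(A * b - A * c) / d = - (A * ((c - b) / d))" for A b c :: real
      by (simp add: diff_divide_distrib right_diff_distrib)
    then show ?thesis by (simp only: diff_quot_def[of d h])
  qed
  finally show ?thesis by simp
qed

lemma diff_quot_prim:
  assumes f: "bdd_integrable T K f"
  shows "diff_quot d (prim f t) x = prim (\<lambda>(s, y). diff_quot d (\<lambda>y. f (s, y)) y) t x"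
proof -
  have "prim (\<lambda>(s, y). diff_quot d (\<lambda>y. f (s, y)) y) t x
    = (LBINT s. (indicator {0..t} s * f (s, x + d) - indicator {0..t} s * f (s, x)) / d)"
    by (simp add: diff_quot_def prim_def right_diff_distrib)
  also have "\<dots> = diff_quot d (prim f t) x"
    using integrable_time_section_ind[OF f, of t] by (simp add: diff_quot_def prim_def)
  finally show ?thesis by simp
qed

lemma integrable_shift_snd:
  fixes f :: "real \<times> real \<Rightarrow> real"
  assumes f: "integrable plane f"
  shows "integrable plane (\<lambda>(s, x). f (s, x + a))"
proof (rule lborel_pair.Fubini_integrable)
  have [measurable]: "f \<in> borel_measurable plane" using f by auto
  show "(\<lambda>(s, x). f (s, x + a)) \<in> borel_measurable plane" by measurable
  have "integrable lborel (\<lambda>s. LBINT x. norm (f (s, x)))"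
    using lborel_pair.integrable_fst'[OF integrable_norm[OF f]] .
  then show "integrable lborel (\<lambda>s. LBINT x. norm (case (s, x) of (s, x) \<Rightarrow> f (s, x + a)))"
    using integral_shift[of "\<lambda>x. norm (f (s, x))" a for s] by simp
  show "AE s in lborel. integrable lborel (\<lambda>x. case (s, x) of (s, x) \<Rightarrow> f (s, x + a))"
    using lborel_pair.AE_integrable_fst'[OF f] by eventually_elim (auto intro: integrable_shift)
qed

lemma bdd_integrable_diff_quot:
  assumes f: "bdd_integrable T K f"
  shows "bdd_integrable T (2 * K / \<bar>d\<bar>) (\<lambda>(s, y). diff_quot d (\<lambda>y. f (s, y)) y)"
  unfolding bdd_integrable_def
proof (intro conjI allI impI)
  have "integrable plane (\<lambda>p. ((\<lambda>(s, x). f (s, x + d)) p - (\<lambda>(s, x). f (s, x + 0)) p) / d)"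
    by (intro integrable_divide_zero Bochner_Integration.integrable_diff integrable_shift_snd bdd_integrableD(1)[OF f])
  then show "integrable plane (\<lambda>(s, y). diff_quot d (\<lambda>y. f (s, y)) y)"
    by (simp add: diff_quot_def case_prod_beta')
  fix p :: "real \<times> real"
  show "\<bar>(\<lambda>(s, y). diff_quot d (\<lambda>y. f (s, y)) y) p\<bar> \<le> 2 * K / \<bar>d\<bar>"
    using bdd_integrableD(3)[OF f, of "(fst p, snd p + d)"] bdd_integrableD(3)[OF f, of "(fst p, snd p)"]
    by (auto simp: diff_quot_def abs_divide case_prod_beta intro!: divide_right_mono)
qed (use bdd_integrableD(4)[OF f] in \<open>auto simp: diff_quot_def\<close>)

text \<open>Summation by parts in \<open>x\<close> leaves the product of the difference quotients of
  the primitive and of \<open>f\<close>. Quotients in \<open>x\<close> commute with the primitive in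
  time, so \<open>triangle_integral\<close> applies for each \<open>x\<close> once the order of
  integration is exchanged.\<close>

lemma energy_second_diff:
  assumes f: "bdd_integrable T K f" and T: "T \<ge> 0" and d: "d \<noteq> 0"
  shows "(LBINT s. indicator {0..t} s * (LBINT x. second_diff d (prim f s) x * f (s, x)))
    = - (LBINT x. (diff_quot d (prim f t) x)\<^sup>2) / 2"
proof -
  let ?a = "\<lambda>(s, y). diff_quot d (\<lambda>y. f (s, y)) y"
  note a = bdd_integrable_diff_quot[OF f, of d]
  note [measurable] = bdd_integrableD(2)[OF f] bdd_integrableD(2)[OF a] prim_measurable[OF f] prim_measurable[OF a]
  let ?K = "2 * K / \<bar>d\<bar>"
  have "integrable plane (\<lambda>(s, x). prim ?a s x * ?a (s, x))"
  proof (rule Bochner_Integration.integrable_bound)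
    show "integrable plane (\<lambda>p. (T * ?K) * ?a p)" using bdd_integrableD(1)[OF a] by auto
    show "AE p in plane. norm (case p of (s, x) \<Rightarrow> prim ?a s x * ?a (s, x)) \<le> norm ((T * ?K) * ?a p)"
    proof (intro AE_I2)
      fix p :: "real \<times> real"
      obtain s x where p: "p = (s, x)" by force
      show "norm (case p of (s, x) \<Rightarrow> prim ?a s x * ?a (s, x)) \<le> norm ((T * ?K) * ?a p)"
        using order_trans[OF prim_bound[OF a T, of s x] abs_ge_self]
        unfolding p prod.case real_norm_def abs_mult[of _ "diff_quot _ _ _"] by (intro mult_right_mono) auto
    qed
  qed (use prim_measurable[OF a] bdd_integrableD(2)[OF a] in measurable)
  from integrable_ind[OF this, of t]
  have i: "integrable plane (\<lambda>(s, x). indicator {0..t} s * (prim ?a s x * ?a (s, x)))"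
    by simp
  have "(LBINT s. indicator {0..t} s * (LBINT x. second_diff d (prim f s) x * f (s, x)))
    = (LBINT s. - (LBINT x. indicator {0..t} s * (prim ?a s x * ?a (s, x))))"
  proof (rule integral_cong_AE)
    show "AE s in lborel. indicator {0..t} s * (LBINT x. second_diff d (prim f s) x * f (s, x))
        = - (LBINT x. indicator {0..t} s * (prim ?a s x * ?a (s, x)))"
      using bdd_integrable_section[OF f]
    proof eventually_elim
      case (elim s)
      have "(LBINT x. second_diff d (prim f s) x * f (s, x))
        = - (LBINT x. diff_quot d (prim f s) x * diff_quot d (\<lambda>x. f (s, x)) x)"
        by (rule integral_second_diff_diff_quot[OF integrable_prim[OF f] elim prim_bound[OF f T] d])
      then show ?case by (simp add: diff_quot_prim[OF f])
    qed
    show "(\<lambda>s. indicator {0..t} s * (LBINT x. second_diff d (prim f s) x * f (s, x))) \<in> borel_measurable lborel"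
      unfolding second_diff_def by measurable
    show "(\<lambda>s. - (LBINT x. indicator {0..t} s * (prim ?a s x * ?a (s, x)))) \<in> borel_measurable lborel"
      by measurable
  qed
  also have "\<dots> = - (LBINT x. LBINT s. indicator {0..t} s * (prim ?a s x * ?a (s, x)))"
    using lborel_pair.Fubini_integral[OF i] by simp
  also have "\<dots> = - (LBINT x. (prim ?a t x)\<^sup>2 / 2)"
  proof -
    have "(LBINT s. indicator {0..t} s * (prim ?a s x * ?a (s, x))) = (prim ?a t x)\<^sup>2 / 2" for x
      unfolding prim_def by (rule triangle_integral[OF integrable_time_section[OF a]])
    then show ?thesis by (simp only: integral_minus)
  qed
  finally show ?thesis by (simp add: diff_quot_prim[OF f])
qed

text \<open>The initial datum is zero here. The test functions are quantified inside the almost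
  everywhere, so one null set of times serves all of them.\<close>

definition weak_solution :: "real \<Rightarrow> (real \<times> real \<Rightarrow> real) \<Rightarrow> (real \<times> real \<Rightarrow> real) \<Rightarrow> bool" where
  "weak_solution T z f \<longleftrightarrow> (AE t in lborel. t \<in> {0..T} \<longrightarrow> (\<forall>\<phi>\<in>schwartz.
      (LBINT x. z (t, x) * \<phi> x) = 1 / 2 * (LBINT x. prim f t x * (deriv ^^ 2) \<phi> x)))"

text \<open>The exceptional times do not depend on \<open>d\<close>, so a whole sequence of steps
  can be used at one time.\<close>

lemma weak_solution_stek:
  assumes z: "bdd_integrable T K z" and f: "bdd_integrable T K f" and w: "weak_solution T z f"
  shows "AE t in lborel. t \<in> {0..T} \<longrightarrow> (\<forall>d. d \<noteq> 0 \<longrightarrow>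
     (AE x in lborel. stek d (stek (- d) (\<lambda>x. z (t, x))) x = second_diff d (prim f t) x / 2))"
  using w[unfolded weak_solution_def] bdd_integrable_section[OF z]
proof (eventually_elim, intro impI allI)
  case (elim t)
  fix d :: real assume t: "t \<in> {0..T}" and "d \<noteq> 0"
  have "AE x in lborel. stek d (stek (- d) (\<lambda>x. z (t, x))) x = second_diff d (\<lambda>x. 1 / 2 * prim f t x) x"
    by (rule weak_second_derivative_stek[OF elim(2) _ _ \<open>d \<noteq> 0\<close>])
       (use elim t integrable_prim[OF f] in \<open>auto simp flip: integral_mult_right_zero\<close>)
  then show "AE x in lborel. stek d (stek (- d) (\<lambda>x. z (t, x))) x = second_diff d (prim f t) x / 2"
    by eventually_elim (simp add: second_diff_def field_simps)
qed

text \<open>With S and S' the two averages, S S' f - f = S (S' f - f) + (S f - f), and S does not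
  increase L1 norms. The linearity of S used here asks for integrable sections, which are available
  for almost every \<open>x\<close>.\<close>

lemma stek_stek_minus_L1:
  assumes f: "integrable lborel f"
  shows "(LBINT x. \<bar>stek d (stek (- d) f) x - f x\<bar>)
    \<le> (LBINT x. \<bar>stek d f x - f x\<bar>) + (LBINT x. \<bar>stek (- d) f x - f x\<bar>)"
    (is "?L \<le> ?A + ?B")
proof -
  note i = integrable_stek[OF f, of d] integrable_stek[OF f, of "- d"] integrable_stek[OF integrable_stek[OF f], of d "- d"]
  have "AE x in lborel. integrable unit_uniform (\<lambda>r. stek (- d) f (x + d * r))"
    if "integrable lborel (stek (- d) f)"
    using pair_sigma_finite.AE_integrable_snd[OF _ integrable_avg_pair[OF prob_space_unit_uniform sets_unit_uniform that, of d]]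
    by (simp add: pair_sigma_finite_def sigma_finite_lborel prob_space_imp_sigma_finite prob_space_unit_uniform)
  moreover have "AE x in lborel. integrable unit_uniform (\<lambda>r. f (x + d * r))"
    using pair_sigma_finite.AE_integrable_snd[OF _ integrable_avg_pair[OF prob_space_unit_uniform sets_unit_uniform f, of d]]
    by (simp add: pair_sigma_finite_def sigma_finite_lborel prob_space_imp_sigma_finite prob_space_unit_uniform)
  ultimately have lin: "AE x in lborel. stek d (stek (- d) f) x - stek d f x = stek d (\<lambda>y. stek (- d) f y - f y) x"
    using i by (auto simp: stek_def avg_def elim!: AE_mp)
  have "?L \<le> (LBINT x. \<bar>stek d (\<lambda>y. stek (- d) f y - f y) x\<bar> + \<bar>stek d f x - f x\<bar>)"
  proof (rule integral_mono_AE)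
    show "AE x in lborel. \<bar>stek d (stek (- d) f) x - f x\<bar> \<le> \<bar>stek d (\<lambda>y. stek (- d) f y - f y) x\<bar> + \<bar>stek d f x - f x\<bar>"
      using lin by eventually_elim auto
  qed (use i f integrable_stek[of "\<lambda>y. stek (- d) f y - f y" d] in auto)
  also have "\<dots> = (LBINT x. \<bar>stek d (\<lambda>y. stek (- d) f y - f y) x\<bar>) + ?A"
    using i f integrable_stek[of "\<lambda>y. stek (- d) f y - f y" d] by (intro Bochner_Integration.integral_add) auto
  also have "(LBINT x. \<bar>stek d (\<lambda>y. stek (- d) f y - f y) x\<bar>) \<le> ?B"
    using stek_L1_le[of "\<lambda>y. stek (- d) f y - f y" d] i f by auto
  finally show ?thesis by simp
qed

lemma stek_minus_L1_twice:
  assumes f: "integrable lborel f"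
  shows "(LBINT x. \<bar>stek d f x - f x\<bar>) \<le> 2 * (LBINT x. \<bar>f x\<bar>)"
proof -
  have "(LBINT x. \<bar>stek d f x - f x\<bar>) \<le> (LBINT x. \<bar>stek d f x\<bar> + \<bar>f x\<bar>)"
    using integrable_stek[OF f, of d] f by (intro integral_mono) auto
  also have "\<dots> \<le> 2 * (LBINT x. \<bar>f x\<bar>)"
    using integrable_stek[OF f, of d] f stek_L1_le[OF f, of d] by simp
  finally show ?thesis .
qed

text \<open>In \<open>energy_second_diff\<close>, half the second difference of the primitive at
  time \<open>s\<close> is the double Steklov average of \<open>z\<close> at that time. It tends to
  \<open>z\<close> in L1 while \<open>f\<close> stays bounded, which gives convergence for almost
  every \<open>s\<close>; dominated convergence then integrates over time.\<close>

theorem energy_identity: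
  assumes z: "bdd_integrable T K z" and f: "bdd_integrable T K f" and w: "weak_solution T z f"
    and T: "T \<ge> 0" and t: "t \<in> {0..T}" and Y: "Y \<longlonglongrightarrow> 0" "\<And>n. Y n \<noteq> 0"
  shows "(\<lambda>n. LBINT x. (diff_quot (Y n) (prim f t) x)\<^sup>2)
     \<longlonglongrightarrow> - 4 * (LBINT s. indicator {0..t} s * (LBINT x. z (s, x) * f (s, x)))"
proof -
  note [measurable] = bdd_integrableD(2)[OF f] bdd_integrableD(2)[OF z] prim_measurable[OF f]
  note K = bdd_integrableD(3)[OF f] and K0 = bdd_integrableD(5)[OF f]
  define g where "g n s = indicator {0..t} s * (LBINT x. second_diff (Y n) (prim f s) x / 2 * f (s, x))" for n s
  define h where "h s = indicator {0..t} s * (LBINT x. z (s, x) * f (s, x))" for s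
  have bnd: "AE s in lborel. \<forall>n. \<bar>g n s - h s\<bar> \<le> K * (LBINT x. \<bar>stek (Y n) (\<lambda>x. z (s, x)) x - z (s, x)\<bar>)
       + K * (LBINT x. \<bar>stek (- Y n) (\<lambda>x. z (s, x)) x - z (s, x)\<bar>)"
    using weak_solution_stek[OF z f w] bdd_integrable_section[OF f] bdd_integrable_section[OF z]
  proof (eventually_elim, intro allI)
    case (elim s)
    fix n
    let ?z = "\<lambda>x. z (s, x)"
    let ?S = "stek (Y n) (stek (- Y n) ?z)"
    have iS: "integrable lborel ?S" using elim(3) by (intro integrable_stek)
    have ibz: "integrable lborel (\<lambda>x. F x * f (s, x))" if F: "integrable lborel F" for F
      by (rule integrable_mult_bdd[OF F _ K]) simp
    show "\<bar>g n s - h s\<bar> \<le> K * (LBINT x. \<bar>stek (Y n) ?z x - z (s, x)\<bar>)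
       + K * (LBINT x. \<bar>stek (- Y n) ?z x - z (s, x)\<bar>)"
    proof (cases "s \<in> {0..t}")
      case False
      then show ?thesis using K0 by (auto simp: g_def h_def intro!: add_nonneg_nonneg mult_nonneg_nonneg)
    next
      case True
      then have "s \<in> {0..T}" using t by auto
      then have "AE x in lborel. ?S x = second_diff (Y n) (prim f s) x / 2" using elim(1) Y(2) by blast
      then have "(LBINT x. second_diff (Y n) (prim f s) x / 2 * f (s, x)) = (LBINT x. ?S x * f (s, x))"
        using iS by (intro integral_cong_AE) (auto simp: second_diff_def)
      then have "g n s - h s = (LBINT x. (?S x - z (s, x)) * f (s, x))"
        using True ibz[OF iS] ibz[OF elim(3)] by (simp add: g_def h_def left_diff_distrib)
      then have "\<bar>g n s - h s\<bar> \<le> (LBINT x. \<bar>(?S x - z (s, x)) * f (s, x)\<bar>)"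
        by (simp only: integral_abs_bound)
      also have "\<dots> \<le> (LBINT x. K * \<bar>?S x - z (s, x)\<bar>)"
        using iS elim(3) integrable_abs[OF ibz[OF Bochner_Integration.integrable_diff[OF iS elim(3)]]]
        by (intro integral_mono abs_mult_le K) auto
      also have "\<dots> = K * (LBINT x. \<bar>?S x - z (s, x)\<bar>)" by simp
      also have "\<dots> \<le> K * ((LBINT x. \<bar>stek (Y n) ?z x - z (s, x)\<bar>) + (LBINT x. \<bar>stek (- Y n) ?z x - z (s, x)\<bar>))"
        using stek_stek_minus_L1[OF elim(3)] K0 by (intro mult_left_mono)
      finally show ?thesis by (simp add: distrib_left)
    qed
  qed
  \<comment> \<open>Each of the two averages is at L1 distance at most twice the norm of the
    section, hence \<open>4 * K\<close>; unlike the previous bound, this one does not depend on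
    \<open>n\<close>.\<close>
  have dom: "AE s in lborel. \<forall>n. \<bar>g n s - h s\<bar> \<le> 4 * K * (LBINT x. \<bar>z (s, x)\<bar>)"
    using bnd bdd_integrable_section[OF z]
  proof (eventually_elim, intro allI)
    case (elim s)
    fix n
    note twice = stek_minus_L1_twice[OF elim(2)]
    from mult_left_mono[OF twice[of "Y n"] K0] mult_left_mono[OF twice[of "- Y n"] K0] elim(1)[rule_format, of n]
    show "\<bar>g n s - h s\<bar> \<le> 4 * K * (LBINT x. \<bar>z (s, x)\<bar>)" by simp
  qed
  have z1: "integrable lborel (\<lambda>s. LBINT x. \<bar>z (s, x)\<bar>)"
    using lborel_pair.integrable_fst'[OF integrable_abs[OF bdd_integrableD(1)[OF z]]] .
  have [measurable]: "g n \<in> borel_measurable lborel" for n unfolding g_def second_diff_def by measurable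
  have [measurable]: "h \<in> borel_measurable lborel" unfolding h_def by measurable
  have "(\<lambda>n. LBINT s. g n s - h s) \<longlonglongrightarrow> (LINT s::real|lborel. 0)"
  proof (rule integral_dominated_convergence[where w="\<lambda>s. 4 * K * (LBINT x. \<bar>z (s, x)\<bar>)"])
    show "AE s in lborel. (\<lambda>n. g n s - h s) \<longlonglongrightarrow> 0"
      using bnd bdd_integrable_section[OF z]
    proof eventually_elim
      case (elim s)
      have Y': "(\<lambda>n. - Y n) \<longlonglongrightarrow> 0" using tendsto_minus[OF Y(1)] by simp
      define G where "G n = K * (LBINT x. \<bar>stek (Y n) (\<lambda>x. z (s, x)) x - z (s, x)\<bar>)
       + K * (LBINT x. \<bar>stek (- Y n) (\<lambda>x. z (s, x)) x - z (s, x)\<bar>)" for n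
      have "G \<longlonglongrightarrow> K * 0 + K * 0" unfolding G_def
        by (intro tendsto_intros stek_tendsto_L1[OF elim(2) Y(1)] stek_tendsto_L1[OF elim(2) Y'])
      then have "G \<longlonglongrightarrow> 0" by simp
      moreover have "\<forall>\<^sub>F n in sequentially. norm (g n s - h s) \<le> G n"
        using elim(1) by (simp add: G_def)
      ultimately show ?case by (rule Lim_null_comparison[rotated])
    qed
    show "AE s in lborel. norm (g n s - h s) \<le> 4 * K * (LBINT x. \<bar>z (s, x)\<bar>)" for n
      using dom by eventually_elim simp
  qed (use z1 in auto)
  then have c: "(\<lambda>n. LBINT s. g n s - h s) \<longlonglongrightarrow> 0" by simp
  have zf: "integrable plane (\<lambda>(s, x). z (s, x) * f (s, x))"
    using integrable_mult_bdd[OF bdd_integrableD(1)[OF z] bdd_integrableD(2)[OF f] K] by (simp add: case_prod_beta')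
  have ih: "integrable lborel h"
    using lborel_pair.integrable_fst[OF integrable_ind[OF zf, of t]] by (simp add: h_def[abs_def])
  have "integrable lborel (\<lambda>s. g n s - h s)" for n
  proof -
    have "AE s in lborel. norm (g n s - h s) \<le> norm (4 * K * (LBINT x. \<bar>z (s, x)\<bar>))"
      using dom
    proof eventually_elim
      case (elim s)
      show ?case using order_trans[OF elim[rule_format, of n] abs_ge_self] by simp
    qed
    then show ?thesis
      by (intro Bochner_Integration.integrable_bound[OF integrable_mult_right[OF z1, of "4 * K"]]) auto
  qed
  then have ig: "integrable lborel (g n)" for n
    using Bochner_Integration.integrable_add[OF _ ih, of "\<lambda>s. g n s - h s"] by simp
  have gn: "(LBINT s. g n s) = - (LBINT x. (diff_quot (Y n) (prim f t) x)\<^sup>2) / 4" for n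
  proof -
    have "(LBINT s. g n s) = (LBINT s. (indicator {0..t} s * (LBINT x. second_diff (Y n) (prim f s) x * f (s, x))) / 2)"
      unfolding g_def by (intro Bochner_Integration.integral_cong) auto
    also have "\<dots> = - (LBINT x. (diff_quot (Y n) (prim f t) x)\<^sup>2) / 4"
      using energy_second_diff[OF f T Y(2), of t n] by simp
    finally show ?thesis .
  qed
  have "(\<lambda>n. (LBINT s. g n s) - (LBINT s. h s)) \<longlonglongrightarrow> 0"
    using c ig ih by simp
  then have "(\<lambda>n. LBINT s. g n s) \<longlonglongrightarrow> (LBINT s. h s)"
    by (rule LIM_zero_cancel)
  then have "(\<lambda>n. (- 4) * (LBINT s. g n s)) \<longlonglongrightarrow> (- 4) * (LBINT s. h s)"
    by (intro tendsto_intros)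
  then show ?thesis unfolding gn h_def by simp
qed

section \<open>Uniqueness of distributional solutions\<close>

lemma sum_squared_le:
  fixes a :: "nat \<Rightarrow> real"
  shows "(\<Sum>i<n. a i)\<^sup>2 \<le> real n * (\<Sum>i<n. (a i)\<^sup>2)"
  using sum_squared_le_sum_of_squares[of a "{..<n}"] by (cases "n = 0") (auto simp: mult.commute)

lemma square_integrable_diff_quot:
  assumes g: "integrable lborel g" and K: "\<And>x. \<bar>g x\<bar> \<le> K"
  shows "integrable lborel (\<lambda>x. (diff_quot d g (x + a))\<^sup>2)"
proof -
  have [measurable]: "g \<in> borel_measurable borel" using g by auto
  have D: "\<bar>diff_quot d g x\<bar> \<le> 2 * K / \<bar>d\<bar>" for x
    using K[of x] K[of "x + d"] by (auto simp: diff_quot_def abs_divide intro!: divide_right_mono)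
  have i: "integrable lborel (diff_quot d g)"
    unfolding diff_quot_def using g integrable_shift[OF g] by auto
  have "integrable lborel (\<lambda>x. (diff_quot d g x)\<^sup>2)"
  proof (rule Bochner_Integration.integrable_bound)
    show "integrable lborel (\<lambda>x. (2 * K / \<bar>d\<bar>) * \<bar>diff_quot d g x\<bar>)" using i by auto
    show "AE x in lborel. norm ((diff_quot d g x)\<^sup>2) \<le> norm ((2 * K / \<bar>d\<bar>) * \<bar>diff_quot d g x\<bar>)"
      using order_trans[OF abs_mult_le[OF D] abs_ge_self]
      by (intro AE_I2) (simp only: power2_eq_square real_norm_def)
    show "(\<lambda>x. (diff_quot d g x)\<^sup>2) \<in> borel_measurable lborel" unfolding diff_quot_def by measurable
  qed
  from integrable_shift[OF this] show ?thesis .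
qed

text \<open>The quotient with step \<open>m * d\<close> is the mean of \<open>m\<close> translates
  of the quotient with step \<open>d\<close>; the square of a mean is at most the mean of the
  squares, and translates have equal integrals. For \<open>d = 0\<close> both quotients are zero by
  the convention for division.\<close>

lemma diff_quot_mult_le:
  assumes g: "integrable lborel g" and K: "\<And>x. \<bar>g x\<bar> \<le> K" and m: "m > 0"
  shows "(LBINT x. (diff_quot (real m * d) g x)\<^sup>2) \<le> (LBINT x. (diff_quot d g x)\<^sup>2)"
proof (cases "d = 0")
  case False
  note i = square_integrable_diff_quot[OF g K, of d]
  have "(diff_quot (real m * d) g x)\<^sup>2 \<le> (\<Sum>j<m. (diff_quot d g (x + real j * d))\<^sup>2) / real m" for x
  proof -
    have "(\<Sum>j<m. diff_quot d g (x + real j * d)) = (\<Sum>j<m. g (x + real (Suc j) * d) - g (x + real j * d)) / d"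
      by (simp add: diff_quot_def sum_divide_distrib algebra_simps)
    also have "\<dots> = (g (x + real m * d) - g x) / d"
      by (subst sum_lessThan_telescope) simp
    finally have "diff_quot (real m * d) g x = (\<Sum>j<m. diff_quot d g (x + real j * d)) / real m"
      by (simp add: diff_quot_def mult.commute)
    then have "(diff_quot (real m * d) g x)\<^sup>2 \<le> (real m * (\<Sum>j<m. (diff_quot d g (x + real j * d))\<^sup>2)) / (real m)\<^sup>2"
      using sum_squared_le[of "\<lambda>j. diff_quot d g (x + real j * d)" m] by (simp add: power_divide divide_right_mono)
    also have "\<dots> = (\<Sum>j<m. (diff_quot d g (x + real j * d))\<^sup>2) / real m"
      using m by (simp add: power2_eq_square)
    finally show ?thesis .
  qed
  then have "(LBINT x. (diff_quot (real m * d) g x)\<^sup>2)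
      \<le> (LBINT x. (\<Sum>j<m. (diff_quot d g (x + real j * d))\<^sup>2) / real m)"
    using square_integrable_diff_quot[OF g K, of "real m * d" 0] i by (intro integral_mono) auto
  also have "\<dots> = (\<Sum>j<m. LBINT x. (diff_quot d g (x + real j * d))\<^sup>2) / real m"
    using i by simp
  also have "\<dots> = (LBINT x. (diff_quot d g x)\<^sup>2)"
    using m integral_shift[of "\<lambda>x. (diff_quot d g x)\<^sup>2"] by simp
  finally show ?thesis .
qed (simp add: diff_quot_def)

text \<open>A translation invariant function equals its mean over intervals of length
  \<open>Suc n\<close>, and such a mean is at most the L1 norm divided by that length.\<close>

lemma translation_invariant_imp_zero:
  assumes g: "integrable lborel g" and L: "\<And>y. L1_shift g y = 0"
  shows "AE x in lborel. g x = 0"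
proof -
  have [measurable]: "g \<in> borel_measurable borel" using g by auto
  define C where "C = (LBINT x. \<bar>g x\<bar>)"
  have eq: "AE x in lborel. \<bar>g x\<bar> \<le> C / real (Suc n)" for n
  proof -
    have "(LBINT x. \<bar>stek (real (Suc n)) g x - g x\<bar>) \<le> 0"
      by (rule stek_minus_L1_le[OF g]) (simp add: L)
    moreover have "(LBINT x. \<bar>stek (real (Suc n)) g x - g x\<bar>) \<ge> 0" by simp
    ultimately have "(LBINT x. \<bar>stek (real (Suc n)) g x - g x\<bar>) = 0" by linarith
    then have ae: "AE x in lborel. stek (real (Suc n)) g x = g x"
      using g integrable_stek[OF g, of "real (Suc n)"] by (subst (asm) integral_nonneg_eq_0_iff_AE) auto
    have le: "\<bar>stek (real (Suc n)) g x\<bar> \<le> C / real (Suc n)" for x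
    proof -
      have i: "integrable lborel (\<lambda>r. g (x + real (Suc n) * r))"
        using lborel_integrable_real_affine[OF g, of "real (Suc n)" x] by simp
      have "\<bar>stek (real (Suc n)) g x\<bar> = \<bar>LBINT r. indicator {0..1} r * g (x + real (Suc n) * r)\<bar>"
        by (simp add: stek_def avg_unit_uniform set_lebesgue_integral_def)
      also have "\<dots> \<le> (LBINT r. \<bar>indicator {0..1} r * g (x + real (Suc n) * r)\<bar>)"
        by (rule integral_abs_bound)
      also have "\<dots> \<le> (LBINT r. \<bar>g (x + real (Suc n) * r)\<bar>)"
        using i integrable_mult_indicator[OF _ i, of "{0..1}"]
        by (intro integral_mono) (auto split: split_indicator)
      also have "\<dots> = C / real (Suc n)"
        using lborel_integral_real_affine[of "real (Suc n)" "\<lambda>x. \<bar>g x\<bar>" x] by (simp add: C_def field_simps)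
      finally show ?thesis .
    qed
    from ae show ?thesis
    proof eventually_elim
      case (elim x)
      then show ?case using le[of x] by simp
    qed
  qed
  then have "AE x in lborel. \<forall>n. \<bar>g x\<bar> \<le> C / real (Suc n)" by (simp add: AE_all_countable)
  then show ?thesis
  proof eventually_elim
    case (elim x)
    have "(\<lambda>n. C / real (Suc n)) \<longlonglongrightarrow> 0"
      by (rule LIMSEQ_Suc[OF lim_const_over_n])
    then have "\<bar>g x\<bar> \<le> 0" by (rule LIMSEQ_le_const) (use elim in auto)
    then show ?case by simp
  qed
qed

lemma stek_prim:
  assumes f: "bdd_integrable T K f" and d: "d > 0"
  shows "stek d (\<lambda>s. f (s, x)) t = (prim f (t + d) x - prim f t x) / d"
proof -
  note i = integrable_time_section[OF f, of x]
  have [measurable]: "(\<lambda>s. f (s, x)) \<in> borel_measurable borel" using i by auto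
  have "stek d (\<lambda>s. f (s, x)) t = (LBINT r. indicator {t..t + d} (t + d * r) * f (t + d * r, x))"
    using d by (auto simp: stek_def avg_unit_uniform set_lebesgue_integral_def
        zero_le_mult_iff intro!: Bochner_Integration.integral_cong split: split_indicator)
  also have "\<dots> = (LBINT s. indicator {t..t + d} s * f (s, x)) / d"
    using lborel_integral_real_affine[of d "\<lambda>s. indicator {t..t + d} s * f (s, x)" t] d by (simp add: field_simps)
  also have "(LBINT s. indicator {t..t + d} s * f (s, x))
      = (LBINT s. indicator {0..t + d} s * f (s, x) - indicator {0..t} s * f (s, x))"
  proof (rule integral_cong_AE)
    show "AE s in lborel. indicator {t..t + d} s * f (s, x) = indicator {0..t + d} s * f (s, x) - indicator {0..t} s * f (s, x)"
      using AE_lborel_singleton[of t]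
    proof eventually_elim
      case (elim s)
      \<comment> \<open>If \<open>t < 0\<close>, the two sides also differ in their treatment of
        negative times, and there \<open>f\<close> vanishes.\<close>
      show ?case using elim d bdd_integrableD(4)[OF f, of s x] by (cases "s < 0") (auto split: split_indicator)
    qed
  qed measurable
  also have "\<dots> = prim f (t + d) x - prim f t x"
    using integrable_time_section_ind[OF f] by (simp add: prim_def)
  finally show ?thesis .
qed

lemma prim_beyond:
  assumes f: "bdd_integrable T K f" and T: "T \<ge> 0"
  shows "t < 0 \<Longrightarrow> prim f t x = 0" and "t > T \<Longrightarrow> prim f t x = prim f T x"
  unfolding prim_def using bdd_integrableD(4)[OF f] T
  by (auto intro!: Bochner_Integration.integral_cong split: split_indicator)

text \<open>Once the primitive vanishes at each time, both functions are recovered from it: up to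
  constant factors, its second differences in \<open>x\<close> are double Steklov averages of
  \<open>z\<close>, and its increments in time are Steklov averages of \<open>f\<close>.\<close>

theorem weak_solution_unique:
  assumes z: "bdd_integrable T K z" and f: "bdd_integrable T K f" and w: "weak_solution T z f"
    and T: "T \<ge> 0" and nn: "AE p in plane. z p * f p \<ge> 0"
  shows "AE p in plane. z p = 0 \<and> f p = 0"
proof -
  note [measurable] = bdd_integrableD(2)[OF f] bdd_integrableD(2)[OF z] prim_measurable[OF f]
  have Y1: "(\<lambda>n. 1 / real (Suc n)) \<longlonglongrightarrow> 0" by (rule LIMSEQ_Suc) (rule lim_1_over_n)
  have E: "(LBINT s. indicator {0..t} s * (LBINT x. z (s, x) * f (s, x))) \<ge> 0" for t
  proof (rule integral_nonneg_AE)
    show "AE s in lborel. 0 \<le> indicator {0..t} s * (LBINT x. z (s, x) * f (s, x))"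
      using lborel_pair.AE_pair[OF nn]
    proof eventually_elim
      case (elim s)
      then have "(LBINT x. z (s, x) * f (s, x)) \<ge> 0" by (rule integral_nonneg_AE)
      then show ?case by (simp split: split_indicator)
    qed
  qed
  have lim: "(\<lambda>n. LBINT x. (diff_quot (Y n) (prim f t) x)\<^sup>2) \<longlonglongrightarrow> 0"
    if "t \<in> {0..T}" "Y \<longlonglongrightarrow> 0" "\<And>n. Y n \<noteq> 0" for t Y
  proof -
    note e = energy_identity[OF z f w T that]
    have "0 \<le> - 4 * (LBINT s. indicator {0..t} s * (LBINT x. z (s, x) * f (s, x)))"
      by (rule LIMSEQ_le_const[OF e]) auto
    then show ?thesis using e E[of t] by simp
  qed
  have shift0: "AE x in lborel. prim f t (x + y) = prim f t x" if t: "t \<in> {0..T}" for t y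
  proof (cases "y = 0")
    case False
    note ip = integrable_prim[OF f, of t] and bp = prim_bound[OF f T, of t]
    have "(\<lambda>n. y / real (Suc n)) \<longlonglongrightarrow> 0" by (rule LIMSEQ_Suc[OF lim_const_over_n])
    from lim[OF t this] False
    have l: "(\<lambda>n. LBINT x. (diff_quot (y / real (Suc n)) (prim f t) x)\<^sup>2) \<longlonglongrightarrow> 0" by simp
    have "(LBINT x. (diff_quot y (prim f t) x)\<^sup>2) \<le> 0"
    \<comment> \<open>The step \<open>y\<close> is \<open>Suc n\<close> times the step
      \<open>y / Suc n\<close>, so its quotient is dominated by quotients whose norms tend to
      zero.\<close>
    proof (rule LIMSEQ_le_const[OF l], intro exI allI impI)
      fix n
      show "(LBINT x. (diff_quot y (prim f t) x)\<^sup>2) \<le> (LBINT x. (diff_quot (y / real (Suc n)) (prim f t) x)\<^sup>2)"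
        using diff_quot_mult_le[OF ip bp, of "Suc n" "y / real (Suc n)"] by (simp del: of_nat_Suc)
    qed
    moreover have "(LBINT x. (diff_quot y (prim f t) x)\<^sup>2) \<ge> 0" by simp
    ultimately have "(LBINT x. (diff_quot y (prim f t) x)\<^sup>2) = 0" by linarith
    then have "AE x in lborel. (diff_quot y (prim f t) x)\<^sup>2 = 0"
      using square_integrable_diff_quot[OF ip bp, of y 0] by (subst (asm) integral_nonneg_eq_0_iff_AE) auto
    then show ?thesis using False by (simp add: diff_quot_def)
  qed simp
  have prim0: "AE x in lborel. prim f t x = 0" if t: "t \<in> {0..T}" for t
  proof (rule translation_invariant_imp_zero[OF integrable_prim[OF f]])
    fix y
    have "L1_shift (prim f t) y = (LINT x::real|lborel. 0)"
      unfolding L1_shift_def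
    proof (rule integral_cong_AE)
      show "AE x in lborel. \<bar>prim f t (x + y) - prim f t x\<bar> = 0"
        using shift0[OF t, of y] by eventually_elim simp
    qed measurable
    then show "L1_shift (prim f t) y = 0" by simp
  qed
  have prim0': "AE x in lborel. prim f t x = 0" for t
    using prim0[of t] prim0[of T] prim_beyond[OF f T, of t] T by (cases "t < 0"; cases "t > T") auto
  have "AE t in lborel. AE x in lborel. z (t, x) = 0"
    using weak_solution_stek[OF z f w] bdd_integrable_section[OF z]
  proof eventually_elim
    case (elim t)
    show ?case
    proof (cases "t \<in> {0..T}")
      case True
      let ?z = "\<lambda>x. z (t, x)"
      have SS: "AE x in lborel. stek d (stek (- d) ?z) x = 0" if "d \<noteq> 0" for d
      proof -
        have "AE x in lborel. stek d (stek (- d) ?z) x = second_diff d (prim f t) x / 2"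
          using elim(1) True that by blast
        then show ?thesis using prim0[OF True] AE_shift[OF prim0[OF True], of d] AE_shift[OF prim0[OF True], of "- d"]
          by eventually_elim (simp add: second_diff_def)
      qed
      have le: "(LBINT x. \<bar>?z x\<bar>) \<le> (LBINT x. \<bar>stek d ?z x - ?z x\<bar>) + (LBINT x. \<bar>stek (- d) ?z x - ?z x\<bar>)"
        if "d \<noteq> 0" for d
      proof -
        have [measurable]: "stek d (stek (- d) ?z) \<in> borel_measurable borel"
          using elim(2) by (intro stek_measurable) auto
        have "(LBINT x. \<bar>?z x\<bar>) = (LBINT x. \<bar>stek d (stek (- d) ?z) x - ?z x\<bar>)"
        proof (rule integral_cong_AE)
          show "AE x in lborel. \<bar>?z x\<bar> = \<bar>stek d (stek (- d) ?z) x - ?z x\<bar>"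
            using SS[OF that] by eventually_elim simp
        qed measurable
        then show ?thesis using stek_stek_minus_L1[OF elim(2), of d] by linarith
      qed
      have Y1': "(\<lambda>n. - (1 / real (Suc n))) \<longlonglongrightarrow> 0" using tendsto_minus[OF Y1] by simp
      have "(\<lambda>n. (LBINT x. \<bar>stek (1 / real (Suc n)) ?z x - ?z x\<bar>) + (LBINT x. \<bar>stek (- (1 / real (Suc n))) ?z x - ?z x\<bar>)) \<longlonglongrightarrow> 0 + 0"
        by (intro tendsto_add stek_tendsto_L1[OF elim(2)] Y1 Y1')
      then have "(LBINT x. \<bar>?z x\<bar>) \<le> 0 + 0"
        by (rule LIMSEQ_le_const) (use le in auto)
      moreover have "(LBINT x. \<bar>?z x\<bar>) \<ge> 0" by simp
      ultimately have "(LBINT x. \<bar>?z x\<bar>) = 0" by linarith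
      then show ?thesis using elim(2) by (subst (asm) integral_nonneg_eq_0_iff_AE) auto
    next
      case False
      then show ?thesis using bdd_integrableD(4)[OF z] by auto
    qed
  qed
  then have z0: "AE p in plane. z p = 0"
    by (intro lborel_pair.AE_pair_measure; (measurable)?)
  \<comment> \<open>The null set of \<open>x\<close> off which the primitive vanishes depends on
    \<open>t\<close>. Fubini turns this into almost every \<open>x\<close> and then almost every
    \<open>t\<close>, for countably many time increments at once.\<close>
  have "AE x in lborel. \<forall>n. AE t in lborel. prim f (t + 1 / real (Suc n)) x = 0 \<and> prim f t x = 0"
    unfolding AE_all_countable
  proof
    fix n
    have "AE t in lborel. AE x in lborel. prim f (t + 1 / real (Suc n)) x = 0 \<and> prim f t x = 0"
      using prim0' by auto
    then show "AE x in lborel. AE t in lborel. prim f (t + 1 / real (Suc n)) x = 0 \<and> prim f t x = 0"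
      by (subst (asm) lborel_pair.AE_commute) measurable
  qed
  then have "AE x in lborel. AE t in lborel. f (t, x) = 0"
  proof eventually_elim
    case (elim x)
    show ?case
    proof (rule stek_zero_imp_zero[OF integrable_time_section[OF f] Y1])
      fix n
      show "AE t in lborel. stek (1 / real (Suc n)) (\<lambda>s. f (s, x)) t = 0"
        using elim[rule_format, of n]
      proof eventually_elim
        case (elim t)
        then show ?case using stek_prim[OF f, of "1 / real (Suc n)" x t] by simp
      qed
    qed
  qed
  then have "AE t in lborel. AE x in lborel. f (t, x) = 0"
    by (subst lborel_pair.AE_commute) measurable
  then have f0: "AE p in plane. f p = 0"
    by (intro lborel_pair.AE_pair_measure; (measurable)?)
  from z0 f0 show ?thesis by eventually_elim simp
qed

section \<open>Transfer between the strip and the plane\<close>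

lemma strip_eq: "strip T = restrict_space plane ({0..T} \<times> UNIV)"
  unfolding strip_def
proof (rule pair_measure_eqI)
  show "sigma_finite_measure (restrict_space (lborel :: real measure) {0..T})"
    by (rule sigma_finite_measure_restrict_space[OF sigma_finite_lborel]) simp
  show "sigma_finite_measure (lborel :: real measure)" by (rule sigma_finite_lborel)
  show "sets (restrict_space (lborel :: real measure) {0..T} \<Otimes>\<^sub>M (lborel :: real measure))
    = sets (restrict_space plane ({0..T} \<times> (UNIV :: real set)))" (is "sets ?M = sets ?N")
  proof (intro equalityI)
    show "sets ?M \<subseteq> sets ?N"
    proof (rule sets_pair_in_sets)
      fix a b :: "real set" assume "a \<in> sets (restrict_space lborel {0..T})" "b \<in> sets lborel"
      then have "a \<in> sets lborel" "a \<subseteq> {0..T}" "b \<in> sets lborel" by (auto simp: sets_restrict_space_iff)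
      then show "a \<times> b \<in> sets ?N" by (subst sets_restrict_space_iff) auto
    qed
    have id: "(\<lambda>p. p) \<in> measurable ?M plane"
      by (intro measurable_pair measurable_compose[OF measurable_fst measurable_restrict_space1])
         (auto simp: comp_def intro!: measurable_compose[OF measurable_fst] measurable_restrict_space1)
    show "sets ?N \<subseteq> sets ?M"
    proof
      fix S assume "S \<in> sets ?N"
      then obtain S' where S': "S' \<in> sets plane" "S = ({0..T} \<times> UNIV) \<inter> S'"
        by (auto simp: sets_restrict_space)
      have "(\<lambda>p. p) -` S' \<inter> space ?M \<in> sets ?M" by (rule measurable_sets[OF id S'(1)])
      then show "S \<in> sets ?M" using S'(2) by (simp add: space_pair_measure Int_commute)
    qed
  qed
  fix A B :: "real set"
  assume A: "A \<in> sets (restrict_space lborel {0..T})" and B: "B \<in> sets lborel"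
  then have A': "A \<in> sets borel" "A \<subseteq> {0..T}" by (auto simp: sets_restrict_space_iff)
  show "emeasure (restrict_space lborel {0..T}) A * emeasure lborel B
      = emeasure (restrict_space plane ({0..T} \<times> UNIV)) (A \<times> B)"
    using A' B by (subst (1 2) emeasure_restrict_space) (auto simp: lborel.emeasure_pair_measure_Times)
qed

lemma AE_strip:
  "(AE p in strip T. P p) \<longleftrightarrow> (AE p in plane. p \<in> {0..T} \<times> UNIV \<longrightarrow> P p)"
  unfolding strip_eq by (subst AE_restrict_space_iff) auto

lemma integrable_strip:
  fixes f :: "real \<times> real \<Rightarrow> real"
  shows "integrable (strip T) f \<longleftrightarrow> integrable plane (\<lambda>p. indicator ({0..T} \<times> UNIV) p * f p)"
  unfolding strip_eq by (subst integrable_restrict_space) auto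

lemma AE_time: "(AE t in restrict_space lborel {0..T::real}. P t) \<longleftrightarrow> (AE t in lborel. t \<in> {0..T} \<longrightarrow> P t)"
  by (subst AE_restrict_space_iff) auto

lemma L1_Linf_bound:
  assumes "f \<in> L1_Linf M"
  obtains K where "K \<ge> 0" "AE x in M. \<bar>f x\<bar> \<le> K"
proof -
  obtain K :: nat where "Linf_norm M f < ereal (real K)"
    using assms less_PInf_Ex_of_nat[of "Linf_norm M f"] unfolding L1_Linf_def by auto
  then have "AE x in M. \<bar>f x\<bar> \<le> max K 0"
    using esssup_AE[of "\<lambda>x. ereal \<bar>f x\<bar>" M] unfolding Linf_norm_def
    by (auto elim!: eventually_mono dest: order_trans less_imp_le)
  then show ?thesis by (intro that[of "max K 0"]) auto
qed

lemma Linf_norm_le: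
  assumes [measurable]: "f \<in> borel_measurable M" and "AE x in M. \<bar>f x\<bar> \<le> K"
  shows "Linf_norm M f \<le> ereal K"
  unfolding Linf_norm_def by (rule esssup_I) (use assms in auto)

text \<open>For \<open>K\<close> above the essential bound this agrees with \<open>f\<close> almost
  everywhere on the strip, and it has the pointwise properties that \<open>bdd_integrable\<close>
  demands.\<close>

definition cutoff :: "real \<Rightarrow> real \<Rightarrow> (real \<times> real \<Rightarrow> real) \<Rightarrow> real \<times> real \<Rightarrow> real" where
  "cutoff T K f p = indicator ({0..T} \<times> UNIV) p * max (- K) (min K (f p))"

lemma cutoff_bdd_integrable:
  assumes f: "f \<in> L1_Linf (strip T)" and K: "K \<ge> 0"
  shows "bdd_integrable T K (cutoff T K f)"
  unfolding bdd_integrable_def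
proof (intro conjI allI impI)
  have i: "integrable plane (\<lambda>p. indicator ({0..T} \<times> UNIV) p * f p)"
    using f integrable_strip unfolding L1_Linf_def by blast
  then have [measurable]: "(\<lambda>p. indicator ({0..T} \<times> UNIV) p * f p) \<in> borel_measurable plane"
    by auto
  have eq: "cutoff T K f = (\<lambda>p. max (- K) (min K (indicator ({0..T} \<times> UNIV) p * f p)))"
    using K by (auto simp: cutoff_def fun_eq_iff split: split_indicator)
  show "integrable plane (cutoff T K f)"
    unfolding eq by (rule Bochner_Integration.integrable_bound[OF i]) (use K in auto)
qed (use K in \<open>auto simp: cutoff_def split: split_indicator\<close>)

lemma cutoff_AE:
  assumes "AE p in strip T. \<bar>f p\<bar> \<le> K"
  shows "AE p in strip T. cutoff T K f p = f p"
  using assms unfolding AE_strip by eventually_elim (auto simp: cutoff_def split: split_indicator)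

lemma AE_strip_section:
  assumes "AE p in strip T. P p"
  shows "AE t in lborel. t \<in> {0..T} \<longrightarrow> (AE x in lborel. P (t, x))"
  using lborel_pair.AE_pair[OF assms[unfolded AE_strip]] by eventually_elim auto

lemma integral_prim_mult:
  assumes f: "bdd_integrable T K f" and [measurable]: "g \<in> borel_measurable borel" and B: "\<And>x. \<bar>g x\<bar> \<le> B"
  shows "(LBINT x. prim f t x * g x) = (LBINT s. indicator {0..t} s * (LBINT x. f (s, x) * g x))"
    and "integrable lborel (\<lambda>s. indicator {0..t} s * (LBINT x. f (s, x) * g x))"
proof -
  note [measurable] = bdd_integrableD(2)[OF f]
  have i: "integrable plane (\<lambda>(s, x). indicator {0..t} s * f (s, x) * g x)"
  proof (rule Bochner_Integration.integrable_bound)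
    show "integrable plane (\<lambda>p. B * f p)" using bdd_integrableD(1)[OF f] by auto
    show "AE p in plane. norm (case p of (s, x) \<Rightarrow> indicator {0..t} s * f (s, x) * g x) \<le> norm (B * f p)"
    proof (intro AE_I2)
      fix p :: "real \<times> real"
      obtain s x where p: "p = (s, x)" by force
      have "\<bar>f (s, x) * g x\<bar> \<le> B * \<bar>f (s, x)\<bar>" by (rule abs_mult_le[OF B])
      also have "\<dots> \<le> \<bar>B * f (s, x)\<bar>" by (simp add: abs_mult mult_right_mono)
      finally show "norm (case p of (s, x) \<Rightarrow> indicator {0..t} s * f (s, x) * g x) \<le> norm (B * f p)"
        by (auto simp: p split: split_indicator)
    qed
  qed measurable
  have "(LBINT x. prim f t x * g x) = (LBINT x. LBINT s. indicator {0..t} s * f (s, x) * g x)"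
    by (simp add: prim_def)
  also have "\<dots> = (LBINT s. LBINT x. indicator {0..t} s * f (s, x) * g x)"
    using lborel_pair.Fubini_integral[OF i] by simp
  finally show "(LBINT x. prim f t x * g x) = (LBINT s. indicator {0..t} s * (LBINT x. f (s, x) * g x))"
    by (simp add: mult.assoc)
  show "integrable lborel (\<lambda>s. indicator {0..t} s * (LBINT x. f (s, x) * g x))"
    using lborel_pair.integrable_fst[OF i] by (simp add: mult.assoc)
qed

lemma integral_strip_section:
  assumes f: "f \<in> L1_Linf (strip T)" and K: "K \<ge> 0" and b: "AE p in strip T. \<bar>f p\<bar> \<le> K"
    and \<psi>: "\<psi> \<in> schwartz" and t: "t \<in> {0..T}"
  shows "(LINT s:{0..t}|lborel. (LBINT x. f (s, x) * \<psi> x)) = (LBINT x. prim (cutoff T K f) t x * \<psi> x)"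
proof -
  note [measurable] = schwartz_measurable[OF \<psi>]
  obtain B where B: "\<And>x. \<bar>\<psi> x\<bar> \<le> B" using schwartz_bounded[OF \<psi>] by blast
  note bc = cutoff_bdd_integrable[OF f K]
  note [measurable] = bdd_integrableD(2)[OF bc]
  have "integrable plane (\<lambda>p. indicator ({0..T} \<times> UNIV) p * f p)"
    using f integrable_strip unfolding L1_Linf_def by blast
  then have [measurable]: "(\<lambda>p. indicator ({0..T} \<times> UNIV) p * f p) \<in> borel_measurable plane"
    by auto
  \<comment> \<open>Measurability of \<open>f\<close> is known on the strip; with the indicator
    inserted the integrand is measurable on the plane, as the comparison of integrals
    demands.\<close>
  have "(LINT s:{0..t}|lborel. (LBINT x. f (s, x) * \<psi> x))
    = (LBINT s. indicator {0..t} s * (LBINT x. indicator ({0..T} \<times> UNIV) (s, x) * f (s, x) * \<psi> x))"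
    unfolding set_lebesgue_integral_def using t
    by (intro Bochner_Integration.integral_cong) (auto split: split_indicator)
  also have "\<dots> = (LBINT s. indicator {0..t} s * (LBINT x. cutoff T K f (s, x) * \<psi> x))"
  proof (rule integral_cong_AE)
    show "AE s in lborel. indicator {0..t} s * (LBINT x. indicator ({0..T} \<times> UNIV) (s, x) * f (s, x) * \<psi> x)
      = indicator {0..t} s * (LBINT x. cutoff T K f (s, x) * \<psi> x)"
      using AE_strip_section[OF cutoff_AE[OF b]]
    proof eventually_elim
      case (elim s)
      show ?case
      proof (cases "s \<in> {0..t}")
        case True
        then have ae: "AE x in lborel. cutoff T K f (s, x) = f (s, x)" and s: "s \<in> {0..T}" using elim t by auto
        have "(LBINT x. indicator ({0..T} \<times> UNIV) (s, x) * f (s, x) * \<psi> x) = (LBINT x. cutoff T K f (s, x) * \<psi> x)"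
        proof (rule integral_cong_AE)
          from ae show "AE x in lborel. indicator ({0..T} \<times> UNIV) (s, x) * f (s, x) * \<psi> x = cutoff T K f (s, x) * \<psi> x"
          proof eventually_elim
            case (elim x)
            then show ?case using s by simp
          qed
        qed measurable
        then show ?thesis by simp
      qed auto
    qed
  qed measurable
  also have "\<dots> = (LBINT x. prim (cutoff T K f) t x * \<psi> x)"
    by (rule integral_prim_mult(1)[OF bc _ B, symmetric]) measurable
  finally show ?thesis .
qed

lemma distributional_solution_cutoff:
  assumes sol: "distributional_solution T \<beta> u0 u \<eta>" and K: "K \<ge> 0"
    and u: "AE p in strip T. \<bar>u p\<bar> \<le> K" and \<eta>: "AE p in strip T. \<bar>\<eta> p\<bar> \<le> K"
  shows "AE t in lborel. t \<in> {0..T} \<longrightarrow> (\<forall>\<phi>\<in>schwartz.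
      (LBINT x. cutoff T K u (t, x) * \<phi> x) =
      (LBINT x. u0 x * \<phi> x) + 1 / 2 * (LBINT x. prim (cutoff T K \<eta>) t x * (deriv ^^ 2) \<phi> x))"
proof -
  have uL: "u \<in> L1_Linf (strip T)" and \<eta>L: "\<eta> \<in> L1_Linf (strip T)"
    and eq: "AE t in lborel. t \<in> {0..T} \<longrightarrow> (\<forall>\<phi>\<in>schwartz.
        (LBINT x. u (t, x) * \<phi> x) = (LBINT x. u0 x * \<phi> x)
          + 1 / 2 * (LINT s:{0..t}|lborel. (LBINT x. \<eta> (s, x) * (deriv ^^ 2) \<phi> x)))"
    using sol unfolding distributional_solution_def AE_time by auto
  note bu = cutoff_bdd_integrable[OF uL K]
  note [measurable] = bdd_integrableD(2)[OF bu]
  have "integrable plane (\<lambda>p. indicator ({0..T} \<times> UNIV) p * u p)"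
    using uL integrable_strip unfolding L1_Linf_def by blast
  then have [measurable]: "(\<lambda>p. indicator ({0..T} \<times> UNIV) p * u p) \<in> borel_measurable plane"
    by auto
  show ?thesis using eq AE_strip_section[OF cutoff_AE[OF u]]
  proof (eventually_elim, intro impI ballI)
    case (elim t)
    fix \<phi> :: "real \<Rightarrow> real" assume t: "t \<in> {0..T}" and \<phi>: "\<phi> \<in> schwartz"
    note [measurable] = schwartz_measurable[OF \<phi>]
    have "(LBINT x. cutoff T K u (t, x) * \<phi> x) = (LBINT x. indicator ({0..T} \<times> UNIV) (t, x) * u (t, x) * \<phi> x)"
    proof (rule integral_cong_AE)
      show "AE x in lborel. cutoff T K u (t, x) * \<phi> x = indicator ({0..T} \<times> UNIV) (t, x) * u (t, x) * \<phi> x"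
        using elim(2)[rule_format, OF t] t by (auto elim!: eventually_mono)
    qed measurable
    also have "\<dots> = (LBINT x. u (t, x) * \<phi> x)" using t by simp
    also have "\<dots> = (LBINT x. u0 x * \<phi> x) + 1 / 2 * (LBINT x. prim (cutoff T K \<eta>) t x * (deriv ^^ 2) \<phi> x)"
      using elim(1) t \<phi> integral_strip_section[OF \<eta>L K \<eta> schwartz_funpow_deriv[OF \<phi>] t, of 2] by simp
    finally show "(LBINT x. cutoff T K u (t, x) * \<phi> x) =
      (LBINT x. u0 x * \<phi> x) + 1 / 2 * (LBINT x. prim (cutoff T K \<eta>) t x * (deriv ^^ 2) \<phi> x)" .
  qed
qed

lemma distributional_solutionI:
  assumes u: "bdd_integrable T K u" and \<eta>: "bdd_integrable T K \<eta>"
    and eq: "AE t in lborel. t \<in> {0..T} \<longrightarrow> (\<forall>\<phi>\<in>schwartz. (LBINT x. u (t, x) * \<phi> x) =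
      (LBINT x. u0 x * \<phi> x) + 1 / 2 * (LBINT x. prim \<eta> t x * (deriv ^^ 2) \<phi> x))"
    and \<beta>: "AE p in plane. p \<in> {0..T} \<times> UNIV \<longrightarrow> \<eta> p \<in> \<beta> `` {u p}"
  shows "distributional_solution T \<beta> u0 u \<eta>"
  unfolding distributional_solution_def AE_time
proof (intro conjI)
  have "f \<in> L1_Linf (strip T)" if f: "bdd_integrable T K f" for f
  proof -
    have "integrable (strip T) f"
      unfolding integrable_strip
      using bdd_integrableD(1)[OF f] by (rule Bochner_Integration.integrable_bound)
        (use bdd_integrableD(2)[OF f] in \<open>auto split: split_indicator\<close>)
    moreover from this have "Linf_norm (strip T) f \<le> ereal K"
      using bdd_integrableD(3)[OF f] by (intro Linf_norm_le) auto
    ultimately show ?thesis unfolding L1_Linf_def by (auto intro: le_less_trans)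
  qed
  from this[OF u] this[OF \<eta>] show "u \<in> L1_Linf (strip T)" "\<eta> \<in> L1_Linf (strip T)" by auto
  show "AE p in strip T. \<eta> p \<in> \<beta> `` {u p}" using \<beta> by (simp add: AE_strip)
  show "AE t in lborel. t \<in> {0..T} \<longrightarrow> (\<forall>\<phi>\<in>schwartz.
        (LBINT x. u (t, x) * \<phi> x) = (LBINT x. u0 x * \<phi> x)
          + 1 / 2 * (LINT s:{0..t}|lborel. (LBINT x. \<eta> (s, x) * (deriv ^^ 2) \<phi> x)))"
    using eq
  proof (eventually_elim, intro impI ballI)
    case (elim t)
    fix \<phi> :: "real \<Rightarrow> real" assume t: "t \<in> {0..T}" and \<phi>: "\<phi> \<in> schwartz"
    note \<phi>2 = schwartz_funpow_deriv[OF \<phi>, of 2]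
    obtain B where B: "\<And>x. \<bar>(deriv ^^ 2) \<phi> x\<bar> \<le> B" using schwartz_bounded[OF \<phi>2] by blast
    have "(LBINT x. prim \<eta> t x * (deriv ^^ 2) \<phi> x) = (LINT s:{0..t}|lborel. (LBINT x. \<eta> (s, x) * (deriv ^^ 2) \<phi> x))"
      using integral_prim_mult(1)[OF \<eta> schwartz_measurable[OF \<phi>2] B] by (simp add: set_lebesgue_integral_def)
    then show "(LBINT x. u (t, x) * \<phi> x) = (LBINT x. u0 x * \<phi> x)
          + 1 / 2 * (LINT s:{0..t}|lborel. (LBINT x. \<eta> (s, x) * (deriv ^^ 2) \<phi> x))"
      using elim t \<phi> by simp
  qed
qed

text \<open>Both solutions are cut off at one common bound, which changes them on null sets only; in
  the difference the initial data cancel, so it is a \<open>weak_solution\<close>.\<close>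

theorem distributional_solution_unique:
  assumes T: "T \<ge> 0" and mono: "monotone_graph \<beta>"
    and s: "distributional_solution T \<beta> u0 u \<eta>" and s': "distributional_solution T \<beta> u0 u' \<eta>'"
  shows "AE p in strip T. u' p = u p \<and> \<eta>' p = \<eta> p"
proof -
  have L: "u \<in> L1_Linf (strip T)" "\<eta> \<in> L1_Linf (strip T)" "u' \<in> L1_Linf (strip T)" "\<eta>' \<in> L1_Linf (strip T)"
    and b: "AE p in strip T. \<eta> p \<in> \<beta> `` {u p}" "AE p in strip T. \<eta>' p \<in> \<beta> `` {u' p}"
    using s s' unfolding distributional_solution_def by auto
  obtain K1 K2 K3 K4 where K1: "AE p in strip T. \<bar>u p\<bar> \<le> K1" "K1 \<ge> 0" and K2: "AE p in strip T. \<bar>\<eta> p\<bar> \<le> K2" "K2 \<ge> 0"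
    and K3: "AE p in strip T. \<bar>u' p\<bar> \<le> K3" "K3 \<ge> 0" and K4: "AE p in strip T. \<bar>\<eta>' p\<bar> \<le> K4" "K4 \<ge> 0"
    using L by (metis L1_Linf_bound)
  define K where "K = K1 + K2 + K3 + K4"
  have K: "K \<ge> 0" using K1 K2 K3 K4 by (simp add: K_def)
  have bd: "AE p in strip T. \<bar>u p\<bar> \<le> K" "AE p in strip T. \<bar>\<eta> p\<bar> \<le> K"
    "AE p in strip T. \<bar>u' p\<bar> \<le> K" "AE p in strip T. \<bar>\<eta>' p\<bar> \<le> K"
    subgoal using K1(1) by eventually_elim (use K1 K2 K3 K4 in \<open>auto simp: K_def\<close>)
    subgoal using K2(1) by eventually_elim (use K1 K2 K3 K4 in \<open>auto simp: K_def\<close>)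
    subgoal using K3(1) by eventually_elim (use K1 K2 K3 K4 in \<open>auto simp: K_def\<close>)
    subgoal using K4(1) by eventually_elim (use K1 K2 K3 K4 in \<open>auto simp: K_def\<close>)
    done
  let ?c = "cutoff T K"
  note c = cutoff_bdd_integrable[OF L(1) K] cutoff_bdd_integrable[OF L(2) K]
    cutoff_bdd_integrable[OF L(3) K] cutoff_bdd_integrable[OF L(4) K]
  have diff: "bdd_integrable T (2 * K) (\<lambda>p. f p - g p)" if "bdd_integrable T K f" "bdd_integrable T K g" for f g
  proof -
    have "\<bar>f p - g p\<bar> \<le> 2 * K" for p
      using bdd_integrableD(3)[OF that(1), of p] bdd_integrableD(3)[OF that(2), of p] by linarith
    then show ?thesis
      using bdd_integrableD[OF that(1)] bdd_integrableD[OF that(2)] unfolding bdd_integrable_def by auto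
  qed
  note z = diff[OF c(3) c(1)] and f = diff[OF c(4) c(2)]
  have w: "weak_solution T (\<lambda>p. ?c u' p - ?c u p) (\<lambda>p. ?c \<eta>' p - ?c \<eta> p)"
    unfolding weak_solution_def
    using distributional_solution_cutoff[OF s K bd(1,2)] distributional_solution_cutoff[OF s' K bd(3,4)]
      bdd_integrable_section[OF c(1)] bdd_integrable_section[OF c(3)]
  proof (eventually_elim, intro impI ballI)
    case (elim t)
    fix \<phi> :: "real \<Rightarrow> real" assume t: "t \<in> {0..T}" and \<phi>: "\<phi> \<in> schwartz"
    have i: "integrable lborel (\<lambda>x. g x * \<psi> x)" if g: "integrable lborel g" and \<psi>: "\<psi> \<in> schwartz" for g \<psi> :: "real \<Rightarrow> real"
    proof -
      obtain B where B: "\<And>x. \<bar>\<psi> x\<bar> \<le> B" using schwartz_bounded[OF \<psi>] by blast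
      show ?thesis by (rule integrable_mult_bdd[OF g _ B]) (use schwartz_measurable[OF \<psi>] in simp)
    qed
    note \<phi>2 = schwartz_funpow_deriv[OF \<phi>, of 2]
    have pr: "prim (\<lambda>p. ?c \<eta>' p - ?c \<eta> p) t x = prim (?c \<eta>') t x - prim (?c \<eta>) t x" for x
      using integrable_time_section_ind[OF c(2)] integrable_time_section_ind[OF c(4)]
      by (simp add: prim_def right_diff_distrib)
    show "(LBINT x. (?c u' (t, x) - ?c u (t, x)) * \<phi> x) =
        1 / 2 * (LBINT x. prim (\<lambda>p. ?c \<eta>' p - ?c \<eta> p) t x * (deriv ^^ 2) \<phi> x)"
      using elim(1,2)[rule_format, OF t \<phi>] i[OF elim(3) \<phi>] i[OF elim(4) \<phi>]
        i[OF integrable_prim[OF c(2)] \<phi>2] i[OF integrable_prim[OF c(4)] \<phi>2]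
      by (simp add: pr left_diff_distrib)
  qed
  have nn: "AE p in plane. (?c u' p - ?c u p) * (?c \<eta>' p - ?c \<eta> p) \<ge> 0"
    using b[unfolded AE_strip] cutoff_AE[OF bd(1), unfolded AE_strip] cutoff_AE[OF bd(2), unfolded AE_strip]
      cutoff_AE[OF bd(3), unfolded AE_strip] cutoff_AE[OF bd(4), unfolded AE_strip]
  proof eventually_elim
    case (elim p)
    show ?case
    proof (cases "p \<in> {0..T} \<times> UNIV")
      case True
      then show ?thesis using elim mono unfolding monotone_graph_def by metis
    qed (simp add: cutoff_def)
  qed
  have "AE p in plane. ?c u' p - ?c u p = 0 \<and> ?c \<eta>' p - ?c \<eta> p = 0"
    by (rule weak_solution_unique[OF z f w T nn])
  then show ?thesis
    unfolding AE_strip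
    using cutoff_AE[OF bd(1), unfolded AE_strip] cutoff_AE[OF bd(2), unfolded AE_strip]
      cutoff_AE[OF bd(3), unfolded AE_strip] cutoff_AE[OF bd(4), unfolded AE_strip]
    by eventually_elim auto
qed

section \<open>Almost everywhere convergence of convex combinations\<close>

lemma sum_atMost_extend:
  fixes F :: "nat \<Rightarrow> 'b::real_vector"
  assumes "\<And>k. k > m \<Longrightarrow> c k = 0" "m \<le> m'"
  shows "(\<Sum>k\<le>m. c k *\<^sub>R F k) = (\<Sum>k\<le>m'. c k *\<^sub>R F k)"
  using assms by (intro sum.mono_neutral_left) auto

text \<open>Near-minimisers of the \<open>L\<^sup>2\<close> norm over the convex hulls of the tails form a Cauchy sequence, by the
  parallelogram identity. This replaces weak compactness.\<close>

lemma convex_tail_AE_convergent: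
  fixes f :: "nat \<Rightarrow> 'a \<Rightarrow> 'b::{banach, real_inner, second_countable_topology}"
  assumes M: "finite_measure M" and f [measurable]: "\<And>k. f k \<in> borel_measurable M"
    and C: "\<And>k x. norm (f k x) \<le> C"
  obtains c :: "nat \<Rightarrow> nat \<Rightarrow> real" and m where "\<And>n k. c n k \<ge> 0" "\<And>n k. k < n \<Longrightarrow> c n k = 0"
    "\<And>n. (\<Sum>k\<le>m n. c n k) = 1" "AE x in M. convergent (\<lambda>n. \<Sum>k\<le>m n. c n k *\<^sub>R f k x)"
proof -
  interpret finite_measure M by fact
  \<comment> \<open>Pairs of a last index and a weight function: the finite convex combinations of
    the functions with index at least \<open>n\<close>. The weights vanish beyond the last index, so
    that sums of different lengths can be compared.\<close>
  define W where "W n = {(m, c) | (m :: nat) (c :: nat \<Rightarrow> real).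
      (\<forall>k. c k \<ge> 0) \<and> (\<forall>k. k < n \<or> k > m \<longrightarrow> c k = 0) \<and> (\<Sum>k\<le>m. c k) = 1}" for n
  define G where "G w x = (\<Sum>k\<le>fst w. snd w k *\<^sub>R f k x)" for w x
  define N where "N w = (LINT x|M. (norm (G w x))\<^sup>2)" for w
  define a where "a n = (INF w\<in>W n. N w)" for n
  have [measurable]: "G w \<in> borel_measurable M" for w unfolding G_def by measurable
  have Gb: "norm (G w x) \<le> C" if "w \<in> W n" for w n x
  proof -
    have "norm (G w x) \<le> (\<Sum>k\<le>fst w. snd w k * C)"
      unfolding G_def using that C by (intro sum_norm_le) (auto simp: W_def mult_left_mono)
    also have "\<dots> = C" using that by (auto simp: W_def simp flip: sum_distrib_right)
    finally show ?thesis .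
  qed
  have iG: "integrable M (\<lambda>x. (norm (G w x))\<^sup>2)" if "w \<in> W n" for w n
    using Gb[OF that] by (intro integrable_const_bound[where B="C\<^sup>2"] AE_I2) (auto intro!: power_mono)
  have N0: "N w \<ge> 0" for w unfolding N_def by simp
  have NC: "N w \<le> C\<^sup>2 * measure M (space M)" if "w \<in> W n" for w n
  proof -
    have "N w \<le> (LINT x|M. C\<^sup>2)" unfolding N_def
      using iG[OF that] Gb[OF that] by (intro integral_mono) (auto intro!: power_mono)
    then show ?thesis by (simp add: mult.commute)
  qed
  have Wne: "(n, \<lambda>k. if k = n then 1 else 0) \<in> W n" for n by (auto simp: W_def)
  have bdd: "bdd_below (N ` W n)" for n using N0 by (intro bdd_belowI[of _ 0]) auto
  have Wmono: "W p \<subseteq> W n" if "n \<le> p" for n p using that by (auto simp: W_def)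
  have amono: "a n \<le> a p" if "n \<le> p" for n p
    unfolding a_def using Wmono[OF that] Wne bdd by (intro cINF_superset_mono) auto
  have aC: "a n \<le> C\<^sup>2 * measure M (space M)" for n
    unfolding a_def using NC[OF Wne] by (rule cINF_lower2[OF bdd Wne])
  obtain L where L: "a \<longlonglongrightarrow> L" "\<And>n. a n \<le> L"
    using incseq_convergent[of a "C\<^sup>2 * measure M (space M)"] amono aC by (auto simp: incseq_def)
  have "\<exists>w\<in>W n. N w < a n + 1 / real (Suc n)" for n
    unfolding a_def using Wne bdd by (subst cINF_less_iff[symmetric]) auto
  then obtain w where w: "\<And>n. w n \<in> W n" "\<And>n. N (w n) < a n + 1 / real (Suc n)" by metis
  have key: "(LINT x|M. (norm (G (w n) x - G (w p) x))\<^sup>2) \<le> 2 * (L - a n) + 4 / real (Suc n)" if np: "n \<le> p" for n p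
  proof -
    obtain mn cn mp cp where wn: "w n = (mn, cn)" and wp: "w p = (mp, cp)" by (meson surj_pair)
    have n: "(\<forall>k. cn k \<ge> 0)" "(\<forall>k. k < n \<or> k > mn \<longrightarrow> cn k = 0)" "(\<Sum>k\<le>mn. cn k) = 1"
      using w(1)[of n] by (auto simp: W_def wn)
    have p: "(\<forall>k. cp k \<ge> 0)" "(\<forall>k. k < n \<or> k > mp \<longrightarrow> cp k = 0)" "(\<Sum>k\<le>mp. cp k) = 1"
      using w(1)[of p] np by (auto simp: W_def wp)
    define mx where "mx = max mn mp"
    \<comment> \<open>The midpoint of the two combinations is again a combination of the tail from
      \<open>n\<close> on, so \<open>N v\<close> is at least \<open>a n\<close>.\<close>
    define v where "v = (mx, \<lambda>k. (cn k + cp k) / 2)"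
    have s: "(\<Sum>k\<le>mn. cn k *\<^sub>R F k) = (\<Sum>k\<le>mx. cn k *\<^sub>R F k)" "(\<Sum>k\<le>mp. cp k *\<^sub>R F k) = (\<Sum>k\<le>mx. cp k *\<^sub>R F k)"
      for F :: "nat \<Rightarrow> 'c::real_vector"
      using n p by (auto simp: mx_def intro!: sum_atMost_extend)
    have v: "v \<in> W n"
      using n p s[of "\<lambda>_. 1::real"] unfolding v_def W_def
      by (auto simp: mx_def sum.distrib simp flip: sum_divide_distrib)
    have Gv: "G v x = (1 / 2) *\<^sub>R (G (w n) x + G (w p) x)" for x
      unfolding G_def wn wp v_def fst_conv snd_conv s
      by (simp add: scaleR_sum_right sum.distrib[symmetric] scaleR_add_left[symmetric] add_divide_distrib)
    have par: "(norm (G (w n) x - G (w p) x))\<^sup>2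
        = 2 * (norm (G (w n) x))\<^sup>2 + 2 * (norm (G (w p) x))\<^sup>2 - 4 * (norm (G v x))\<^sup>2" for x
    proof -
      have h: "(norm ((1 / 2) *\<^sub>R (a + b)))\<^sup>2 = (norm (a + b))\<^sup>2 / 4" for a b :: 'b
        by (simp add: power2_eq_square)
      have "(norm (a - b))\<^sup>2 = 2 * (norm a)\<^sup>2 + 2 * (norm b)\<^sup>2 - 4 * (norm ((1 / 2) *\<^sub>R (a + b)))\<^sup>2" for a b :: 'b
        unfolding h by (simp add: power2_norm_eq_inner inner_add_left inner_add_right inner_diff_left inner_diff_right inner_commute add_divide_distrib)
      then show ?thesis unfolding Gv .
    qed
    have "(LINT x|M. (norm (G (w n) x - G (w p) x))\<^sup>2) = 2 * N (w n) + 2 * N (w p) - 4 * N v"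
      unfolding par N_def using iG[OF w(1)] iG[OF v] by simp
    moreover have "N v \<ge> a n" unfolding a_def by (rule cINF_lower[OF bdd v])
    moreover have "1 / real (Suc p) \<le> 1 / real (Suc n)" using np by (intro divide_left_mono) auto
    moreover have "X \<le> 2 * (L - an) + 4 / q'"
      if "X = 2 * Nn + 2 * Np - 4 * Nv" "an \<le> Nv" "q \<le> 1 / q'" "Nn < an + 1 / q'" "Np < ap + q" "ap \<le> L"
      for X Nn Np Nv an ap q q' :: real
    proof -
      define e where "e = 1 / q'"
      have "2 * Nn + 2 * Np - 4 * Nv \<le> 2 * (an + e) + 2 * (L + e) - 4 * an"
        using that unfolding e_def[symmetric] by (intro diff_mono add_mono mult_left_mono) auto
      then have "X \<le> 2 * (L - an) + 4 * e" using that(1) by (simp add: algebra_simps)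
      then show ?thesis by (simp add: e_def)
    qed
    ultimately show ?thesis using w(2)[of n] w(2)[of p] L(2)[of p] by blast
  qed
  have intd: "integrable M (\<lambda>x. (norm (G (w n) x - G (w p) x))\<^sup>2)" for n p
  proof (rule integrable_const_bound[where B="(2 * C)\<^sup>2"])
    show "AE x in M. norm ((norm (G (w n) x - G (w p) x))\<^sup>2) \<le> (2 * C)\<^sup>2"
    proof (intro AE_I2)
      fix x
      have "norm (G (w n) x - G (w p) x) \<le> 2 * C"
        using norm_triangle_ineq4[of "G (w n) x" "G (w p) x"] Gb[OF w(1), of n x] Gb[OF w(1), of p x] by linarith
      then show "norm ((norm (G (w n) x - G (w p) x))\<^sup>2) \<le> (2 * C)\<^sup>2"
        using power_mono[of "norm (G (w n) x - G (w p) x)" "2 * C" 2] by simp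
    qed
  qed measurable
  have iGw: "integrable M (G (w n))" for n
    by (rule integrable_const_bound[where B=C]) (use Gb[OF w(1)] in auto)
  define mu where "mu = measure M (space M)"
  obtain r where r: "strict_mono r" "AE x in M. Cauchy (\<lambda>i. G (w (r i)) x)"
  proof (rule cauchy_L1_AE_cauchy_subseq[of M "\<lambda>n. G (w n)"])
    fix e :: real assume e: "e > 0"
    \<comment> \<open>On a finite measure, L2 smallness gives L1 smallness through t <= d + t^2 / d.
      This \<open>d\<close> makes the constant term contribute less than e / 2, also when the total
      mass is zero.\<close>
    define d where "d = e / (2 * (mu + 1))"
    have mu: "mu \<ge> 0" by (simp add: mu_def)
    have d: "d > 0" "d * mu < e / 2" using e mu by (auto simp: d_def field_simps)
    have lim: "(\<lambda>n. 2 * (L - a n) + 4 * (1 / real (Suc n))) \<longlonglongrightarrow> 2 * (L - L) + 4 * 0"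
      by (intro tendsto_intros L(1) LIMSEQ_Suc[OF lim_1_over_n])
    then have "\<forall>\<^sub>F n in sequentially. 2 * (L - a n) + 4 * (1 / real (Suc n)) < d * e / 2"
      using d e by (intro order_tendstoD(2)) auto
    then obtain n0 where n0: "\<And>n. n \<ge> n0 \<Longrightarrow> 2 * (L - a n) + 4 / real (Suc n) < d * e / 2"
      by (auto simp: eventually_sequentially)
    have le: "(LINT x|M. norm (G (w i) x - G (w j) x)) < e" if "n0 \<le> i" "i \<le> j" for i j
    proof -
      have pt: "t \<le> d + t\<^sup>2 / d" if "t \<ge> 0" for t :: real
      proof (cases "t \<le> d")
        case False
        then have "t * d \<le> t * t" using that by (intro mult_left_mono) auto
        then have "t \<le> t\<^sup>2 / d" using d by (simp add: field_simps power2_eq_square)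
        then show ?thesis using d by linarith
      qed (use d in \<open>auto intro: add_increasing2\<close>)
      have "(LINT x|M. norm (G (w i) x - G (w j) x)) \<le> (LINT x|M. d + (norm (G (w i) x - G (w j) x))\<^sup>2 / d)"
        using intd[of i j] iGw[of i] iGw[of j] pt by (intro integral_mono) auto
      also have "\<dots> = d * mu + (LINT x|M. (norm (G (w i) x - G (w j) x))\<^sup>2) / d"
        using intd[of i j] by (simp add: mu_def mult.commute)
      also have "\<dots> < e / 2 + (d * e / 2) / d"
        using key[OF that(2)] n0[OF that(1)] d by (intro add_strict_mono divide_strict_right_mono) auto
      also have "\<dots> = e" using d by simp
      finally show ?thesis .
    qed
    have "(LINT x|M. norm (G (w i) x - G (w j) x)) < e" if "n0 \<le> i" "n0 \<le> j" for i j
      using le[of i j] le[of j i] that by (cases "i \<le> j") (auto simp: norm_minus_commute)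
    then show "\<exists>N. \<forall>i\<ge>N. \<forall>j\<ge>N. (LINT x|M. norm (G (w i) x - G (w j) x)) < e" by blast
  qed (use iGw in auto)
  define c where "c n = snd (w (r n))" for n
  define m where "m n = fst (w (r n))" for n
  have "w (r n) \<in> W n" for n using w(1)[of "r n"] Wmono[OF seq_suble[OF r(1), of n]] by auto
  then have W: "(m n, c n) \<in> W n" for n by (simp add: m_def c_def)
  show ?thesis
  proof (rule that[of c m])
    show "AE x in M. convergent (\<lambda>n. \<Sum>k\<le>m n. c n k *\<^sub>R f k x)"
      using r(2) by (auto simp: G_def m_def c_def Cauchy_convergent_iff)
  qed (use W in \<open>auto simp: W_def\<close>)
qed

text \<open>The Gaussian product measure is finite, as \<open>convex_tail_AE_convergent\<close>
  demands, and its positive density gives it the null sets of Lebesgue measure.\<close>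

lemma AE_gaussian_iff:
  "(AE p in std_normal \<Otimes>\<^sub>M std_normal. P p) \<longleftrightarrow> (AE p in plane. P p)"
proof -
  have "sigma_finite_measure std_normal"
    by (intro prob_space_imp_sigma_finite prob_space_std_normal)
  then have eq: "std_normal \<Otimes>\<^sub>M std_normal
      = density plane (\<lambda>(x, y). ennreal (std_normal_density x) * ennreal (std_normal_density y))"
    by (intro pair_measure_density sigma_finite_lborel) auto
  show ?thesis
    unfolding eq by (subst AE_density) (auto simp: case_prod_beta ennreal_zero_less_mult_iff normal_density_pos)
qed

text \<open>The pairs \<open>(u k p, e k p)\<close> are treated as one sequence, so that both
  components get the same weights; only then do the combinations still satisfy the linear equation
  that links them.\<close>

lemma convex_tail_AE_tendsto:
  fixes u e :: "nat \<Rightarrow> real \<times> real \<Rightarrow> real"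
  assumes [measurable]: "\<And>k. u k \<in> borel_measurable plane" "\<And>k. e k \<in> borel_measurable plane"
    and C: "\<And>k p. \<bar>u k p\<bar> \<le> C" "\<And>k p. \<bar>e k p\<bar> \<le> C"
  obtains c :: "nat \<Rightarrow> nat \<Rightarrow> real" and m U E where "\<And>n k. c n k \<ge> 0" "\<And>n k. k < n \<Longrightarrow> c n k = 0"
    "\<And>n. (\<Sum>k\<le>m n. c n k) = 1"
    "U \<in> borel_measurable plane" "E \<in> borel_measurable plane"
    "AE p in plane. (\<lambda>n. \<Sum>k\<le>m n. c n k * u k p) \<longlonglongrightarrow> U p"
    "AE p in plane. (\<lambda>n. \<Sum>k\<le>m n. c n k * e k p) \<longlonglongrightarrow> E p"
proof -
  have ms: "sets (std_normal \<Otimes>\<^sub>M std_normal) = sets plane"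
    by (intro sets_pair_measure_cong) auto
  have fin: "finite_measure (std_normal \<Otimes>\<^sub>M std_normal)"
    by (intro finite_measure_pair_measure prob_space.finite_measure prob_space_std_normal)
  have b: "norm (u k p, e k p) \<le> C + C" for k p
    using norm_Pair_le[of "u k p" "e k p"] C[of k p] by auto
  obtain c :: "nat \<Rightarrow> nat \<Rightarrow> real" and m where c: "\<And>n k. c n k \<ge> 0" "\<And>n k. k < n \<Longrightarrow> c n k = 0"
    "\<And>n. (\<Sum>k\<le>m n. c n k) = 1"
    "AE p in std_normal \<Otimes>\<^sub>M std_normal. convergent (\<lambda>n. \<Sum>k\<le>m n. c n k *\<^sub>R (u k p, e k p))"
    by (rule convex_tail_AE_convergent[OF fin, of "\<lambda>k p. (u k p, e k p)" "C + C"])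
       (use b in \<open>auto simp: measurable_cong_sets[OF ms refl]\<close>)
  define U where "U p = lim (\<lambda>n. \<Sum>k\<le>m n. c n k * u k p)" for p
  define E where "E p = lim (\<lambda>n. \<Sum>k\<le>m n. c n k * e k p)" for p
  have "AE p in plane. (\<lambda>n. \<Sum>k\<le>m n. c n k * u k p) \<longlonglongrightarrow> U p \<and> (\<lambda>n. \<Sum>k\<le>m n. c n k * e k p) \<longlonglongrightarrow> E p"
    using c(4)[unfolded AE_gaussian_iff]
  proof eventually_elim
    case (elim p)
    then obtain l where l: "(\<lambda>n. \<Sum>k\<le>m n. c n k *\<^sub>R (u k p, e k p)) \<longlonglongrightarrow> l" by (auto simp: convergent_def)
    have "(\<lambda>n. \<Sum>k\<le>m n. c n k * u k p) \<longlonglongrightarrow> fst l" "(\<lambda>n. \<Sum>k\<le>m n. c n k * e k p) \<longlonglongrightarrow> snd l"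
      using tendsto_fst[OF l] tendsto_snd[OF l] by (simp_all add: fst_sum snd_sum)
    then show ?case by (simp add: U_def E_def limI)
  qed
  moreover have "U \<in> borel_measurable plane" "E \<in> borel_measurable plane"
    unfolding U_def[abs_def] E_def[abs_def] by (intro borel_measurable_lim_metric; measurable)+
  ultimately show ?thesis
    using c(1-3) by (intro that[of c m U E]) (auto elim: eventually_mono)
qed

section \<open>The Yosida approximation of an m-accretive graph\<close>

text \<open>A larger \<open>x\<close> forces, by monotonicity, a \<open>w\<close> at least as large
  and hence a strictly larger combination. Both weights are left open: the range condition of
  \<open>m_accretive\<close> uses \<open>r * x + w\<close>, the resolvent uses
  \<open>x + s * w\<close>.\<close>

lemma monotone_resolvent:
  assumes mono: "monotone_graph \<beta>" and "w1 \<in> \<beta> `` {x1}" "w2 \<in> \<beta> `` {x2}"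
    and p: "p > 0" and q: "q > 0" and le: "p * x1 + q * w1 \<le> p * x2 + q * (w2 :: real)"
  shows "x1 \<le> x2" "w1 \<le> w2"
proof -
  have m: "(x1 - x2) * (w1 - w2) \<ge> 0" using assms(1-3) unfolding monotone_graph_def by blast
  show "x1 \<le> x2"
  proof (rule ccontr)
    assume n: "\<not> x1 \<le> x2"
    then have "w1 \<ge> w2" using m by (auto simp: zero_le_mult_iff)
    then have "p * x1 + q * w1 > p * x2 + q * w2" using n p q by (intro add_less_le_mono) auto
    then show False using le by simp
  qed
  show "w1 \<le> w2"
  proof (rule ccontr)
    assume n: "\<not> w1 \<le> w2"
    then have "x1 \<ge> x2" using m by (auto simp: zero_le_mult_iff)
    then have "p * x1 + q * w1 > p * x2 + q * w2" using n p q by (intro add_le_less_mono) auto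
    then show False using le by simp
  qed
qed

lemma monotone_resolvent_unique:
  assumes "monotone_graph \<beta>" "w1 \<in> \<beta> `` {x1}" "w2 \<in> \<beta> `` {x2}" "p > 0" "q > 0"
    and "p * x1 + q * w1 = p * x2 + q * (w2 :: real)"
  shows "x1 = x2" "w1 = w2"
  using monotone_resolvent[OF assms(1-5)] monotone_resolvent[OF assms(1,3,2,4,5)] assms(6) by auto

lemma lipschitz_continuous:
  fixes f :: "real \<Rightarrow> real"
  assumes L: "\<And>x y. \<bar>f x - f y\<bar> \<le> L * \<bar>x - y\<bar>"
  shows "continuous_on S f"
proof (rule continuous_on_subset[OF _ subset_UNIV], rule lipschitz_on_continuous_on)
  show "(max L 0)-lipschitz_on UNIV f"
    using L by (intro lipschitz_onI) (auto simp: dist_real_def intro: order_trans[OF L mult_right_mono])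
qed

context
  fixes \<beta> :: "(real \<times> real) set" and c :: real
  assumes acc: "m_accretive \<beta>" and c: "c > 0"
    and growth: "\<And>u w. w \<in> \<beta> `` {u} \<Longrightarrow> \<bar>w\<bar> \<le> c * \<bar>u\<bar>"
begin

lemma graph_monotone: "monotone_graph \<beta>"
  using acc unfolding m_accretive_def by blast

text \<open>The resolvent \<open>J\<close> and \<open>B = id - r J\<close> are Lipschitz and parametrise the graph by the line; the intermediate
  value theorem along this curve gives both claims.\<close>

lemma zero_in_graph_and_resolvent_surj:
  shows "0 \<in> \<beta> `` {0}" and "s > 0 \<Longrightarrow> \<exists>w. w \<in> \<beta> `` {u - s * w}"
proof -
  obtain r where r: "r > 0" "(\<Union>x. (\<lambda>y. y + r * x) ` (\<beta> `` {x})) = UNIV"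
    using acc unfolding m_accretive_def by blast
  have "\<exists>x w. w \<in> \<beta> `` {x} \<and> w + r * x = y" for y
  proof -
    have "y \<in> (\<Union>x. (\<lambda>y. y + r * x) ` (\<beta> `` {x}))" using r(2) by blast
    then show ?thesis by auto
  qed
  then obtain J B where JB: "\<And>y. B y \<in> \<beta> `` {J y}" "\<And>y. B y + r * J y = y" by metis
  have le: "J y \<le> J z" "B y \<le> B z" if "y \<le> z" for y z
    using monotone_resolvent[OF graph_monotone JB(1) JB(1) r(1) zero_less_one, of y z] JB(2)[of y] JB(2)[of z] that
    by (auto simp: add.commute)
  have lipJ: "\<bar>J y - J z\<bar> \<le> (1 / r) * \<bar>y - z\<bar>" and lipB: "\<bar>B y - B z\<bar> \<le> 1 * \<bar>y - z\<bar>" for y z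
  proof -
    have *: "r * (J z - J y) \<le> z - y" "B z - B y \<le> z - y" if "y \<le> z" for y z
    proof -
      have "r * J y \<le> r * J z" using le[OF that] r(1) by (intro mult_left_mono) auto
      then show "r * (J z - J y) \<le> z - y" "B z - B y \<le> z - y"
        using le[OF that] JB(2)[of y] JB(2)[of z] by (simp_all add: right_diff_distrib)
    qed
    have "r * \<bar>J y - J z\<bar> \<le> \<bar>y - z\<bar>"
      using *(1)[of y z] *(1)[of z y] le[of y z] le[of z y] by (cases "y \<le> z") auto
    then show "\<bar>J y - J z\<bar> \<le> (1 / r) * \<bar>y - z\<bar>" using r(1) by (simp add: field_simps)
    show "\<bar>B y - B z\<bar> \<le> 1 * \<bar>y - z\<bar>"
      using *(2)[of y z] *(2)[of z y] le[of y z] le[of z y] by (cases "y \<le> z") auto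
  qed
  have cJ: "continuous_on S J" and cB: "continuous_on S B" for S
    by (rule lipschitz_continuous[OF lipJ], rule lipschitz_continuous[OF lipB])
  have hit: "\<exists>y0. J y0 = 0"
  proof -
    \<comment> \<open>If \<open>J (- R)\<close> were positive, it would be at most
      \<open>J 0\<close>, so \<open>B (- R)\<close> would be at least \<open>- c * |J 0|\<close>,
      whereas \<open>B (- R) = - R - r * J (- R)\<close> lies below \<open>- R\<close>. The other
      end is symmetric, and the summand 1 keeps \<open>R\<close> positive.\<close>
    define R where "R = c * \<bar>J 0\<bar> + 1"
    have R: "R > 0" using c by (simp add: R_def add_nonneg_pos)
    have lo: "J (- R) \<le> 0"
    proof (rule ccontr)
      assume n: "\<not> J (- R) \<le> 0"
      then have "\<bar>J (- R)\<bar> \<le> \<bar>J 0\<bar>" using le(1)[of "- R" 0] R by auto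
      then have "\<bar>B (- R)\<bar> \<le> c * \<bar>J 0\<bar>"
        using growth[OF JB(1), of "- R"] c by (meson mult_left_mono order_trans less_imp_le)
      moreover have "r * J (- R) > 0" using n r(1) by auto
      ultimately show False using JB(2)[of "- R"] by (auto simp: R_def)
    qed
    have hi: "J R \<ge> 0"
    proof (rule ccontr)
      assume n: "\<not> J R \<ge> 0"
      then have "\<bar>J R\<bar> \<le> \<bar>J 0\<bar>" using le(1)[of 0 R] R by auto
      then have "\<bar>B R\<bar> \<le> c * \<bar>J 0\<bar>"
        using growth[OF JB(1), of R] c by (meson mult_left_mono order_trans less_imp_le)
      moreover have "r * J R < 0" using n r(1) by (auto simp: mult_less_0_iff)
      ultimately show False using JB(2)[of R] by (auto simp: R_def)
    qed
    show ?thesis using IVT'[of J "- R" 0 R] lo hi R cJ by auto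
  qed
  then obtain y0 where y0: "J y0 = 0" by blast
  then have "B y0 = 0" using growth[OF JB(1), of y0] by simp
  then show z: "0 \<in> \<beta> `` {0}" using JB(1)[of y0] y0 by simp
  have "y0 = 0" using JB(2)[of y0] y0 \<open>B y0 = 0\<close> by simp
  with y0 \<open>B y0 = 0\<close> have 0: "J 0 = 0" "B 0 = 0" by auto
  show "\<exists>w. w \<in> \<beta> `` {u - s * w}" if s: "s > 0"
  proof -
    \<comment> \<open>For \<open>y \<ge> 0\<close> both \<open>J y\<close> and \<open>B y\<close>
      are nonnegative, so \<open>J y + s * B y\<close> is at least \<mu> times
      \<open>r * J y + B y = y\<close>. This \<mu> is the largest factor for which the comparison
      works term by term, and it fixes the interval for the intermediate value theorem.\<close>
    define \<mu> where "\<mu> = min (1 / r) s"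
    have \<mu>: "\<mu> > 0" using r(1) s by (simp add: \<mu>_def)
    define R where "R = \<bar>u\<bar> / \<mu>"
    have R: "R \<ge> 0" using \<mu> by (simp add: R_def)
    have h: "J y + s * B y \<ge> \<mu> * y" if "y \<ge> 0" for y
    proof -
      have "\<mu> * y = \<mu> * r * J y + \<mu> * B y" using JB(2)[of y] by (simp add: algebra_simps flip: distrib_left)
      also have "\<dots> \<le> 1 * J y + s * B y"
        using le[OF that] 0 r(1) \<mu> by (intro add_mono mult_right_mono) (auto simp: \<mu>_def min_def field_simps)
      finally show ?thesis by simp
    qed
    have h': "J y + s * B y \<le> \<mu> * y" if "y \<le> 0" for y
    proof -
      have "1 * J y + s * B y \<le> \<mu> * r * J y + \<mu> * B y"
        using le[OF that] 0 r(1) \<mu> by (intro add_mono mult_right_mono_neg) (auto simp: \<mu>_def min_def field_simps)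
      also have "\<dots> = \<mu> * y" using JB(2)[of y] by (simp add: algebra_simps flip: distrib_left)
      finally show ?thesis by simp
    qed
    have "\<exists>y\<ge>- R. y \<le> R \<and> J y + s * B y = u"
    proof (rule IVT'[of "\<lambda>y. J y + s * B y" "- R" u R])
      show "J (- R) + s * B (- R) \<le> u" using h'[of "- R"] R \<mu> by (simp add: R_def)
      show "u \<le> J R + s * B R" using h[of R] R \<mu> by (simp add: R_def)
    qed (use R cJ cB in \<open>auto intro!: continuous_intros\<close>)
    then obtain y where "J y + s * B y = u" by blast
    then have "J y = u - s * B y" by simp
    then show ?thesis using JB(1)[of y] by metis
  qed
qed

text \<open>With \<open>J\<close> the resolvent, that is the inverse of id + s \<beta>, this is
  \<open>(u - J u) / s\<close>. Choosing the value rather than the resolvent makes the inclusion in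
  the graph the defining property.\<close>

definition yosida :: "real \<Rightarrow> real \<Rightarrow> real" where
  "yosida s u = (SOME w. w \<in> \<beta> `` {u - s * w})"

lemma yosida_in: "s > 0 \<Longrightarrow> yosida s u \<in> \<beta> `` {u - s * yosida s u}"
  unfolding yosida_def by (rule someI_ex) (rule zero_in_graph_and_resolvent_surj(2))

lemma yosida_mono:
  assumes s: "s > 0" and "u \<le> v"
  shows "yosida s u \<le> yosida s v" "u - s * yosida s u \<le> v - s * yosida s v"
  using monotone_resolvent[OF graph_monotone yosida_in[OF s] yosida_in[OF s] zero_less_one s, of u v] assms by auto

lemma yosida_0: "s > 0 \<Longrightarrow> yosida s 0 = 0"
  using monotone_resolvent_unique(2)[OF graph_monotone yosida_in zero_in_graph_and_resolvent_surj(1), of s 1 s 0] by auto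

lemma yosida_lipschitz:
  assumes s: "s > 0"
  shows "s * \<bar>yosida s u - yosida s v\<bar> \<le> \<bar>u - v\<bar>"
  using yosida_mono[OF s, of u v] yosida_mono[OF s, of v u]
  by (cases "u \<le> v") (auto simp: algebra_simps)

lemma yosida_resolvent_le:
  assumes s: "s > 0"
  shows "\<bar>u - s * yosida s u\<bar> \<le> \<bar>u\<bar>"
  using yosida_mono[OF s, of 0 u] yosida_mono[OF s, of u 0] s yosida_0[OF s]
  by (cases "u \<le> 0") (auto simp: mult_nonneg_nonpos)

text \<open>The value lies in the graph over the resolvent, which does not exceed \<open>u\<close>
  in absolute value; so one growth constant serves all \<open>s\<close>.\<close>

lemma yosida_le:
  assumes s: "s > 0"
  shows "\<bar>yosida s u\<bar> \<le> c * \<bar>u\<bar>"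
proof -
  have "\<bar>yosida s u\<bar> \<le> c * \<bar>u - s * yosida s u\<bar>" by (rule growth[OF yosida_in[OF s]])
  also have "\<dots> \<le> c * \<bar>u\<bar>" using c by (intro mult_left_mono yosida_resolvent_le[OF s]) auto
  finally show ?thesis .
qed

lemma continuous_yosida: "s > 0 \<Longrightarrow> continuous_on S (yosida s)"
  using yosida_lipschitz[of s] by (intro lipschitz_continuous[of _ "1 / s"]) (simp add: field_simps)

end

section \<open>A monotone finite difference scheme\<close>

lemma step_function_integral:
  fixes g :: "nat \<Rightarrow> real"
  assumes tau: "tau > 0" and t: "real n * tau \<le> t" "t \<le> real (Suc n) * tau"
  shows "(LBINT s. indicator {0..t} s * g (nat \<lfloor>s / tau\<rfloor>)) = tau * (\<Sum>j<n. g j) + (t - real n * tau) * g n"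
    and "integrable lborel (\<lambda>s. indicator {0..t} s * g (nat \<lfloor>s / tau\<rfloor>))"
proof -
  have [measurable]: "(\<lambda>s. g (nat \<lfloor>s / tau\<rfloor>)) \<in> borel_measurable borel"
    by (rule measurable_compose[of _ _ "count_space UNIV"]) auto
  have piece: "AE s in lborel. indicator {real n * tau..t} s * g (nat \<lfloor>s / tau\<rfloor>) = indicator {real n * tau..t} s * g n"
    if "real n * tau \<le> t" "t \<le> real (Suc n) * tau" for n t
    using AE_lborel_singleton[of "real (Suc n) * tau"]
  proof eventually_elim
    case (elim s)
    show ?case
    proof (cases "s \<in> {real n * tau..t}")
      case True
      then have "real n \<le> s / tau" "s / tau < real n + 1" using elim that tau by (auto simp: field_simps)
      then have "\<lfloor>s / tau\<rfloor> = int n" by (simp add: floor_eq_iff)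
      then show ?thesis by simp
    qed simp
  qed
  have ind: "integrable lborel (\<lambda>s. indicator {p..q} s * r :: real)" for p q r :: real
    by (intro integrable_mult_left integrable_real_indicator) (auto simp: emeasure_lborel_Icc_eq)
  have ip: "integrable lborel (\<lambda>s. indicator {real n * tau..t} s * g (nat \<lfloor>s / tau\<rfloor>))"
    "(LBINT s. indicator {real n * tau..t} s * g (nat \<lfloor>s / tau\<rfloor>)) = (t - real n * tau) * g n"
    if "real n * tau \<le> t" "t \<le> real (Suc n) * tau" for n t
  proof -
    show "integrable lborel (\<lambda>s. indicator {real n * tau..t} s * g (nat \<lfloor>s / tau\<rfloor>))"
      using ind[of "real n * tau" t "g n"] by (rule integrable_cong_AE_imp) (use piece[OF that] in auto)
    have "(LBINT s. indicator {real n * tau..t} s * g (nat \<lfloor>s / tau\<rfloor>)) = (LBINT s. indicator {real n * tau..t} s * g n)"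
      by (rule integral_cong_AE) (use piece[OF that] in auto)
    then show "(LBINT s. indicator {real n * tau..t} s * g (nat \<lfloor>s / tau\<rfloor>)) = (t - real n * tau) * g n"
      using that by simp
  qed
  have "integrable lborel (\<lambda>s. indicator {0..t} s * g (nat \<lfloor>s / tau\<rfloor>)) \<and>
     (LBINT s. indicator {0..t} s * g (nat \<lfloor>s / tau\<rfloor>)) = tau * (\<Sum>j<n. g j) + (t - real n * tau) * g n"
    using t
  proof (induction n arbitrary: t)
    case 0
    then show ?case using ip[of 0 t] by simp
  next
    case (Suc n)
    let ?s = "real (Suc n) * tau"
    have IH: "integrable lborel (\<lambda>s. indicator {0..?s} s * g (nat \<lfloor>s / tau\<rfloor>))"
     "(LBINT s. indicator {0..?s} s * g (nat \<lfloor>s / tau\<rfloor>)) = tau * (\<Sum>j<n. g j) + (?s - real n * tau) * g n"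
      using Suc.IH[of ?s] tau by (auto simp: algebra_simps)
    have s0: "?s \<ge> 0" using tau by simp
    have ae: "AE s in lborel. indicator {0..t} s * g (nat \<lfloor>s / tau\<rfloor>)
       = indicator {0..?s} s * g (nat \<lfloor>s / tau\<rfloor>) + indicator {?s..t} s * g (nat \<lfloor>s / tau\<rfloor>)"
      using AE_lborel_singleton[of ?s]
    proof eventually_elim
      case (elim s)
      then show ?case using Suc.prems(1) s0 by (auto split: split_indicator)
    qed
    note i2 = ip[OF Suc.prems]
    have i3: "integrable lborel (\<lambda>s. indicator {0..?s} s * g (nat \<lfloor>s / tau\<rfloor>) + indicator {?s..t} s * g (nat \<lfloor>s / tau\<rfloor>))"
      using IH(1) i2(1) by (rule Bochner_Integration.integrable_add)
    have "integrable lborel (\<lambda>s. indicator {0..t} s * g (nat \<lfloor>s / tau\<rfloor>))"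
      by (rule integrable_cong_AE_imp[OF i3]) (use ae in \<open>auto elim: eventually_mono\<close>)
    moreover have "(LBINT s. indicator {0..t} s * g (nat \<lfloor>s / tau\<rfloor>))
       = (LBINT s. indicator {0..?s} s * g (nat \<lfloor>s / tau\<rfloor>) + indicator {?s..t} s * g (nat \<lfloor>s / tau\<rfloor>))"
      by (rule integral_cong_AE) (use ae in auto)
    ultimately show ?case
      unfolding Bochner_Integration.integral_add[OF IH(1) i2(1)] IH(2) i2(2)
      by (simp add: algebra_simps)
  qed
  then show "(LBINT s. indicator {0..t} s * g (nat \<lfloor>s / tau\<rfloor>)) = tau * (\<Sum>j<n. g j) + (t - real n * tau) * g n"
    and "integrable lborel (\<lambda>s. indicator {0..t} s * g (nat \<lfloor>s / tau\<rfloor>))" by auto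
qed

text \<open>Only time is discretized: \<open>x\<close> still ranges over the whole line and
  \<open>h\<close> is merely the step of the second difference, so translations act on the scheme
  exactly. In the application \<open>b\<close> is the Yosida approximation with parameter
  \<open>lam\<close>, whose Lipschitz constant \<open>1 / lam\<close> dictates the CFL
  condition.\<close>

locale monotone_scheme =
  fixes b :: "real \<Rightarrow> real" and lam tau h c M :: real and u0 :: "real \<Rightarrow> real" and N :: nat
  assumes lam: "lam > 0" and tau: "tau > 0" and h: "h > 0" and c: "c > 0"
    and CFL: "tau \<le> lam * h\<^sup>2"
    and b_mono: "x \<le> y \<Longrightarrow> b x \<le> b y" and b_lip: "lam * \<bar>b x - b y\<bar> \<le> \<bar>x - y\<bar>"
    and b_growth: "\<bar>b x\<bar> \<le> c * \<bar>x\<bar>"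
    and u0: "integrable lborel u0" and u0_bound: "\<bar>u0 x\<bar> \<le> M"
begin

definition scheme_step :: "(real \<Rightarrow> real) \<Rightarrow> real \<Rightarrow> real" where
  "scheme_step f x = f x + tau / 2 * second_diff h (\<lambda>x. b (f x)) x"

definition U :: "nat \<Rightarrow> real \<Rightarrow> real" where "U n = (scheme_step ^^ n) u0"

definition w :: "nat \<Rightarrow> real \<Rightarrow> real" where "w n x = b (U n x)"

definition W :: "nat \<Rightarrow> real \<Rightarrow> real" where "W n x = tau * (\<Sum>j<n. w j x)"

definition A :: real where "A = (LBINT x. \<bar>u0 x\<bar>)"

lemma b_0: "b 0 = 0" using b_growth[of 0] by simp

lemma M_nonneg: "M \<ge> 0" using u0_bound[of 0] by linarith

lemma A_nonneg: "A \<ge> 0" by (simp add: A_def)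

lemma b_measurable [measurable]: "b \<in> borel_measurable borel"
  using b_lip lam by (intro borel_measurable_continuous_onI lipschitz_continuous[of _ "1 / lam"]) (simp add: field_simps)

lemma integrable_b:
  assumes f: "integrable lborel f"
  shows "integrable lborel (\<lambda>x. b (f x))"
proof (rule Bochner_Integration.integrable_bound)
  show "integrable lborel (\<lambda>x. c * \<bar>f x\<bar>)" using f by auto
  show "(\<lambda>x. b (f x)) \<in> borel_measurable lborel" using f by measurable
  show "AE x in lborel. norm (b (f x)) \<le> norm (c * \<bar>f x\<bar>)"
    using order_trans[OF b_growth abs_ge_self] by simp
qed

lemma integrable_step: "integrable lborel f \<Longrightarrow> integrable lborel (scheme_step f)"
  unfolding scheme_step_def[abs_def]
  by (intro Bochner_Integration.integrable_add integrable_mult_right integrable_second_diff integrable_b)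

text \<open>Under the CFL condition each summand is nondecreasing in the values of \<open>f\<close>
  that it contains, which is the source of the comparison estimates.\<close>

lemma step_alt:
  "scheme_step f x = (f x - (tau / h\<^sup>2) * b (f x)) + (tau / h\<^sup>2) / 2 * (b (f (x + h)) + b (f (x - h)))"
proof -
  have "F + tau / 2 * ((B + C - 2 * D) / H) = (F - (tau / H) * D) + (tau / H) / 2 * (B + C)" for F B C D H :: real
  proof -
    have "tau / 2 * ((B + C - 2 * D) / H) = (tau / H) / 2 * (B + C - 2 * D)" by simp
    also have "\<dots> = (tau / H) / 2 * (B + C) - (tau / H) * D"
      by (simp only: right_diff_distrib) simp
    finally show ?thesis by simp
  qed
  then show ?thesis by (simp only: scheme_step_def second_diff_def)
qed

lemma ratio: "0 < tau / h\<^sup>2" "tau / h\<^sup>2 \<le> lam"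
  using tau h CFL by (auto simp: divide_le_eq)

lemma ratio_b_le: "(tau / h\<^sup>2) * \<bar>b x - b y\<bar> \<le> \<bar>x - y\<bar>"
  using mult_right_mono[OF ratio(2), of "\<bar>b x - b y\<bar>"] b_lip[of x y] by linarith

text \<open>The CFL condition makes \<open>y \<mapsto> y - (tau / h\<^sup>2) * b y\<close> nondecreasing, so that the absolute value of its
  increments splits exactly.\<close>

lemma step_diff_le:
  "\<bar>scheme_step f x - scheme_step g x\<bar> \<le> \<bar>f x - g x\<bar> - (tau / h\<^sup>2) * \<bar>b (f x) - b (g x)\<bar>
     + (tau / h\<^sup>2) / 2 * (\<bar>b (f (x + h)) - b (g (x + h))\<bar> + \<bar>b (f (x - h)) - b (g (x - h))\<bar>)"
proof -
  define m where "m = tau / h\<^sup>2"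
  have m: "m > 0" using ratio by (simp add: m_def)
  have 1: "\<bar>(f x - g x) - m * (b (f x) - b (g x))\<bar> = \<bar>f x - g x\<bar> - m * \<bar>b (f x) - b (g x)\<bar>"
    using b_mono[of "f x" "g x"] b_mono[of "g x" "f x"] ratio_b_le[of "f x" "g x"]
    by (cases "f x \<le> g x") (auto simp: m_def[symmetric] algebra_simps)
  have 2: "\<bar>m / 2 * (p + q)\<bar> \<le> m / 2 * (\<bar>p\<bar> + \<bar>q\<bar>)" for p q
    using m by (simp add: abs_mult)
  have "scheme_step f x - scheme_step g x = ((f x - g x) - m * (b (f x) - b (g x)))
     + m / 2 * ((b (f (x + h)) - b (g (x + h))) + (b (f (x - h)) - b (g (x - h))))"
    unfolding step_alt m_def[symmetric] by (simp add: algebra_simps)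
  moreover have "\<bar>((f x - g x) - m * (b (f x) - b (g x)))
     + m / 2 * ((b (f (x + h)) - b (g (x + h))) + (b (f (x - h)) - b (g (x - h))))\<bar>
    \<le> (\<bar>f x - g x\<bar> - m * \<bar>b (f x) - b (g x)\<bar>) + m / 2 * (\<bar>b (f (x + h)) - b (g (x + h))\<bar> + \<bar>b (f (x - h)) - b (g (x - h))\<bar>)"
    by (rule order_trans[OF abs_triangle_ineq add_mono[OF eq_refl[OF 1] 2]])
  ultimately show ?thesis unfolding m_def[symmetric] by simp
qed

text \<open>After integration the two neighbour terms of \<open>step_diff_le\<close> restore, by
  translation invariance, exactly what the central term takes away.\<close>

lemma step_contraction:
  assumes f: "integrable lborel f" and g: "integrable lborel g"
  shows "(LBINT x. \<bar>scheme_step f x - scheme_step g x\<bar>) \<le> (LBINT x. \<bar>f x - g x\<bar>)"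
proof -
  define m where "m = tau / h\<^sup>2"
  define D where "D x = \<bar>b (f x) - b (g x)\<bar>" for x
  have D: "integrable lborel D" unfolding D_def using integrable_b[OF f] integrable_b[OF g] by auto
  note Ds = integrable_shift[OF D, of h] integrable_shift[OF D, of "- h"]
  have "(LBINT x. \<bar>scheme_step f x - scheme_step g x\<bar>)
      \<le> (LBINT x. \<bar>f x - g x\<bar> - m * D x + m / 2 * (D (x + h) + D (x + - h)))"
  proof (rule integral_mono)
    show "\<bar>scheme_step f x - scheme_step g x\<bar> \<le> \<bar>f x - g x\<bar> - m * D x + m / 2 * (D (x + h) + D (x + - h))" for x
      using step_diff_le[of f x g] by (simp add: D_def m_def)
  qed (use f g D Ds integrable_step[OF f] integrable_step[OF g] in auto)
  also have "\<dots> = (LBINT x. \<bar>f x - g x\<bar>) - m * (LBINT x. D x)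
      + m / 2 * ((LBINT x. D (x + h)) + (LBINT x. D (x + - h)))"
    using f g D Ds by simp
  also have "\<dots> = (LBINT x. \<bar>f x - g x\<bar>)"
    using integral_shift[of D h] integral_shift[of D "- h"] by simp
  finally show ?thesis .
qed

text \<open>The constants \<open>M\<close> and \<open>- M\<close> are fixed by the step, and the
  step preserves order.\<close>

lemma step_bound:
  assumes f: "\<And>x. \<bar>f x\<bar> \<le> M"
  shows "\<bar>scheme_step f x\<bar> \<le> M"
proof -
  define m where "m = tau / h\<^sup>2"
  have m: "m > 0" using ratio by (simp add: m_def)
  have up: "p - m * b p \<le> q - m * b q" if "p \<le> q" for p q
    using ratio_b_le[of q p] b_mono[OF that] that by (auto simp: m_def[symmetric] algebra_simps)
  have "m * b (f (x + h)) \<le> m * b M" "m * b (f (x - h)) \<le> m * b M"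
    "m * b (- M) \<le> m * b (f (x + h))" "m * b (- M) \<le> m * b (f (x - h))"
    using f[of "x + h"] f[of "x - h"] m by (auto intro!: mult_left_mono b_mono)
  then show ?thesis
    using up[of "f x" M] up[of "- M" "f x"] f[of x] unfolding step_alt m_def[symmetric]
    by (auto simp: abs_le_iff algebra_simps)
qed

lemma step_shift: "scheme_step (\<lambda>x. f (x + a)) x = scheme_step f (x + a)"
  by (simp add: scheme_step_def second_diff_def algebra_simps)

lemma U_0 [simp]: "U 0 = u0" and U_Suc: "U (Suc n) = scheme_step (U n)"
  by (simp_all add: U_def)

lemma integrable_U: "integrable lborel (U n)"
  by (induction n) (auto simp: U_Suc u0 intro: integrable_step)

lemma U_bound: "\<bar>U n x\<bar> \<le> M"
  by (induction n arbitrary: x) (auto simp: U_Suc u0_bound intro: step_bound)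

lemma U_L1: "(LBINT x. \<bar>U n x\<bar>) \<le> A"
proof (induction n)
  case (Suc n)
  have "scheme_step (\<lambda>_. 0) = (\<lambda>_. 0)" by (rule ext) (simp add: scheme_step_def second_diff_def b_0)
  then show ?case
    using step_contraction[OF integrable_U, of "\<lambda>_. 0" n] Suc by (simp add: U_Suc)
qed (simp add: A_def)

text \<open>The step commutes with translations, so the contraction property compares the scheme
  with its own translate.\<close>

lemma U_L1_shift: "L1_shift (U n) y \<le> L1_shift u0 y"
proof (induction n)
  case (Suc n)
  have "L1_shift (U (Suc n)) y = (LBINT x. \<bar>scheme_step (\<lambda>x. U n (x + y)) x - scheme_step (U n) x\<bar>)"
    by (simp add: L1_shift_def U_Suc step_shift)
  also have "\<dots> \<le> L1_shift (U n) y"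
    unfolding L1_shift_def by (intro step_contraction integrable_shift integrable_U)
  finally show ?case using Suc by simp
qed simp

lemma integrable_w: "integrable lborel (w n)"
  unfolding w_def[abs_def] by (intro integrable_b integrable_U)

lemma w_measurable [measurable]: "w n \<in> borel_measurable borel"
  using integrable_w[of n] by auto

lemma w_bound: "\<bar>w n x\<bar> \<le> c * M"
  using order_trans[OF b_growth mult_left_mono[OF U_bound]] c by (simp add: w_def)

lemma w_L1: "(LBINT x. \<bar>w n x\<bar>) \<le> c * A"
proof -
  have "(LBINT x. \<bar>w n x\<bar>) \<le> (LBINT x. c * \<bar>U n x\<bar>)"
  proof (rule integral_mono)
    show "\<bar>w n x\<bar> \<le> c * \<bar>U n x\<bar>" for x by (simp add: w_def b_growth)
  qed (use integrable_w[of n] integrable_U[of n] in auto)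
  also have "\<dots> \<le> c * A" using U_L1[of n] c by simp
  finally show ?thesis .
qed

lemma W_Suc: "W (Suc n) x = W n x + tau * w n x"
  by (simp add: W_def algebra_simps)

lemma integrable_W: "integrable lborel (W n)"
  unfolding W_def[abs_def] using integrable_w by auto

lemma W_bound: "\<bar>W n x\<bar> \<le> tau * (real n * (c * M))"
proof -
  have "\<bar>\<Sum>j<n. w j x\<bar> \<le> (\<Sum>j<n. c * M)"
    by (rule order_trans[OF sum_abs sum_mono]) (rule w_bound)
  then show ?thesis using tau by (simp add: W_def abs_mult)
qed

lemma U_eq: "U n x = u0 x + 1 / 2 * second_diff h (W n) x"
proof (induction n)
  case (Suc n)
  have "second_diff h (W (Suc n)) x = second_diff h (W n) x + tau * second_diff h (w n) x"
    by (simp add: second_diff_def W_Suc add_divide_distrib diff_divide_distrib algebra_simps)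
  then show ?case using Suc by (simp add: U_Suc scheme_step_def w_def[abs_def] algebra_simps)
qed (simp add: W_def second_diff_def)

lemma diff_quot_W_Suc: "diff_quot h (W (Suc n)) x = diff_quot h (W n) x + tau * diff_quot h (w n) x"
  by (simp add: diff_quot_def W_Suc add_divide_distrib diff_divide_distrib algebra_simps)

lemma integrable_diff_quot: "integrable lborel f \<Longrightarrow> integrable lborel (diff_quot h f)"
  unfolding diff_quot_def[abs_def] using integrable_shift[of f h] by auto

lemma diff_quot_bound: "(\<And>x. \<bar>f x\<bar> \<le> B) \<Longrightarrow> \<bar>diff_quot h f x\<bar> \<le> 2 * B / \<bar>h\<bar>"
  using abs_triangle_ineq4[of "f (x + h)" "f x"]
  by (auto simp: diff_quot_def abs_divide intro!: divide_right_mono)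
     (smt (verit, best))

text \<open>Discrete form of the energy identity. Expanding the square of the quotient of
  \<open>W n + tau * w n\<close> leaves extra squares with the factor \<open>tau\<^sup>2\<close>;
  they arise because \<open>U n\<close> is expressed through \<open>W n\<close>, which does not yet
  contain the current step.\<close>

lemma energy_equality:
  "(\<Sum>n<m. tau * (LBINT x. U n x * w n x)) = (LBINT x. u0 x * W m x)
     - 1 / 4 * (LBINT x. (diff_quot h (W m) x)\<^sup>2)
     + tau\<^sup>2 / 4 * (\<Sum>n<m. LBINT x. (diff_quot h (w n) x)\<^sup>2)"
proof (induction m)
  case (Suc m)
  have [measurable]: "W m \<in> borel_measurable borel" using integrable_W[of m] by auto
  have [measurable]: "diff_quot h (w m) \<in> borel_measurable borel"
    using integrable_diff_quot[OF integrable_w[of m]] by auto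
  define P where "P = (LBINT x. diff_quot h (W m) x * diff_quot h (w m) x)"
  define Q where "Q = (LBINT x. (diff_quot h (w m) x)\<^sup>2)"
  define R where "R = (LBINT x. u0 x * w m x)"
  have i1: "integrable lborel (\<lambda>x. u0 x * w m x)" by (rule integrable_mult_bdd[OF u0 _ w_bound]) simp
  have i2: "integrable lborel (\<lambda>x. second_diff h (W m) x * w m x)"
    by (rule integrable_mult_bdd[OF integrable_second_diff[OF integrable_W] _ w_bound]) simp
  have i3: "integrable lborel (\<lambda>x. u0 x * W m x)"
    by (rule integrable_mult_bdd[OF u0 _ W_bound]) simp
  have i4: "integrable lborel (\<lambda>x. diff_quot h (W m) x * diff_quot h (w m) x)"
    by (rule integrable_mult_bdd[OF integrable_diff_quot[OF integrable_W] _ diff_quot_bound[OF w_bound]]) simp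
  have i5: "integrable lborel (\<lambda>x. (diff_quot h (W m) x)\<^sup>2)" "integrable lborel (\<lambda>x. (diff_quot h (w m) x)\<^sup>2)"
    using square_integrable_diff_quot[OF integrable_W W_bound, of h m 0]
      square_integrable_diff_quot[OF integrable_w w_bound, of h m 0] by auto
  have "(LBINT x. U m x * w m x) = (LBINT x. u0 x * w m x + 1 / 2 * (second_diff h (W m) x * w m x))"
    by (simp add: U_eq distrib_right)
  also have "\<dots> = R + 1 / 2 * (LBINT x. second_diff h (W m) x * w m x)"
    using i1 i2 by (simp add: R_def)
  also have "(LBINT x. second_diff h (W m) x * w m x) = - P"
    unfolding P_def using h by (intro integral_second_diff_diff_quot[OF integrable_W integrable_w W_bound]) auto
  finally have a: "(LBINT x. U m x * w m x) = R - P / 2" by simp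
  have e1: "(LBINT x. u0 x * W (Suc m) x) = (LBINT x. u0 x * W m x) + tau * R"
  proof -
    have "(LBINT x. u0 x * W (Suc m) x) = (LBINT x. u0 x * W m x + tau * (u0 x * w m x))"
      by (simp add: W_Suc algebra_simps)
    then show ?thesis using i1 i3 by (simp add: R_def)
  qed
  have e2: "(LBINT x. (diff_quot h (W (Suc m)) x)\<^sup>2) = (LBINT x. (diff_quot h (W m) x)\<^sup>2) + 2 * tau * P + tau\<^sup>2 * Q"
  proof -
    have "(LBINT x. (diff_quot h (W (Suc m)) x)\<^sup>2)
      = (LBINT x. (diff_quot h (W m) x)\<^sup>2 + (2 * tau) * (diff_quot h (W m) x * diff_quot h (w m) x) + tau\<^sup>2 * (diff_quot h (w m) x)\<^sup>2)"
      by (simp add: diff_quot_W_Suc power2_eq_square algebra_simps)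
    then show ?thesis using i4 i5 by (simp add: P_def Q_def)
  qed
  show ?case
    unfolding sum.lessThan_Suc Suc.IH a e1 e2 Q_def[symmetric] by (simp add: algebra_simps power2_eq_square)
qed (simp add: W_def diff_quot_def)

text \<open>The error of the explicit Euler method is of order \<open>tau / h\<^sup>2 \<le> lam\<close> and hence disappears in the limit.\<close>

lemma energy_inequality:
  "(\<Sum>n<m. tau * (LBINT x. U n x * w n x)) \<le> (LBINT x. u0 x * W m x)
     - 1 / 4 * (LBINT x. (diff_quot h (W m) x)\<^sup>2) + (real m * tau) * lam * c\<^sup>2 * M * A"
proof -
  \<comment> \<open>The inequality (a - b)^2 <= 2 a^2 + 2 b^2 gives the 4, and the squared L2 norm
    of \<open>w n\<close> is at most its sup bound times its L1 bound.\<close>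
  have sq: "(LBINT x. (diff_quot h (w n) x)\<^sup>2) \<le> 4 * c\<^sup>2 * M * A / h\<^sup>2" for n
  proof -
    have iw2: "integrable lborel (\<lambda>x. (w n x)\<^sup>2)"
      using integrable_mult_bdd[OF integrable_w[of n] _ w_bound[of n]] by (simp add: power2_eq_square)
    have "(LBINT x. (w n x)\<^sup>2) \<le> (LBINT x. (c * M) * \<bar>w n x\<bar>)"
    proof (rule integral_mono)
      show "(w n x)\<^sup>2 \<le> (c * M) * \<bar>w n x\<bar>" for x
        using abs_mult_le[OF w_bound, of "w n x" n x] by (simp add: power2_eq_square)
    qed (use iw2 integrable_w in auto)
    also have "\<dots> \<le> (c * M) * (c * A)"
      using w_L1[of n] c M_nonneg by (simp add: mult_left_mono)
    finally have l: "(LBINT x. (w n x)\<^sup>2) \<le> c\<^sup>2 * M * A" by (simp add: power2_eq_square ac_simps)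
    have "(LBINT x. (diff_quot h (w n) x)\<^sup>2) \<le> (LBINT x. (2 * (w n (x + h))\<^sup>2 + 2 * (w n x)\<^sup>2) / h\<^sup>2)"
    proof (rule integral_mono)
      show "(diff_quot h (w n) x)\<^sup>2 \<le> (2 * (w n (x + h))\<^sup>2 + 2 * (w n x)\<^sup>2) / h\<^sup>2" for x
        using sum_squares_bound[of "w n (x + h)" "- w n x"]
        by (auto simp: diff_quot_def power_divide power2_diff intro!: divide_right_mono)
    qed (use square_integrable_diff_quot[OF integrable_w w_bound, of h n 0] iw2 integrable_shift[OF iw2, of h] in auto)
    also have "\<dots> = (2 * (LBINT x. (w n (x + h))\<^sup>2) + 2 * (LBINT x. (w n x)\<^sup>2)) / h\<^sup>2"
      using iw2 integrable_shift[OF iw2, of h] by simp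
    also have "\<dots> = 4 * (LBINT x. (w n x)\<^sup>2) / h\<^sup>2"
      using integral_shift[of "\<lambda>x. (w n x)\<^sup>2" h] by simp
    also have "\<dots> \<le> 4 * (c\<^sup>2 * M * A) / h\<^sup>2" using l by (intro divide_right_mono) auto
    finally show ?thesis by (simp add: mult.assoc)
  qed
  have "tau\<^sup>2 / 4 * (\<Sum>n<m. LBINT x. (diff_quot h (w n) x)\<^sup>2) \<le> tau\<^sup>2 / 4 * (\<Sum>n<m. 4 * c\<^sup>2 * M * A / h\<^sup>2)"
    by (intro mult_left_mono sum_mono sq) auto
  also have "\<dots> = (real m * tau) * (tau / h\<^sup>2) * (c\<^sup>2 * M * A)" by (simp add: power2_eq_square)
  also have "\<dots> \<le> (real m * tau) * lam * (c\<^sup>2 * M * A)"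
    using ratio tau M_nonneg A_nonneg by (intro mult_right_mono mult_left_mono) auto
  finally show ?thesis unfolding energy_equality by (simp add: mult.assoc)
qed

section \<open>Piecewise constant interpolation in time\<close>

definition T :: real where "T = real N * tau"

definition ut :: "real \<times> real \<Rightarrow> real" where
  "ut = (\<lambda>(t, x). indicator {0..T} t * U (nat \<lfloor>t / tau\<rfloor>) x)"

definition et :: "real \<times> real \<Rightarrow> real" where
  "et = (\<lambda>(t, x). indicator {0..T} t * w (nat \<lfloor>t / tau\<rfloor>) x)"

lemma bdd_integrable_step_function:
  assumes g: "\<And>n. integrable lborel (g n)" and K: "\<And>n x. \<bar>g n x\<bar> \<le> K" and L: "\<And>n. (LBINT x. \<bar>g n x\<bar>) \<le> L"
  shows "bdd_integrable T K (\<lambda>(t, x). indicator {0..T} t * g (nat \<lfloor>t / tau\<rfloor>) x)"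
  unfolding bdd_integrable_def
proof (intro conjI allI impI)
  have [measurable]: "g n \<in> borel_measurable borel" for n using g[of n] by auto
  have [measurable]: "(\<lambda>(t, x). g (nat \<lfloor>t / tau\<rfloor>) x) \<in> borel_measurable plane"
    unfolding case_prod_beta by (rule measurable_compose_countable[where f="\<lambda>n p. g n (snd p)"]) measurable
  have [measurable]: "(\<lambda>t. LBINT x. \<bar>g (nat \<lfloor>t / tau\<rfloor>) x\<bar>) \<in> borel_measurable borel"
    by (rule measurable_compose[of _ _ "count_space UNIV"]) auto
  show "integrable plane (\<lambda>(t, x). indicator {0..T} t * g (nat \<lfloor>t / tau\<rfloor>) x)"
  proof (rule lborel_pair.Fubini_integrable)
    show "(\<lambda>(t, x). indicator {0..T} t * g (nat \<lfloor>t / tau\<rfloor>) x) \<in> borel_measurable plane"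
      by measurable
    have "integrable lborel (\<lambda>t. indicator {0..T} t * (LBINT x. \<bar>g (nat \<lfloor>t / tau\<rfloor>) x\<bar>))"
    proof (rule Bochner_Integration.integrable_bound)
      show "integrable lborel (\<lambda>t. L * indicator {0..T} t)" using integrable_indicator_Icc by auto
      show "AE t in lborel. norm (indicator {0..T} t * (LBINT x. \<bar>g (nat \<lfloor>t / tau\<rfloor>) x\<bar>)) \<le> norm (L * indicator {0..T} t)"
        using L by (auto split: split_indicator intro: order_trans[OF L abs_ge_self])
    qed measurable
    then show "integrable lborel (\<lambda>t. LBINT x. norm (case (t, x) of (t, x) \<Rightarrow> indicator {0..T} t * g (nat \<lfloor>t / tau\<rfloor>) x))"
      by (simp add: abs_mult)
    show "AE t in lborel. integrable lborel (\<lambda>x. case (t, x) of (t, x) \<Rightarrow> indicator {0..T} t * g (nat \<lfloor>t / tau\<rfloor>) x)"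
      using g by auto
  qed
  have K0: "K \<ge> 0" using K[of 0 0] by linarith
  show "\<bar>(\<lambda>(t, x). indicator {0..T} t * g (nat \<lfloor>t / tau\<rfloor>) x) p\<bar> \<le> K" for p
    using K K0 by (auto simp: case_prod_beta split: split_indicator)
qed auto

lemma bdd_integrable_ut: "bdd_integrable T M ut" and bdd_integrable_et: "bdd_integrable T (c * M) et"
  unfolding ut_def et_def
  by (rule bdd_integrable_step_function[OF integrable_U U_bound U_L1],
      rule bdd_integrable_step_function[OF integrable_w w_bound w_L1])

lemma ut_section: "ut (t, x) = indicator {0..T} t * U (nat \<lfloor>t / tau\<rfloor>) x"
  and et_section: "et (t, x) = indicator {0..T} t * w (nat \<lfloor>t / tau\<rfloor>) x"
  by (simp_all add: ut_def et_def)

lemma et_eq: "et p = b (ut p)"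
  by (cases p) (auto simp: ut_def et_def w_def b_0 split: split_indicator)

lemma ut_L1: "(LBINT x. \<bar>ut (t, x)\<bar>) \<le> A"
  using U_L1 A_nonneg by (auto simp: ut_section abs_mult split: split_indicator)

lemma integrable_ut: "integrable lborel (\<lambda>x. ut (t, x))"
  using integrable_U by (auto simp: ut_section)

lemma ut_L1_shift: "L1_shift (\<lambda>x. ut (t, x)) y \<le> L1_shift u0 y"
  using U_L1_shift[of "nat \<lfloor>t / tau\<rfloor>" y] L1_shift_nonneg[of u0 y]
  by (cases "t \<in> {0..T}") (auto simp: ut_section L1_shift_def)

lemma et_L1: "(LBINT x. \<bar>et (t, x)\<bar>) \<le> c * A"
  using w_L1 A_nonneg c by (auto simp: et_section abs_mult split: split_indicator)

lemma floor_bounds: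
  assumes "t \<ge> 0"
  shows "real (nat \<lfloor>t / tau\<rfloor>) * tau \<le> t" "t \<le> real (Suc (nat \<lfloor>t / tau\<rfloor>)) * tau"
proof -
  have "t / tau \<ge> 0" using assms tau by simp
  then have "real (nat \<lfloor>t / tau\<rfloor>) \<le> t / tau" "t / tau \<le> real (nat \<lfloor>t / tau\<rfloor>) + 1"
    by (auto simp: of_nat_nat)
  then show "real (nat \<lfloor>t / tau\<rfloor>) * tau \<le> t" "t \<le> real (Suc (nat \<lfloor>t / tau\<rfloor>)) * tau"
    using tau by (auto simp: field_simps)
qed

text \<open>In time the primitive is the piecewise linear interpolation of the sequence
  \<open>W\<close>.\<close>

lemma prim_et:
  assumes t: "t \<in> {0..T}" and n: "real n * tau \<le> t" "t \<le> real (Suc n) * tau"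
  shows "prim et t x = W n x + (t - real n * tau) * w n x"
proof -
  have "prim et t x = (LBINT s. indicator {0..t} s * w (nat \<lfloor>s / tau\<rfloor>) x)"
    unfolding prim_def using t
    by (intro Bochner_Integration.integral_cong) (auto simp: et_section split: split_indicator)
  then show ?thesis
    using step_function_integral(1)[OF tau n, of "\<lambda>n. w n x"] by (simp add: W_def)
qed

lemma prim_et_T: "prim et T x = W N x"
  using prim_et[of T N x] tau by (simp add: T_def algebra_simps)

lemma integral_ut_et:
  "(LBINT s. LBINT x. ut (s, x) * et (s, x)) = (\<Sum>n<N. tau * (LBINT x. U n x * w n x))"
proof -
  have "(LBINT s. LBINT x. ut (s, x) * et (s, x))
      = (LBINT s. indicator {0..T} s * (\<lambda>n. LBINT x. U n x * w n x) (nat \<lfloor>s / tau\<rfloor>))"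
    by (intro Bochner_Integration.integral_cong) (auto simp: ut_section et_section split: split_indicator)
  also have "\<dots> = tau * (\<Sum>n<N. LBINT x. U n x * w n x)"
    using tau by (subst step_function_integral(1)[OF tau, of N]) (auto simp: T_def algebra_simps)
  finally show ?thesis by (simp add: sum_distrib_left)
qed

lemma energy_inequality_strip:
  "(LBINT s. LBINT x. ut (s, x) * et (s, x)) \<le> (LBINT x. u0 x * prim et T x)
     - 1 / 4 * (LBINT x. (diff_quot h (prim et T) x)\<^sup>2) + T * lam * c\<^sup>2 * M * A"
proof -
  have "prim et T = W N" using prim_et_T by auto
  then show ?thesis unfolding integral_ut_et using energy_inequality[of N] by (simp add: T_def)
qed

lemma prim_et_L1:
  assumes t: "t \<in> {0..T}"
  shows "(LBINT x. \<bar>prim et t x\<bar>) \<le> T * (c * A)"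
proof -
  define n where "n = nat \<lfloor>t / tau\<rfloor>"
  have n: "real n * tau \<le> t" "t \<le> real (Suc n) * tau" using floor_bounds[of t] t by (auto simp: n_def)
  have "(LBINT x. \<bar>prim et t x\<bar>) \<le> (LBINT x. tau * (\<Sum>j<n. \<bar>w j x\<bar>) + (t - real n * tau) * \<bar>w n x\<bar>)"
  proof (rule integral_mono)
    fix x
    have "\<bar>W n x\<bar> \<le> tau * (\<Sum>j<n. \<bar>w j x\<bar>)" using tau by (simp add: W_def abs_mult)
    moreover have "\<bar>(t - real n * tau) * w n x\<bar> = (t - real n * tau) * \<bar>w n x\<bar>" using n by (simp add: abs_mult)
    ultimately show "\<bar>prim et t x\<bar> \<le> tau * (\<Sum>j<n. \<bar>w j x\<bar>) + (t - real n * tau) * \<bar>w n x\<bar>"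
      unfolding prim_et[OF t n] by linarith
  qed (use integrable_w integrable_prim[OF bdd_integrable_et] in auto)
  also have "\<dots> = tau * (\<Sum>j<n. LBINT x. \<bar>w j x\<bar>) + (t - real n * tau) * (LBINT x. \<bar>w n x\<bar>)"
    using integrable_w by simp
  also have "\<dots> \<le> tau * (\<Sum>j<n. c * A) + (t - real n * tau) * (c * A)"
    using tau n by (intro add_mono mult_left_mono sum_mono w_L1) auto
  also have "\<dots> = t * (c * A)" by (simp add: algebra_simps)
  also have "\<dots> \<le> T * (c * A)" using t c A_nonneg by (intro mult_right_mono) auto
  finally show ?thesis .
qed

text \<open>Two errors add up. In time, \<open>W n\<close> and the primitive differ by at most one
  step, of L1 norm at most \<open>tau * (c * A)\<close>, tested with a second difference bounded by
  \<open>B + K * h\<close>. In space, the second difference of \<phi> replaces its second derivative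
  at a cost of \<open>K * h\<close>, tested with a primitive of L1 norm at most
  \<open>T * (c * A)\<close>.\<close>

lemma approximate_equation:
  assumes t: "t \<in> {0..T}" and \<phi>: "\<phi> \<in> schwartz"
    and B: "\<And>x. \<bar>(deriv ^^ 2) \<phi> x\<bar> \<le> B"
    and K: "K \<ge> 0" "\<And>d x. d \<noteq> 0 \<Longrightarrow> \<bar>second_diff d \<phi> x - (deriv ^^ 2) \<phi> x\<bar> \<le> K * \<bar>d\<bar>"
  shows "\<bar>(LBINT x. ut (t, x) * \<phi> x) - ((LBINT x. u0 x * \<phi> x)
       + 1 / 2 * (LBINT x. prim et t x * (deriv ^^ 2) \<phi> x))\<bar> \<le> c * A * (tau * (B + K * h) + T * (K * h))"
proof -
  define n where "n = nat \<lfloor>t / tau\<rfloor>"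
  have n: "real n * tau \<le> t" "t \<le> real (Suc n) * tau" using floor_bounds[of t] t by (auto simp: n_def)
  note [measurable] = schwartz_measurable[OF \<phi>] schwartz_measurable[OF schwartz_funpow_deriv[OF \<phi>, of 2]]
  obtain C where C: "\<And>x. \<bar>\<phi> x\<bar> \<le> C" using schwartz_bounded[OF \<phi>] by blast
  let ?f = "(deriv ^^ 2) \<phi>" and ?D = "second_diff h \<phi>"
  have [measurable]: "?D \<in> borel_measurable borel" unfolding second_diff_def[abs_def] by measurable
  have DB: "\<bar>?D x\<bar> \<le> B + K * h" for x using K(2)[of h x] B[of x] h by auto
  have iW: "integrable lborel (\<lambda>x. W n x * ?D x)" by (rule integrable_mult_bdd[OF integrable_W _ DB]) simp
  have ip: "integrable lborel (\<lambda>x. prim et t x * ?D x)" "integrable lborel (\<lambda>x. prim et t x * ?f x)"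
    by (rule integrable_mult_bdd[OF integrable_prim[OF bdd_integrable_et] _ DB], simp)
       (rule integrable_mult_bdd[OF integrable_prim[OF bdd_integrable_et] _ B], simp)
  have i: "integrable lborel (\<lambda>x. u0 x * \<phi> x)" "integrable lborel (\<lambda>x. second_diff h (W n) x * \<phi> x)"
    by (rule integrable_mult_bdd[OF u0 _ C], simp)
       (rule integrable_mult_bdd[OF integrable_second_diff[OF integrable_W] _ C], simp)
  have "(LBINT x. ut (t, x) * \<phi> x) = (LBINT x. u0 x * \<phi> x + 1 / 2 * (second_diff h (W n) x * \<phi> x))"
    using t by (simp add: ut_section n_def[symmetric] U_eq distrib_right)
  also have "\<dots> = (LBINT x. u0 x * \<phi> x) + 1 / 2 * (LBINT x. second_diff h (W n) x * \<phi> x)"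
    using i by simp
  also have "(LBINT x. second_diff h (W n) x * \<phi> x) = (LBINT x. W n x * ?D x)"
    by (rule integral_second_diff[OF integrable_W _ C]) simp
  finally have eq: "(LBINT x. ut (t, x) * \<phi> x) = (LBINT x. u0 x * \<phi> x) + 1 / 2 * (LBINT x. W n x * ?D x)" .
  have d1: "\<bar>(LBINT x. W n x * ?D x) - (LBINT x. prim et t x * ?D x)\<bar> \<le> c * A * (tau * (B + K * h))"
  proof -
    have "(LBINT x. W n x * ?D x) - (LBINT x. prim et t x * ?D x)
      = (LBINT x. W n x * ?D x - prim et t x * ?D x)" using iW ip by simp
    also have "\<dots> = (LBINT x. - (t - real n * tau) * (w n x * ?D x))"
      by (simp add: prim_et[OF t n] algebra_simps)
    finally have "\<bar>(LBINT x. W n x * ?D x) - (LBINT x. prim et t x * ?D x)\<bar>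
        = (t - real n * tau) * \<bar>LBINT x. w n x * ?D x\<bar>" using n(1) by (simp add: abs_mult)
    also have "\<dots> \<le> tau * \<bar>LBINT x. w n x * ?D x\<bar>"
      using n(2) by (intro mult_right_mono) (auto simp: algebra_simps)
    also have "\<bar>LBINT x. w n x * ?D x\<bar> \<le> (LBINT x. (B + K * h) * \<bar>w n x\<bar>)"
      using integrable_w integrable_mult_bdd[OF integrable_w[of n] _ DB]
      by (intro order_trans[OF integral_abs_bound] integral_mono abs_mult_le DB) auto
    also have "\<dots> \<le> (B + K * h) * (c * A)"
      using w_L1[of n] order_trans[OF abs_ge_zero DB[of 0]] by (simp add: mult_left_mono)
    finally show ?thesis using tau by (simp add: mult_left_mono ac_simps)
  qed
  have d2: "\<bar>(LBINT x. prim et t x * ?D x) - (LBINT x. prim et t x * ?f x)\<bar> \<le> c * A * (T * (K * h))"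
  proof -
    have Kh: "\<bar>?D x - ?f x\<bar> \<le> K * h" for x using K(2)[of h x] h by auto
    have "(LBINT x. prim et t x * ?D x) - (LBINT x. prim et t x * ?f x)
      = (LBINT x. prim et t x * (?D x - ?f x))" using ip by (simp add: right_diff_distrib)
    then have "\<bar>(LBINT x. prim et t x * ?D x) - (LBINT x. prim et t x * ?f x)\<bar>
      \<le> (LBINT x. \<bar>prim et t x * (?D x - ?f x)\<bar>)" by (simp only: integral_abs_bound)
    also have "\<dots> \<le> (LBINT x. (K * h) * \<bar>prim et t x\<bar>)"
      using integrable_prim[OF bdd_integrable_et, of t] integrable_mult_bdd[OF integrable_prim[OF bdd_integrable_et, of t] _ Kh]
      by (intro integral_mono abs_mult_le Kh) auto
    also have "\<dots> \<le> (K * h) * (T * (c * A))"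
      using prim_et_L1[OF t] K h by (simp add: mult_left_mono)
    finally show ?thesis by (simp add: ac_simps)
  qed
  have "\<bar>(LBINT x. ut (t, x) * \<phi> x) - ((LBINT x. u0 x * \<phi> x) + 1 / 2 * (LBINT x. prim et t x * ?f x))\<bar>
     = 1 / 2 * \<bar>(LBINT x. W n x * ?D x) - (LBINT x. prim et t x * ?f x)\<bar>"
    unfolding eq by (simp add: abs_mult flip: right_diff_distrib diff_divide_distrib)
  also have "\<dots> \<le> \<bar>(LBINT x. W n x * ?D x) - (LBINT x. prim et t x * ?f x)\<bar>" by simp
  also have "\<dots> \<le> c * A * (tau * (B + K * h) + T * (K * h))"
    using d1 d2 by (simp add: distrib_left)
  finally show ?thesis .
qed

end

section \<open>Passage to the limit in the scheme\<close>

text \<open>Transfers L1 bounds along almost everywhere convergence. The bound is asked for only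
  eventually, because in the extension to all times it holds from some index on.\<close>

lemma L1_Fatou:
  fixes f :: "nat \<Rightarrow> 'a \<Rightarrow> real"
  assumes f: "\<And>n. integrable M (f n)" and B: "\<forall>\<^sub>F n in sequentially. (LINT x|M. \<bar>f n x\<bar>) \<le> B"
    and [measurable]: "g \<in> borel_measurable M" and lim: "AE x in M. (\<lambda>n. f n x) \<longlonglongrightarrow> g x"
  shows "integrable M g" "(LINT x|M. \<bar>g x\<bar>) \<le> B"
proof -
  have [measurable]: "f n \<in> borel_measurable M" for n using f[of n] by auto
  have B0: "B \<ge> 0"
  proof -
    obtain n where "(LINT x|M. \<bar>f n x\<bar>) \<le> B" using eventually_happens[OF B] by auto
    moreover have "0 \<le> (LINT x|M. \<bar>f n x\<bar>)" by simp
    ultimately show ?thesis by linarith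
  qed
  have "(\<integral>\<^sup>+x. ennreal \<bar>g x\<bar> \<partial>M) = (\<integral>\<^sup>+x. liminf (\<lambda>n. ennreal \<bar>f n x\<bar>) \<partial>M)"
  proof (rule nn_integral_cong_AE)
    show "AE x in M. ennreal \<bar>g x\<bar> = liminf (\<lambda>n. ennreal \<bar>f n x\<bar>)"
      using lim
    proof eventually_elim
      case (elim x)
      have "(\<lambda>n. ennreal \<bar>f n x\<bar>) \<longlonglongrightarrow> ennreal \<bar>g x\<bar>"
        using elim by (intro tendsto_ennrealI tendsto_rabs)
      then show ?case using lim_imp_Liminf[OF sequentially_bot] by metis
    qed
  qed
  also have "\<dots> \<le> liminf (\<lambda>n. \<integral>\<^sup>+x. ennreal \<bar>f n x\<bar> \<partial>M)" by (rule nn_integral_liminf) measurable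
  also have "\<dots> \<le> liminf (\<lambda>n. ennreal B)"
  proof (rule Liminf_mono)
    show "\<forall>\<^sub>F n in sequentially. (\<integral>\<^sup>+x. ennreal \<bar>f n x\<bar> \<partial>M) \<le> ennreal B"
      using B
    proof eventually_elim
      case (elim n)
      have "(\<integral>\<^sup>+x. ennreal \<bar>f n x\<bar> \<partial>M) = ennreal (LINT x|M. \<bar>f n x\<bar>)"
        using f[of n] by (intro nn_integral_eq_integral) auto
      then show ?case using elim by (simp add: ennreal_leI)
    qed
  qed
  also have "\<dots> = ennreal B" by (simp add: Liminf_const)
  finally have le: "(\<integral>\<^sup>+x. ennreal \<bar>g x\<bar> \<partial>M) \<le> ennreal B" .
  then show "integrable M g" by (intro integrableI_bounded) (auto simp: le_less_trans)
  then have "(\<integral>\<^sup>+x. ennreal \<bar>g x\<bar> \<partial>M) = ennreal (LINT x|M. \<bar>g x\<bar>)"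
    by (intro nn_integral_eq_integral) auto
  then show "(LINT x|M. \<bar>g x\<bar>) \<le> B" using le B0 by (simp add: ennreal_le_iff)
qed

lemma convex_tail_tendsto:
  fixes a :: "nat \<Rightarrow> nat \<Rightarrow> real"
  assumes a: "\<And>n k. a n k \<ge> 0" "\<And>n k. k < n \<Longrightarrow> a n k = 0" "\<And>n. (\<Sum>k\<le>m n. a n k) = 1"
    and r: "r \<longlonglongrightarrow> 0"
  shows "(\<lambda>n. \<Sum>k\<le>m n. a n k * r k) \<longlonglongrightarrow> 0"
proof (rule LIMSEQ_I)
  fix e :: real assume e: "e > 0"
  obtain n0 where n0: "\<And>k. k \<ge> n0 \<Longrightarrow> \<bar>r k\<bar> < e / 2" using LIMSEQ_D[OF r, of "e/2"] e by auto
  have "norm ((\<Sum>k\<le>m n. a n k * r k) - 0) < e" if n: "n \<ge> n0" for n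
  proof -
    have "\<bar>\<Sum>k\<le>m n. a n k * r k\<bar> \<le> (\<Sum>k\<le>m n. a n k * (e / 2))"
    proof (rule order_trans[OF sum_abs sum_mono])
      fix k
      show "\<bar>a n k * r k\<bar> \<le> a n k * (e / 2)"
      proof (cases "k < n")
        case False
        then have "\<bar>r k\<bar> \<le> e / 2" using n0[of k] n by simp
        from mult_left_mono[OF this a(1)] show ?thesis using a(1)[of n k] by (simp add: abs_mult)
      qed (simp add: a(2))
    qed
    also have "\<dots> = e / 2" by (simp add: a(3) flip: sum_distrib_right sum_divide_distrib)
    finally show ?thesis using e by simp
  qed
  then show "\<exists>no. \<forall>n\<ge>no. norm ((\<Sum>k\<le>m n. a n k * r k) - 0) < e" by blast
qed

lemma bdd_integrable_mono: "bdd_integrable T K f \<Longrightarrow> K \<le> K' \<Longrightarrow> bdd_integrable T K' f"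
  unfolding bdd_integrable_def by (meson order_trans)

lemma bdd_integrable_convex:
  fixes m :: nat
  assumes f: "\<And>k. bdd_integrable T K (f k)" and a: "\<And>k. a k \<ge> 0" "(\<Sum>k\<le>m. a k) = 1"
  shows "bdd_integrable T K (\<lambda>p. \<Sum>k\<le>m. a k * f k p)"
  unfolding bdd_integrable_def
proof (intro conjI allI impI)
  show "integrable plane (\<lambda>p. \<Sum>k\<le>m. a k * f k p)"
    using bdd_integrableD(1)[OF f] by auto
  fix p
  have "\<bar>\<Sum>k\<le>m. a k * f k p\<bar> \<le> (\<Sum>k\<le>m. a k * K)"
    using a bdd_integrableD(3)[OF f] by (intro order_trans[OF sum_abs sum_mono]) (auto simp: abs_mult mult_left_mono)
  also have "\<dots> = K" by (simp add: a flip: sum_distrib_right)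
  finally show "\<bar>\<Sum>k\<le>m. a k * f k p\<bar> \<le> K" .
qed (use bdd_integrableD(4)[OF f] in auto)

lemma prim_sum:
  fixes m :: nat
  assumes f: "\<And>k. bdd_integrable T K (f k)"
  shows "prim (\<lambda>p. \<Sum>k\<le>m. a k * f k p) t x = (\<Sum>k\<le>m. a k * prim (f k) t x)"
proof -
  have "prim (\<lambda>p. \<Sum>k\<le>m. a k * f k p) t x = (LBINT s. (\<Sum>k\<le>m. a k * (indicator {0..t} s * f k (s, x))))"
    by (simp add: prim_def sum_distrib_left mult.left_commute)
  then show ?thesis
    using integrable_time_section_ind[OF f] by (simp add: prim_def)
qed

lemma prim_mult_eq_pair:
  assumes f: "bdd_integrable T K f" and [measurable]: "g \<in> borel_measurable borel" and B: "\<And>x. \<bar>g x\<bar> \<le> B"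
  shows "(LBINT x. prim f t x * g x) = (LINT p|plane. indicator {0..t} (fst p) * f p * g (snd p))"
proof -
  note [measurable] = bdd_integrableD(2)[OF f]
  have i: "integrable plane (\<lambda>p. indicator {0..t} (fst p) * f p * g (snd p))"
  proof (rule Bochner_Integration.integrable_bound)
    show "integrable plane (\<lambda>p. B * \<bar>f p\<bar>)" using bdd_integrableD(1)[OF f] by auto
    show "AE p in plane. norm (indicator {0..t} (fst p) * f p * g (snd p)) \<le> norm (B * \<bar>f p\<bar>)"
    proof (intro AE_I2)
      fix p
      have "\<bar>f p * g (snd p)\<bar> \<le> \<bar>B * \<bar>f p\<bar>\<bar>" using order_trans[OF abs_mult_le[OF B] abs_ge_self] .
      then show "norm (indicator {0..t} (fst p) * f p * g (snd p)) \<le> norm (B * \<bar>f p\<bar>)"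
        by (auto split: split_indicator)
    qed
  qed measurable
  have "(LINT p|plane. indicator {0..t} (fst p) * f p * g (snd p))
      = (LBINT s. LBINT x. indicator {0..t} s * f (s, x) * g x)"
    using lborel_pair.integral_fst'[OF i] by simp
  then show ?thesis using integral_prim_mult(1)[OF f \<open>g \<in> borel_measurable borel\<close> B, where t = t] by (simp add: mult.assoc)
qed

lemma prim_mult_tendsto:
  assumes f: "\<And>n. bdd_integrable T K (f n)" and f': "bdd_integrable T K f'"
    and lim: "AE p in plane. (\<lambda>n. f n p) \<longlonglongrightarrow> f' p"
    and g: "integrable lborel g" and B: "\<And>x. \<bar>g x\<bar> \<le> B"
  shows "(\<lambda>n. LBINT x. prim (f n) t x * g x) \<longlonglongrightarrow> (LBINT x. prim f' t x * g x)"
proof -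
  have [measurable]: "g \<in> borel_measurable borel" using g by auto
  note [measurable] = bdd_integrableD(2)[OF f] bdd_integrableD(2)[OF f']
  have w: "integrable plane (\<lambda>(s, x). K * (indicator {0..T} s * \<bar>g x\<bar>))"
  proof (rule lborel_pair.Fubini_integrable)
    show "integrable lborel (\<lambda>s. LBINT x. norm (case (s, x) of (s, x) \<Rightarrow> K * (indicator {0..T} s * \<bar>g x\<bar>)))"
      using integrable_indicator_Icc[of T] by (simp add: abs_mult)
    show "AE s in lborel. integrable lborel (\<lambda>x. case (s, x) of (s, x) \<Rightarrow> K * (indicator {0..T} s * \<bar>g x\<bar>))"
      using g by auto
  qed measurable
  have "(\<lambda>n. LINT p|plane. indicator {0..t} (fst p) * f n p * g (snd p))
     \<longlonglongrightarrow> (LINT p|plane. indicator {0..t} (fst p) * f' p * g (snd p))"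
  proof (rule integral_dominated_convergence[OF _ _ w])
    show "AE p in plane. (\<lambda>n. indicator {0..t} (fst p) * f n p * g (snd p)) \<longlonglongrightarrow> indicator {0..t} (fst p) * f' p * g (snd p)"
      using lim by eventually_elim (intro tendsto_intros)
    fix n
    show "AE p in plane. norm (indicator {0..t} (fst p) * f n p * g (snd p)) \<le> (case p of (s, x) \<Rightarrow> K * (indicator {0..T} s * \<bar>g x\<bar>))"
    proof (intro AE_I2)
      fix p :: "real \<times> real"
      obtain s x where p: "p = (s, x)" by force
      have "\<bar>g x * f n (s, x)\<bar> \<le> K * \<bar>g x\<bar>" by (rule abs_mult_le[OF bdd_integrableD(3)[OF f]])
      then show "norm (indicator {0..t} (fst p) * f n p * g (snd p)) \<le> (case p of (s, x) \<Rightarrow> K * (indicator {0..T} s * \<bar>g x\<bar>))"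
        using bdd_integrableD(4)[OF f, of s n x] bdd_integrableD(5)[OF f]
        by (auto simp: p mult.commute split: split_indicator)
    qed
  qed measurable
  then show ?thesis
    by (simp add: prim_mult_eq_pair[OF f _ B] prim_mult_eq_pair[OF f' _ B])
qed

lemma integral_mult_tendsto:
  assumes f: "\<And>n. bdd_integrable T K (f n)" and f': "bdd_integrable T K f'"
    and lim: "AE p in plane. (\<lambda>n. f n p) \<longlonglongrightarrow> f' p"
    and g: "integrable plane g"
  shows "(\<lambda>n. LINT p|plane. g p * f n p) \<longlonglongrightarrow> (LINT p|plane. g p * f' p)"
proof (rule integral_dominated_convergence[where w="\<lambda>p. K * \<bar>g p\<bar>"])
  note [measurable] = bdd_integrableD(2)[OF f] bdd_integrableD(2)[OF f']
  have [measurable]: "g \<in> borel_measurable plane" using g by auto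
  show "(\<lambda>p. g p * f' p) \<in> borel_measurable plane" by measurable
  show "(\<lambda>p. g p * f n p) \<in> borel_measurable plane" for n by measurable
  show "integrable plane (\<lambda>p. K * \<bar>g p\<bar>)" using g by auto
  show "AE p in plane. (\<lambda>n. g p * f n p) \<longlonglongrightarrow> g p * f' p"
    using lim by eventually_elim (intro tendsto_intros)
  show "AE p in plane. norm (g p * f n p) \<le> K * \<bar>g p\<bar>" for n
    using abs_mult_le[OF bdd_integrableD(3)[OF f]] by simp
qed

lemma integral_diff_quot_mult:
  assumes f: "integrable lborel f" and [measurable]: "g \<in> borel_measurable borel" and B: "\<And>x. \<bar>g x\<bar> \<le> B"
  shows "(LBINT x. diff_quot d f x * g x) = - (LBINT x. f x * diff_quot (- d) g x)"
proof -
  have [measurable]: "f \<in> borel_measurable borel" using f by auto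
  have i: "integrable lborel (\<lambda>x. f (x + p) * g (x + q))" for p q
    by (rule integrable_mult_bdd[OF integrable_shift[OF f], where B = B]) (use B in auto)
  have e: "(LBINT x. f (x + d) * g x) = (LBINT x. f x * g (x + - d))"
    using integral_shift[of "\<lambda>x. f (x + d) * g x" "- d"] by simp
  have "(LBINT x. diff_quot d f x * g x) = ((LBINT x. f (x + d) * g x) - (LBINT x. f x * g x)) / d"
    using i[of d 0] i[of 0 0] by (simp add: diff_quot_def left_diff_distrib)
  also have "\<dots> = ((LBINT x. f x * g (x + - d)) - (LBINT x. f x * g x)) / d" unfolding e ..
  also have "\<dots> = (LBINT x. (f x * g (x + - d) - f x * g x) / d)"
    using i[of 0 "- d"] i[of 0 0] by simp
  also have "\<dots> = - (LBINT x. f x * diff_quot (- d) g x)"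
    by (simp add: diff_quot_def right_diff_distrib)
  finally show ?thesis .
qed

text \<open>What the passage to the limit uses of the scheme; the time step enters only through \<open>tau \<le> lam * h\<^sup>2\<close>.\<close>

definition scheme_approx :: "real \<Rightarrow> (real \<times> real) set \<Rightarrow> real \<Rightarrow> real \<Rightarrow> (real \<Rightarrow> real) \<Rightarrow> real \<Rightarrow> real \<Rightarrow>
    (real \<times> real \<Rightarrow> real) \<Rightarrow> (real \<times> real \<Rightarrow> real) \<Rightarrow> bool" where
  "scheme_approx T \<beta> c M u0 lam h u e \<longleftrightarrow>
    bdd_integrable T M u \<and> bdd_integrable T (c * M) e \<and>
    (\<forall>t. integrable lborel (\<lambda>x. u (t, x)) \<and> (LBINT x. \<bar>u (t, x)\<bar>) \<le> (LBINT x. \<bar>u0 x\<bar>) \<and>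
       (\<forall>y. L1_shift (\<lambda>x. u (t, x)) y \<le> L1_shift u0 y) \<and>
       integrable lborel (\<lambda>x. e (t, x)) \<and> (LBINT x. \<bar>e (t, x)\<bar>) \<le> c * (LBINT x. \<bar>u0 x\<bar>)) \<and>
    (\<forall>p. e p \<in> \<beta> `` {u p - lam * e p}) \<and>
    (LBINT s. LBINT x. u (s, x) * e (s, x)) \<le> (LBINT x. u0 x * prim e T x)
       - 1 / 4 * (LBINT x. (diff_quot h (prim e T) x)\<^sup>2) + T * lam * c\<^sup>2 * M * (LBINT x. \<bar>u0 x\<bar>) \<and>
    (\<forall>t\<in>{0..T}. \<forall>\<phi>\<in>schwartz. \<forall>B K. (\<forall>x. \<bar>(deriv ^^ 2) \<phi> x\<bar> \<le> B) \<longrightarrow> K \<ge> 0 \<longrightarrow>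
       (\<forall>d x. d \<noteq> 0 \<longrightarrow> \<bar>second_diff d \<phi> x - (deriv ^^ 2) \<phi> x\<bar> \<le> K * \<bar>d\<bar>) \<longrightarrow>
       \<bar>(LBINT x. u (t, x) * \<phi> x) - ((LBINT x. u0 x * \<phi> x)
       + 1 / 2 * (LBINT x. prim e t x * (deriv ^^ 2) \<phi> x))\<bar>
       \<le> c * (LBINT x. \<bar>u0 x\<bar>) * (lam * h\<^sup>2 * (B + K * h) + T * (K * h)))"

lemma scheme_approx_exists:
  assumes T: "T > 0" and acc: "m_accretive \<beta>" and c: "c > 0"
    and growth: "\<And>u w. w \<in> \<beta> `` {u} \<Longrightarrow> \<bar>w\<bar> \<le> c * \<bar>u\<bar>"
    and u0: "integrable lborel u0" "\<And>x. \<bar>u0 x\<bar> \<le> M" and lam: "lam > 0" and h: "h > 0"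
  shows "\<exists>u e. scheme_approx T \<beta> c M u0 lam h u e"
proof -
  \<comment> \<open>Enough steps for the CFL condition; \<open>tau\<close> is then chosen so that
    the last step ends exactly at \<open>T\<close>.\<close>
  define N where "N = nat \<lceil>T / (lam * h\<^sup>2)\<rceil>"
  define tau where "tau = T / real N"
  have pos: "T / (lam * h\<^sup>2) > 0" using T lam h by simp
  then have N: "N > 0" "T / (lam * h\<^sup>2) \<le> real N" unfolding N_def by (auto intro: real_nat_ceiling_ge)
  have ta: "tau > 0" "tau \<le> lam * h\<^sup>2" "real N * tau = T"
    using T N lam h by (auto simp: tau_def divide_le_eq mult.commute)
  interpret monotone_scheme "yosida \<beta> lam" lam tau h c M u0 N
    using lam ta h c u0 yosida_mono[OF acc c growth lam] yosida_lipschitz[OF acc c growth lam]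
      yosida_le[OF acc c growth lam] by unfold_locales auto
  have TT: "T = local.T" by (simp only: T_def ta(3))
  have "et p \<in> \<beta> `` {ut p - lam * et p}" for p
    unfolding et_eq by (rule yosida_in[OF acc c growth lam])
  moreover have "integrable lborel (\<lambda>x. et (t, x))" for t
    using integrable_w by (auto simp: et_section)
  moreover have "\<bar>(LBINT x. ut (t, x) * \<phi> x) - ((LBINT x. u0 x * \<phi> x)
       + 1 / 2 * (LBINT x. prim et t x * (deriv ^^ 2) \<phi> x))\<bar>
       \<le> c * (LBINT x. \<bar>u0 x\<bar>) * (lam * h\<^sup>2 * (B + K * h) + T * (K * h))"
    if "t \<in> {0..T}" "\<phi> \<in> schwartz" "\<forall>x. \<bar>(deriv ^^ 2) \<phi> x\<bar> \<le> B" "K \<ge> 0"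
      "\<forall>d x. d \<noteq> 0 \<longrightarrow> \<bar>second_diff d \<phi> x - (deriv ^^ 2) \<phi> x\<bar> \<le> K * \<bar>d\<bar>" for t \<phi> B K
  proof -
    have "0 \<le> B + K * h" using that(3)[rule_format, of 0] that(4) h by (intro add_nonneg_nonneg) auto
    then have "c * A * (tau * (B + K * h) + T * (K * h)) \<le> c * A * (lam * h\<^sup>2 * (B + K * h) + T * (K * h))"
      using c A_nonneg ta by (intro mult_left_mono add_right_mono mult_right_mono) auto
    then show ?thesis
      using approximate_equation[of t \<phi> B K] that unfolding TT[symmetric] A_def by auto
  qed
  ultimately have "scheme_approx T \<beta> c M u0 lam h ut et"
    unfolding scheme_approx_def
    using bdd_integrable_ut bdd_integrable_et integrable_ut ut_L1 ut_L1_shift et_L1 energy_inequality_strip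
    unfolding TT[symmetric] A_def by blast
  then show ?thesis by blast
qed

lemma integral_abs_convex_le:
  fixes f :: "nat \<Rightarrow> 'a \<Rightarrow> real" and m :: nat
  assumes f: "\<And>k. integrable N (f k)" "\<And>k. (LINT x|N. \<bar>f k x\<bar>) \<le> B"
    and a: "\<And>k. a k \<ge> 0" "(\<Sum>k\<le>m. a k) = 1"
  shows "(LINT x|N. \<bar>\<Sum>k\<le>m. a k * f k x\<bar>) \<le> B"
proof -
  have "(LINT x|N. \<bar>\<Sum>k\<le>m. a k * f k x\<bar>) \<le> (LINT x|N. (\<Sum>k\<le>m. a k * \<bar>f k x\<bar>))"
  proof (rule integral_mono)
    show "\<bar>\<Sum>k\<le>m. a k * f k x\<bar> \<le> (\<Sum>k\<le>m. a k * \<bar>f k x\<bar>)" for x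
      using a by (intro order_trans[OF sum_abs sum_mono]) (auto simp: abs_mult)
  qed (use f in auto)
  also have "\<dots> = (\<Sum>k\<le>m. a k * (LINT x|N. \<bar>f k x\<bar>))" using f by simp
  also have "\<dots> \<le> (\<Sum>k\<le>m. a k * B)" by (intro sum_mono mult_left_mono f a)
  also have "\<dots> = B" by (simp add: a flip: sum_distrib_right)
  finally show ?thesis .
qed

text \<open>\<open>energy_identity\<close> concerns the zero initial datum; subtracting the datum,
  held constant in time, reduces a solution of the linear equation to that case.\<close>

lemma weak_solution_sub_initial:
  assumes U: "bdd_integrable T K U" and E: "bdd_integrable T K E"
    and u0: "integrable lborel u0" "\<And>x. \<bar>u0 x\<bar> \<le> M"
    and eq: "AE t in lborel. t \<in> {0..T} \<longrightarrow> (\<forall>\<phi>\<in>schwartz. (LBINT x. U (t, x) * \<phi> x) =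
      (LBINT x. u0 x * \<phi> x) + 1 / 2 * (LBINT x. prim E t x * (deriv ^^ 2) \<phi> x))"
  defines "z \<equiv> (\<lambda>p. U p - indicator {0..T} (fst p) * u0 (snd p))"
  shows "bdd_integrable T (K + M) z" "weak_solution T z E"
proof -
  have [measurable]: "u0 \<in> borel_measurable borel" using u0 by auto
  have M0: "M \<ge> 0" using u0(2)[of 0] by linarith
  have "integrable plane (\<lambda>(s, x). indicator {0..T} s * u0 x)"
  proof (rule lborel_pair.Fubini_integrable)
    show "integrable lborel (\<lambda>s. LBINT x. norm (case (s, x) of (s, x) \<Rightarrow> indicator {0..T} s * u0 x))"
      using integrable_indicator_Icc[of T] by (simp add: abs_mult)
    show "AE s in lborel. integrable lborel (\<lambda>x. case (s, x) of (s, x) \<Rightarrow> indicator {0..T} s * u0 x)"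
      using u0 by auto
  qed measurable
  then have i: "integrable plane (\<lambda>p. indicator {0..T} (fst p) * u0 (snd p))"
    by (simp add: case_prod_beta')
  show "bdd_integrable T (K + M) z"
    unfolding bdd_integrable_def
  proof (intro conjI allI impI)
    show "integrable plane z" unfolding z_def using i bdd_integrableD(1)[OF U] by auto
    fix p
    show "\<bar>z p\<bar> \<le> K + M"
      using bdd_integrableD(3)[OF U, of p] u0(2)[of "snd p"] M0
      by (auto simp: z_def split: split_indicator)
  qed (use bdd_integrableD(4)[OF U] in \<open>auto simp: z_def\<close>)
  show "weak_solution T z E"
    unfolding weak_solution_def using eq bdd_integrable_section[OF U]
  proof (eventually_elim, intro impI ballI)
    case (elim t)
    fix \<phi> :: "real \<Rightarrow> real" assume t: "t \<in> {0..T}" and \<phi>: "\<phi> \<in> schwartz"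
    note [measurable] = schwartz_measurable[OF \<phi>]
    obtain B where B: "\<And>x. \<bar>\<phi> x\<bar> \<le> B" using schwartz_bounded[OF \<phi>] by blast
    have i: "integrable lborel (\<lambda>x. U (t, x) * \<phi> x)" "integrable lborel (\<lambda>x. u0 x * \<phi> x)"
      by (rule integrable_mult_bdd[OF elim(2) _ B], simp, rule integrable_mult_bdd[OF u0(1) _ B], simp)
    have "(LBINT x. z (t, x) * \<phi> x) = (LBINT x. U (t, x) * \<phi> x - u0 x * \<phi> x)"
      using t by (simp add: z_def left_diff_distrib)
    also have "\<dots> = 1 / 2 * (LBINT x. prim E t x * (deriv ^^ 2) \<phi> x)"
      using i elim(1)[rule_format, OF t \<phi>] by simp
    finally show "(LBINT x. z (t, x) * \<phi> x) = 1 / 2 * (LBINT x. prim E t x * (deriv ^^ 2) \<phi> x)" .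
  qed
qed

text \<open>One common bound \<open>M + c * M\<close> serves both functions; the sharp bound
  \<open>M\<close> for \<open>U\<close> is kept apart because the final sup estimate depends on it.
  The translation modulus of \<open>U\<close> and the L1 bound of \<open>E\<close> feed the
  continuity in time.\<close>

definition limit_solution :: "real \<Rightarrow> (real \<times> real) set \<Rightarrow> real \<Rightarrow> real \<Rightarrow> (real \<Rightarrow> real) \<Rightarrow>
    (real \<times> real \<Rightarrow> real) \<Rightarrow> (real \<times> real \<Rightarrow> real) \<Rightarrow> bool" where
  "limit_solution T \<beta> c M u0 U E \<longleftrightarrow>
    bdd_integrable T (M + c * M) U \<and> bdd_integrable T (M + c * M) E \<and>
    (AE t in lborel. t \<in> {0..T} \<longrightarrow> (\<forall>\<phi>\<in>schwartz. (LBINT x. U (t, x) * \<phi> x) =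
      (LBINT x. u0 x * \<phi> x) + 1 / 2 * (LBINT x. prim E t x * (deriv ^^ 2) \<phi> x))) \<and>
    (AE p in plane. E p \<in> \<beta> `` {U p}) \<and>
    (AE t in lborel. \<forall>y. L1_shift (\<lambda>x. U (t, x)) y \<le> L1_shift u0 y) \<and>
    (AE t in lborel. (LBINT x. \<bar>E (t, x)\<bar>) \<le> c * (LBINT x. \<bar>u0 x\<bar>)) \<and>
    (AE p in plane. \<bar>U p\<bar> \<le> M)"

theorem limit_solution_exists:
  assumes T: "T > 0" and acc: "m_accretive \<beta>" and c: "c > 0"
    and growth: "\<And>u w. w \<in> \<beta> `` {u} \<Longrightarrow> \<bar>w\<bar> \<le> c * \<bar>u\<bar>"
    and u0: "integrable lborel u0" "\<And>x. \<bar>u0 x\<bar> \<le> M"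
  shows "\<exists>U E. limit_solution T \<beta> c M u0 U E"
proof -
  define A where "A = (LBINT x. \<bar>u0 x\<bar>)"
  define K where "K = M + c * M"
  define lam where "lam k = 1 / real (Suc k)" for k
  \<comment> \<open>Powers of 1/2, so that a coarse step \<open>h j\<close> is an integer multiple
    of each finer step \<open>h k\<close>, as \<open>diff_quot_mult_le\<close> demands.\<close>
  define h where "h k = (1 / 2 :: real) ^ k" for k
  have M0: "M \<ge> 0" using u0(2)[of 0] by linarith
  have A0: "A \<ge> 0" by (simp add: A_def)
  have MK: "M \<le> K" "c * M \<le> K" using M0 c by (auto simp: K_def)
  have lam: "lam k > 0" and h: "h k > 0" for k by (auto simp: lam_def h_def)
  have lam_lim: "lam \<longlonglongrightarrow> 0" unfolding lam_def by (rule LIMSEQ_Suc) (rule lim_1_over_n)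
  have h_lim: "h \<longlonglongrightarrow> 0" unfolding h_def by (rule LIMSEQ_realpow_zero) auto
  have [measurable]: "u0 \<in> borel_measurable borel" using u0 by auto
  have "\<forall>k. \<exists>u e. scheme_approx T \<beta> c M u0 (lam k) (h k) u e"
    using scheme_approx_exists[OF T acc c growth u0 lam h] by blast
  then obtain u e where ue: "\<And>k. scheme_approx T \<beta> c M u0 (lam k) (h k) (u k) (e k)" by metis
  have uM: "bdd_integrable T M (u k)" and ecM: "bdd_integrable T (c * M) (e k)" for k
    using ue[of k] unfolding scheme_approx_def by auto
  note u = bdd_integrable_mono[OF uM MK(1)] and e = bdd_integrable_mono[OF ecM MK(2)]
  have us: "integrable lborel (\<lambda>x. u k (t, x))" "(LBINT x. \<bar>u k (t, x)\<bar>) \<le> A"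
      "L1_shift (\<lambda>x. u k (t, x)) y \<le> L1_shift u0 y"
    and es: "integrable lborel (\<lambda>x. e k (t, x))" "(LBINT x. \<bar>e k (t, x)\<bar>) \<le> c * A" for k t y
    using ue[of k] unfolding scheme_approx_def A_def by auto
  note [measurable] = bdd_integrableD(2)[OF u] bdd_integrableD(2)[OF e]
  obtain a :: "nat \<Rightarrow> nat \<Rightarrow> real" and m U0 E0 where a: "\<And>n k. a n k \<ge> 0" "\<And>n k. k < n \<Longrightarrow> a n k = 0"
    "\<And>n. (\<Sum>k\<le>m n. a n k) = 1"
    and UE0 [measurable]: "U0 \<in> borel_measurable plane" "E0 \<in> borel_measurable plane"
    and conv0: "AE p in plane. (\<lambda>n. \<Sum>k\<le>m n. a n k * u k p) \<longlonglongrightarrow> U0 p"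
      "AE p in plane. (\<lambda>n. \<Sum>k\<le>m n. a n k * e k p) \<longlonglongrightarrow> E0 p"
    by (rule convex_tail_AE_tendsto[of u e K]) (use bdd_integrableD(3)[OF u] bdd_integrableD(3)[OF e] in auto)
  define Ut where "Ut n p = (\<Sum>k\<le>m n. a n k * u k p)" for n p
  define Et where "Et n p = (\<Sum>k\<le>m n. a n k * e k p)" for n p
  have Ut: "bdd_integrable T K (Ut n)" and Et: "bdd_integrable T K (Et n)" for n
    unfolding Ut_def[abs_def] Et_def[abs_def] by (intro bdd_integrable_convex u e a)+
  have UtM: "bdd_integrable T M (Ut n)" for n
    unfolding Ut_def[abs_def] by (intro bdd_integrable_convex uM a)
  note [measurable] = bdd_integrableD(2)[OF Ut] bdd_integrableD(2)[OF Et]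
  have Uts: "integrable lborel (\<lambda>x. Ut n (t, x))" "(LBINT x. \<bar>Ut n (t, x)\<bar>) \<le> A"
    and Ets: "integrable lborel (\<lambda>x. Et n (t, x))" "(LBINT x. \<bar>Et n (t, x)\<bar>) \<le> c * A" for n t
    unfolding Ut_def Et_def using us es
    by (auto intro!: integral_abs_convex_le us(1,2) es a)
  have Utshift: "(LBINT x. \<bar>Ut n (t, x + y) - Ut n (t, x)\<bar>) \<le> L1_shift u0 y" for n t y
  proof -
    have "(LBINT x. \<bar>\<Sum>k\<le>m n. a n k * (u k (t, x + y) - u k (t, x))\<bar>) \<le> L1_shift u0 y"
      using us(3) integrable_shift[OF us(1)] us(1)
      by (intro integral_abs_convex_le a) (auto simp: L1_shift_def)
    then show ?thesis by (simp add: Ut_def right_diff_distrib sum_subtractf)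
  qed
  have total: "(LINT p|plane. \<bar>f p\<bar>) \<le> T * L"
    if f: "bdd_integrable T K f" and L: "\<And>t. (LBINT x. \<bar>f (t, x)\<bar>) \<le> L" for f L
  proof -
    note i = integrable_abs[OF bdd_integrableD(1)[OF f]]
    have "(LINT p|plane. \<bar>f p\<bar>) = (LBINT t. LBINT x. \<bar>f (t, x)\<bar>)"
      using lborel_pair.integral_fst'[OF i] by simp
    also have "\<dots> \<le> (LBINT t. L * indicator {0..T} t)"
    proof (rule integral_mono)
      show "(LBINT x. \<bar>f (t, x)\<bar>) \<le> L * indicator {0..T} t" for t
        using L[of t] bdd_integrableD(4)[OF f, of t] by (cases "t \<in> {0..T}") auto
    qed (use lborel_pair.integrable_fst'[OF i] integrable_indicator_Icc in auto)
    also have "\<dots> = T * L" using T by simp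
    finally show ?thesis .
  qed
  \<comment> \<open>The limits are known almost everywhere only. The approximations are unchanged by
    the cutoff, so it may be applied to the limits to gain pointwise bounds.\<close>
  define U where "U = cutoff T K U0"
  define E where "E = cutoff T K E0"
  have [measurable]: "U \<in> borel_measurable plane" "E \<in> borel_measurable plane"
    unfolding U_def E_def cutoff_def[abs_def] by measurable
  have cut: "AE p in plane. (\<lambda>n. f n p) \<longlonglongrightarrow> cutoff T K g p"
    if f: "\<And>n. bdd_integrable T K (f n)" and g: "AE p in plane. (\<lambda>n. f n p) \<longlonglongrightarrow> g p"
    for f :: "nat \<Rightarrow> real \<times> real \<Rightarrow> real" and g
    using g
  proof eventually_elim
    case (elim p)
    have "(\<lambda>n. cutoff T K (f n) p) \<longlonglongrightarrow> cutoff T K g p"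
      unfolding cutoff_def using elim by (intro tendsto_intros)
    moreover have "cutoff T K (f n) p = f n p" for n
      using bdd_integrableD(3)[OF f, of n p] bdd_integrableD(4)[OF f, of "fst p" n "snd p"]
      by (cases p) (auto simp: cutoff_def split: split_indicator)
    ultimately show ?case by simp
  qed
  have convU: "AE p in plane. (\<lambda>n. Ut n p) \<longlonglongrightarrow> U p"
    unfolding U_def by (rule cut[OF Ut]) (use conv0(1) in \<open>simp add: Ut_def\<close>)
  have convE: "AE p in plane. (\<lambda>n. Et n p) \<longlonglongrightarrow> E p"
    unfolding E_def by (rule cut[OF Et]) (use conv0(2) in \<open>simp add: Et_def\<close>)
  have K0: "K \<ge> 0" using M0 MK by linarith
  have iU: "integrable plane U"
    by (rule L1_Fatou(1)[OF bdd_integrableD(1)[OF Ut] _ _ convU, of "T * A"])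
       (use total[OF Ut Uts(2)] in auto)
  have iE: "integrable plane E"
    by (rule L1_Fatou(1)[OF bdd_integrableD(1)[OF Et] _ _ convE, of "T * (c * A)"])
       (use total[OF Et Ets(2)] in auto)
  have U: "bdd_integrable T K U" and E: "bdd_integrable T K E"
    unfolding bdd_integrable_def using iU iE K0 by (auto simp: U_def E_def cutoff_def split: split_indicator)
  have UM: "AE p in plane. \<bar>U p\<bar> \<le> M"
    using convU
  proof eventually_elim
    case (elim p)
    show ?case
      by (rule LIMSEQ_le_const2[OF tendsto_rabs[OF elim]]) (use bdd_integrableD(3)[OF UtM] in auto)
  qed
  have secU: "AE t in lborel. AE x in lborel. (\<lambda>n. Ut n (t, x)) \<longlonglongrightarrow> U (t, x)"
    using lborel_pair.AE_pair[OF convU] .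
  have secE: "AE t in lborel. AE x in lborel. (\<lambda>n. Et n (t, x)) \<longlonglongrightarrow> E (t, x)"
    using lborel_pair.AE_pair[OF convE] .
  have EL1: "AE t in lborel. (LBINT x. \<bar>E (t, x)\<bar>) \<le> c * A"
    using secE
  proof eventually_elim
    case (elim t)
    show ?case by (rule L1_Fatou(2)[OF Ets(1) _ _ elim]) (use Ets(2) in auto)
  qed
  have Ushift: "AE t in lborel. \<forall>y. L1_shift (\<lambda>x. U (t, x)) y \<le> L1_shift u0 y"
    using secU
  proof (eventually_elim, intro allI)
    case (elim t)
    fix y
    have lim: "AE x in lborel. (\<lambda>n. Ut n (t, x + y) - Ut n (t, x)) \<longlonglongrightarrow> U (t, x + y) - U (t, x)"
      using elim AE_shift[OF elim, of y] by eventually_elim (intro tendsto_intros)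
    show "L1_shift (\<lambda>x. U (t, x)) y \<le> L1_shift u0 y"
      unfolding L1_shift_def[of "\<lambda>x. U (t, x)"]
      by (rule L1_Fatou(2)[OF _ _ _ lim]) (use Uts(1) integrable_shift[OF Uts(1)] Utshift in auto)
  qed
  have equation: "AE t in lborel. t \<in> {0..T} \<longrightarrow> (\<forall>\<phi>\<in>schwartz. (LBINT x. U (t, x) * \<phi> x) =
      (LBINT x. u0 x * \<phi> x) + 1 / 2 * (LBINT x. prim E t x * (deriv ^^ 2) \<phi> x))"
    using secU
  proof (eventually_elim, intro impI ballI)
    case (elim t)
    fix \<phi> :: "real \<Rightarrow> real" assume t: "t \<in> {0..T}" and \<phi>: "\<phi> \<in> schwartz"
    note [measurable] = schwartz_measurable[OF \<phi>]
    note \<phi>2 = schwartz_funpow_deriv[OF \<phi>, of 2]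
    obtain B0 where B0: "\<And>x. \<bar>\<phi> x\<bar> \<le> B0" using schwartz_bounded[OF \<phi>] by blast
    obtain B where B: "\<And>x. \<bar>(deriv ^^ 2) \<phi> x\<bar> \<le> B" using schwartz_bounded[OF \<phi>2] by blast
    obtain K' where K': "K' \<ge> 0" "\<And>d x. d \<noteq> 0 \<Longrightarrow> \<bar>second_diff d \<phi> x - (deriv ^^ 2) \<phi> x\<bar> \<le> K' * \<bar>d\<bar>"
      using second_diff_approx[OF \<phi>] by blast
    define I0 where "I0 = (LBINT x. u0 x * \<phi> x)"
    define L where "L k = (LBINT x. u k (t, x) * \<phi> x)" for k
    define R where "R k = (LBINT x. prim (e k) t x * (deriv ^^ 2) \<phi> x)" for k
    define err where "err k = c * A * (lam k * (h k)\<^sup>2 * (B + K' * h k) + T * (K' * h k))" for k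
    have err: "\<bar>L k - (I0 + 1 / 2 * R k)\<bar> \<le> err k" for k
      using ue[of k] t \<phi> B K' unfolding scheme_approx_def L_def I0_def R_def err_def A_def by blast
    have "err \<longlonglongrightarrow> c * A * (0 * 0\<^sup>2 * (B + K' * 0) + T * (K' * 0))"
      unfolding err_def by (intro tendsto_intros lam_lim h_lim)
    then have err0: "err \<longlonglongrightarrow> 0" by simp
    have LU: "(LBINT x. Ut n (t, x) * \<phi> x) = (\<Sum>k\<le>m n. a n k * L k)" for n
    proof -
      have i: "integrable lborel (\<lambda>x. u k (t, x) * \<phi> x)" for k
        by (rule integrable_mult_bdd[OF us(1) _ B0]) simp
      have "(LBINT x. Ut n (t, x) * \<phi> x) = (LBINT x. (\<Sum>k\<le>m n. a n k * (u k (t, x) * \<phi> x)))"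
        by (simp add: Ut_def sum_distrib_right mult.assoc)
      then show ?thesis using i by (simp add: L_def)
    qed
    have RE: "(LBINT x. prim (Et n) t x * (deriv ^^ 2) \<phi> x) = (\<Sum>k\<le>m n. a n k * R k)" for n
    proof -
      have i: "integrable lborel (\<lambda>x. prim (e k) t x * (deriv ^^ 2) \<phi> x)" for k
        by (rule integrable_mult_bdd[OF integrable_prim[OF e] _ B]) (use schwartz_measurable[OF \<phi>2] in simp)
      have "(LBINT x. prim (Et n) t x * (deriv ^^ 2) \<phi> x)
          = (LBINT x. (\<Sum>k\<le>m n. a n k * (prim (e k) t x * (deriv ^^ 2) \<phi> x)))"
        unfolding Et_def[abs_def] prim_sum[OF e] by (simp add: sum_distrib_right mult.assoc)
      then show ?thesis using i by (simp add: R_def)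
    qed
    have c1: "(\<lambda>n. \<Sum>k\<le>m n. a n k * L k) \<longlonglongrightarrow> (LBINT x. U (t, x) * \<phi> x)"
      unfolding LU[symmetric]
    proof (rule integral_dominated_convergence[where w="\<lambda>x. K * \<bar>\<phi> x\<bar>"])
      show "AE x in lborel. (\<lambda>n. Ut n (t, x) * \<phi> x) \<longlonglongrightarrow> U (t, x) * \<phi> x"
        using elim by eventually_elim (intro tendsto_intros)
      show "AE x in lborel. norm (Ut n (t, x) * \<phi> x) \<le> K * \<bar>\<phi> x\<bar>" for n
        using bdd_integrableD(3)[OF Ut] by (auto simp: abs_mult intro!: AE_I2 mult_right_mono)
    qed (use schwartz_integrable[OF \<phi>] in auto)
    have c2: "(\<lambda>n. \<Sum>k\<le>m n. a n k * R k) \<longlonglongrightarrow> (LBINT x. prim E t x * (deriv ^^ 2) \<phi> x)"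
      unfolding RE[symmetric] by (rule prim_mult_tendsto[OF Et E convE schwartz_integrable[OF \<phi>2] B])
    \<comment> \<open>The equation is linear: a combination satisfies it up to the same combination
      of the errors, which tends to zero because the weights sit on the tail.\<close>
    have "(\<lambda>n. (\<Sum>k\<le>m n. a n k * L k) - (I0 + 1 / 2 * (\<Sum>k\<le>m n. a n k * R k))) \<longlonglongrightarrow> 0"
    proof (rule Lim_null_comparison[OF _ convex_tail_tendsto[OF a err0]])
      have "\<bar>(\<Sum>k\<le>m n. a n k * L k) - (I0 + 1 / 2 * (\<Sum>k\<le>m n. a n k * R k))\<bar> \<le> (\<Sum>k\<le>m n. a n k * err k)" for n
      proof -
        have "(\<Sum>k\<le>m n. a n k * (L k - (I0 + 1 / 2 * R k)))
            = (\<Sum>k\<le>m n. a n k * L k) - ((\<Sum>k\<le>m n. a n k) * I0 + 1 / 2 * (\<Sum>k\<le>m n. a n k * R k))"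
          by (simp add: right_diff_distrib distrib_left sum_subtractf sum.distrib sum_distrib_right sum_divide_distrib)
        then have "\<bar>(\<Sum>k\<le>m n. a n k * L k) - (I0 + 1 / 2 * (\<Sum>k\<le>m n. a n k * R k))\<bar>
            = \<bar>\<Sum>k\<le>m n. a n k * (L k - (I0 + 1 / 2 * R k))\<bar>" by (simp add: a(3))
        also have "\<dots> \<le> (\<Sum>k\<le>m n. a n k * err k)"
        proof (rule order_trans[OF sum_abs sum_mono])
          fix k
          show "\<bar>a n k * (L k - (I0 + 1 / 2 * R k))\<bar> \<le> a n k * err k"
            using mult_left_mono[OF err[of k] a(1)[of n k]] a(1)[of n k] by (simp add: abs_mult)
        qed
        finally show ?thesis .
      qed
      then show "\<forall>\<^sub>F n in sequentially. norm ((\<Sum>k\<le>m n. a n k * L k) - (I0 + 1 / 2 * (\<Sum>k\<le>m n. a n k * R k)))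
          \<le> (\<Sum>k\<le>m n. a n k * err k)" by simp
    qed
    moreover have "(\<lambda>n. (\<Sum>k\<le>m n. a n k * L k) - (I0 + 1 / 2 * (\<Sum>k\<le>m n. a n k * R k))) \<longlonglongrightarrow>
        (LBINT x. U (t, x) * \<phi> x) - (I0 + 1 / 2 * (LBINT x. prim E t x * (deriv ^^ 2) \<phi> x))"
      by (intro tendsto_intros c1 c2)
    ultimately have "(LBINT x. U (t, x) * \<phi> x) - (I0 + 1 / 2 * (LBINT x. prim E t x * (deriv ^^ 2) \<phi> x)) = 0"
      using LIMSEQ_unique by blast
    then show "(LBINT x. U (t, x) * \<phi> x) =
      (LBINT x. u0 x * \<phi> x) + 1 / 2 * (LBINT x. prim E t x * (deriv ^^ 2) \<phi> x)"
      by (simp add: I0_def)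
  qed
  have graph: "AE p in plane. E p \<in> \<beta> `` {U p}"
  proof -
    \<comment> \<open>Minty's argument, with the graph tested at the point \<open>(aa, bb)\<close> for which \<open>aa + bb = U + E\<close>.\<close>
    let ?P = "plane"
    note mono = graph_monotone[OF acc c growth]
    define bb where "bb p = yosida \<beta> 1 (U p + E p)" for p
    define aa where "aa p = U p + E p - bb p" for p
    have bb_in: "bb p \<in> \<beta> `` {aa p}" for p
      using yosida_in[OF acc c growth zero_less_one, of "U p + E p"] by (simp add: aa_def bb_def)
    have [measurable]: "yosida \<beta> 1 \<in> borel_measurable borel"
      by (rule borel_measurable_continuous_onI[OF continuous_yosida[OF acc c growth zero_less_one]])
    have [measurable]: "bb \<in> borel_measurable ?P" "aa \<in> borel_measurable ?P"
      unfolding aa_def[abs_def] bb_def[abs_def] by measurable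
    have bbc: "\<bar>bb p\<bar> \<le> c * \<bar>U p + E p\<bar>" for p
      unfolding bb_def by (rule yosida_le[OF acc c growth zero_less_one])
    have aac: "\<bar>aa p\<bar> \<le> \<bar>U p + E p\<bar>" for p
      using yosida_resolvent_le[OF acc c growth zero_less_one, of "U p + E p"] by (simp add: aa_def bb_def)
    have ibb: "integrable ?P bb"
    proof (rule Bochner_Integration.integrable_bound)
      show "integrable ?P (\<lambda>p. c * \<bar>U p + E p\<bar>)" using iU iE by auto
      show "AE p in ?P. norm (bb p) \<le> norm (c * \<bar>U p + E p\<bar>)"
        using order_trans[OF bbc abs_ge_self] by auto
    qed measurable
    have iaa: "integrable ?P aa" unfolding aa_def[abs_def] using iU iE ibb by auto
    have UEb: "\<bar>U p + E p\<bar> \<le> 2 * K" for p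
      using bdd_integrableD(3)[OF U, of p] bdd_integrableD(3)[OF E, of p] by linarith
    have bbB: "\<bar>bb p\<bar> \<le> c * (2 * K)" and aaB: "\<bar>aa p\<bar> \<le> 2 * K" for p
      using order_trans[OF bbc mult_left_mono[OF UEb]] order_trans[OF aac UEb] c by auto
    have iab: "integrable ?P (\<lambda>p. aa p * bb p)" by (rule integrable_mult_bdd[OF iaa _ bbB]) simp
    have ifu: "integrable ?P (\<lambda>p. f p * g p)" if f: "integrable ?P f" and g: "bdd_integrable T K g" for f g
      by (rule integrable_mult_bdd[OF f bdd_integrableD(2)[OF g] bdd_integrableD(3)[OF g]])
    define q where "q k = (LINT p|?P. u k p * e k p)" for k
    define C2 where "C2 = K * (LINT p|?P. \<bar>bb p\<bar>)"
    \<comment> \<open>In the expansion of \<open>(u k - lam k * e k - aa) * (e k - bb)\<close>, the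
      square of \<open>e k\<close> has a favourable sign and the remaining term in
      \<open>lam k\<close> costs at most \<open>lam k * C2\<close>. The resulting lower bound is
      affine in \<open>u k\<close> and \<open>e k\<close>, so it survives convex
      combinations.\<close>
    have lower: "(LINT p|?P. aa p * e k p) + (LINT p|?P. bb p * u k p) - (LINT p|?P. aa p * bb p) - lam k * C2 \<le> q k" for k
    proof -
      have "(LINT p|?P. aa p * e k p + bb p * u k p - aa p * bb p - lam k * (K * \<bar>bb p\<bar>)) \<le> q k"
        unfolding q_def
      proof (rule integral_mono)
        show "integrable ?P (\<lambda>p. aa p * e k p + bb p * u k p - aa p * bb p - lam k * (K * \<bar>bb p\<bar>))"
          using ifu[OF iaa e] ifu[OF ibb u] iab ibb by auto
        show "integrable ?P (\<lambda>p. u k p * e k p)" by (rule ifu[OF bdd_integrableD(1)[OF u] e])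
        fix p
        have "e k p \<in> \<beta> `` {u k p - lam k * e k p}" using ue[of k] unfolding scheme_approx_def by blast
        then have "0 \<le> (u k p - lam k * e k p - aa p) * (e k p - bb p)"
          using mono bb_in[of p] unfolding monotone_graph_def by blast
        also have "\<dots> = u k p * e k p - lam k * (e k p)\<^sup>2 - aa p * e k p - bb p * u k p + lam k * (bb p * e k p) + aa p * bb p"
          by (simp add: algebra_simps power2_eq_square)
        finally have 1: "aa p * e k p + bb p * u k p - aa p * bb p \<le> u k p * e k p - lam k * (e k p)\<^sup>2 + lam k * (bb p * e k p)"
          by linarith
        have "bb p * e k p \<le> K * \<bar>bb p\<bar>"
          using abs_mult_le[OF bdd_integrableD(3)[OF e], of "bb p"] by (meson abs_ge_self order_trans)
        then have "lam k * (bb p * e k p) \<le> lam k * (K * \<bar>bb p\<bar>)" using lam[of k] by (intro mult_left_mono) auto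
        moreover have "lam k * (e k p)\<^sup>2 \<ge> 0" using lam[of k] by simp
        ultimately show "aa p * e k p + bb p * u k p - aa p * bb p - lam k * (K * \<bar>bb p\<bar>) \<le> u k p * e k p"
          using 1 by linarith
      qed
      then show ?thesis
        using ifu[OF iaa e] ifu[OF ibb u] iab ibb by (simp add: C2_def)
    qed
    define P where "P = prim E T"
    define G where "G j = diff_quot (h j) P" for j
    \<comment> \<open>The backward quotient of the forward quotient: what \<open>G j\<close> becomes
      when summation by parts moves the quotient off the primitive.\<close>
    define G' where "G' j = diff_quot (- h j) (G j)" for j
    define Gs where "Gs j = (LBINT x. (G j x)\<^sup>2)" for j
    define C1 where "C1 = T * c\<^sup>2 * M * A"
    note iP = integrable_prim[OF E, of T, folded P_def] and bP = prim_bound[OF E less_imp_le[OF T], of T, folded P_def]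
    have [measurable]: "P \<in> borel_measurable borel" using iP by auto
    have iG: "integrable lborel (G j)" for j
      unfolding G_def diff_quot_def[abs_def] using iP integrable_shift[OF iP] by auto
    have [measurable]: "G j \<in> borel_measurable borel" for j using iG[of j] by auto
    have bG: "\<bar>G j x\<bar> \<le> 2 * (T * K) / \<bar>h j\<bar>" for j x
      using bP[of x] bP[of "x + h j"] unfolding G_def diff_quot_def abs_divide by (intro divide_right_mono) auto
    have iG': "integrable lborel (G' j)" for j
      unfolding G'_def diff_quot_def[abs_def] using iG integrable_shift[OF iG, of j "- h j"] by auto
    have bG': "\<bar>G' j x\<bar> \<le> 2 * (2 * (T * K) / \<bar>h j\<bar>) / \<bar>- h j\<bar>" for j x
      using bG[of j x] bG[of j "x + - h j"] unfolding G'_def diff_quot_def abs_divide by (intro divide_right_mono) auto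
    have iG2: "integrable lborel (\<lambda>x. (G j x)\<^sup>2)" for j
      using square_integrable_diff_quot[OF iP bP, of "h j" 0] by (simp add: G_def)
    have dq: "(LBINT x. diff_quot (h j) f x * G j x) = - (LBINT x. f x * G' j x)" if "integrable lborel f" for f j
      unfolding G'_def by (rule integral_diff_quot_mult[OF that _ bG]) simp
    have upper: "q k \<le> (LBINT x. prim (e k) T x * u0 x) + 1 / 2 * (LBINT x. prim (e k) T x * G' j x)
        + 1 / 4 * Gs j + lam k * C1" if jk: "j \<le> k" for j k
    proof -
      let ?p = "prim (e k) T"
      note ip = integrable_prim[OF e, of k T] and bp = prim_bound[OF e less_imp_le[OF T], of k T]
      have qk: "q k = (LBINT s. LBINT x. u k (s, x) * e k (s, x))"
        unfolding q_def using lborel_pair.integral_fst'[OF ifu[OF bdd_integrableD(1)[OF u] e]] by simp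
      have 1: "q k \<le> (LBINT x. u0 x * ?p x) - 1 / 4 * (LBINT x. (diff_quot (h k) ?p x)\<^sup>2) + lam k * C1"
        using ue[of k] unfolding scheme_approx_def qk C1_def A_def by (simp add: ac_simps)
      \<comment> \<open>The scheme controls the quotient with its own step \<open>h k\<close>, which
        varies with \<open>k\<close>. Passing to the coarser step \<open>h j\<close> does not
        increase the squared norm, and \<open>j\<close> can then stay fixed while \<open>k\<close>
        runs through the tail.\<close>
      have hj: "h j = real (2 ^ (k - j)) * h k"
      proof -
        obtain i where "k = j + i" using jk le_Suc_ex by blast
        then show ?thesis by (simp add: h_def power_add power_one_over)
      qed
      have "(LBINT x. (diff_quot (h j) ?p x)\<^sup>2) \<le> (LBINT x. (diff_quot (h k) ?p x)\<^sup>2)"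
        unfolding hj by (rule diff_quot_mult_le[OF ip bp]) simp
      \<comment> \<open>The bound \<open>y\<^sup>2 \<ge> 2 y g - g\<^sup>2\<close> makes the square linear in the approximation, so that it survives
        convex combinations and the limit.\<close>
      moreover have "- 2 * (LBINT x. ?p x * G' j x) - Gs j \<le> (LBINT x. (diff_quot (h j) ?p x)\<^sup>2)"
      proof -
        have id: "integrable lborel (diff_quot (h j) ?p)"
          unfolding diff_quot_def[abs_def] using ip integrable_shift[OF ip] by auto
        have im: "integrable lborel (\<lambda>x. diff_quot (h j) ?p x * G j x)"
          by (rule integrable_mult_bdd[OF id _ bG]) simp
        have i2: "integrable lborel (\<lambda>x. (diff_quot (h j) ?p x)\<^sup>2)"
          using square_integrable_diff_quot[OF ip bp, of "h j" 0] by simp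
        have "(LBINT x. 2 * (diff_quot (h j) ?p x * G j x) - (G j x)\<^sup>2) \<le> (LBINT x. (diff_quot (h j) ?p x)\<^sup>2)"
        proof (rule integral_mono)
          show "2 * (diff_quot (h j) ?p x * G j x) - (G j x)\<^sup>2 \<le> (diff_quot (h j) ?p x)\<^sup>2" for x
            using zero_le_power2[of "diff_quot (h j) ?p x - G j x"] unfolding power2_diff by (simp add: algebra_simps)
        qed (use im iG2 i2 in auto)
        then show ?thesis using im iG2[of j] dq[OF ip, of j] by (simp add: Gs_def)
      qed
      ultimately show ?thesis using 1 by (simp add: mult.commute[of "u0 _"])
    qed
    define S where "S n = (\<Sum>k\<le>m n. a n k * q k)" for n
    have sl: "(\<lambda>n. \<Sum>k\<le>m n. a n k * lam k) \<longlonglongrightarrow> 0" by (rule convex_tail_tendsto[OF a lam_lim])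
    have sumE: "(LINT p|?P. g p * Et n p) = (\<Sum>k\<le>m n. a n k * (LINT p|?P. g p * e k p))" if g: "integrable ?P g" for g n
    proof -
      have "(LINT p|?P. g p * Et n p) = (LINT p|?P. (\<Sum>k\<le>m n. a n k * (g p * e k p)))"
        by (simp add: Et_def sum_distrib_left mult.left_commute)
      then show ?thesis using ifu[OF g e] by simp
    qed
    have sumU: "(LINT p|?P. g p * Ut n p) = (\<Sum>k\<le>m n. a n k * (LINT p|?P. g p * u k p))" if g: "integrable ?P g" for g n
    proof -
      have "(LINT p|?P. g p * Ut n p) = (LINT p|?P. (\<Sum>k\<le>m n. a n k * (g p * u k p)))"
        by (simp add: Ut_def sum_distrib_left mult.left_commute)
      then show ?thesis using ifu[OF g u] by simp
    qed
    have sumP: "(LBINT x. prim (Et n) T x * g x) = (\<Sum>k\<le>m n. a n k * (LBINT x. prim (e k) T x * g x))"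
      if [measurable]: "g \<in> borel_measurable borel" and B: "\<And>x. \<bar>g x\<bar> \<le> B" for g n B
    proof -
      have i: "integrable lborel (\<lambda>x. prim (e k) T x * g x)" for k
        by (rule integrable_mult_bdd[OF integrable_prim[OF e] _ B]) simp
      have "(LBINT x. prim (Et n) T x * g x) = (LBINT x. (\<Sum>k\<le>m n. a n k * (prim (e k) T x * g x)))"
        unfolding Et_def[abs_def] prim_sum[OF e] by (simp add: sum_distrib_right mult.assoc)
      then show ?thesis using i by simp
    qed
    have SL: "(LINT p|?P. aa p * Et n p) + (LINT p|?P. bb p * Ut n p) - (LINT p|?P. aa p * bb p)
        - (\<Sum>k\<le>m n. a n k * lam k) * C2 \<le> S n" for n
    proof -
      have "(\<Sum>k\<le>m n. a n k * ((LINT p|?P. aa p * e k p) + (LINT p|?P. bb p * u k p) - (LINT p|?P. aa p * bb p) - lam k * C2)) \<le> S n"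
        unfolding S_def by (intro sum_mono mult_left_mono lower a)
      moreover have "(\<Sum>k\<le>m n. a n k * ((LINT p|?P. aa p * e k p) + (LINT p|?P. bb p * u k p) - (LINT p|?P. aa p * bb p) - lam k * C2))
        = (LINT p|?P. aa p * Et n p) + (LINT p|?P. bb p * Ut n p) - (\<Sum>k\<le>m n. a n k) * (LINT p|?P. aa p * bb p)
        - (\<Sum>k\<le>m n. a n k * lam k) * C2"
        unfolding sumE[OF iaa] sumU[OF ibb]
        by (simp add: right_diff_distrib distrib_left sum_subtractf sum.distrib sum_distrib_right mult.assoc)
      ultimately show ?thesis by (simp add: a(3))
    qed
    \<comment> \<open>All weights with \<open>k < n\<close> vanish, so \<open>j \<le> n\<close>
      ensures \<open>j \<le> k\<close> wherever \<open>upper\<close> is used.\<close>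
    have SU: "S n \<le> (LBINT x. prim (Et n) T x * u0 x) + 1 / 2 * (LBINT x. prim (Et n) T x * G' j x)
        + 1 / 4 * Gs j + (\<Sum>k\<le>m n. a n k * lam k) * C1" if jn: "j \<le> n" for j n
    proof -
      have "S n \<le> (\<Sum>k\<le>m n. a n k * ((LBINT x. prim (e k) T x * u0 x) + 1 / 2 * (LBINT x. prim (e k) T x * G' j x)
        + 1 / 4 * Gs j + lam k * C1))"
        unfolding S_def
      proof (rule sum_mono)
        fix k
        show "a n k * q k \<le> a n k * ((LBINT x. prim (e k) T x * u0 x) + 1 / 2 * (LBINT x. prim (e k) T x * G' j x)
          + 1 / 4 * Gs j + lam k * C1)"
          using upper[of j k] jn a(1)[of n k] a(2)[of k n] by (cases "k < n") (auto intro: mult_left_mono)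
      qed
      also have "\<dots> = (LBINT x. prim (Et n) T x * u0 x) + 1 / 2 * (LBINT x. prim (Et n) T x * G' j x)
        + 1 / 4 * ((\<Sum>k\<le>m n. a n k) * Gs j) + (\<Sum>k\<le>m n. a n k * lam k) * C1"
        using iG'[of j]
        by (subst sumP[OF _ u0(2)], simp, subst sumP[OF _ bG'], simp)
           (simp add: distrib_left sum.distrib sum_distrib_right sum_distrib_left sum_divide_distrib mult.assoc)
      finally show ?thesis by (simp add: a(3))
    qed
    have bound: "(LINT p|?P. aa p * E p) + (LINT p|?P. bb p * U p) - (LINT p|?P. aa p * bb p)
        \<le> (LBINT x. P x * u0 x) - 1 / 4 * Gs j" for j
    proof -
      have l: "(\<lambda>n. (LINT p|?P. aa p * Et n p) + (LINT p|?P. bb p * Ut n p) - (LINT p|?P. aa p * bb p)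
        - (\<Sum>k\<le>m n. a n k * lam k) * C2) \<longlonglongrightarrow>
        (LINT p|?P. aa p * E p) + (LINT p|?P. bb p * U p) - (LINT p|?P. aa p * bb p) - 0 * C2"
        by (intro tendsto_intros sl integral_mult_tendsto[OF Et E convE iaa] integral_mult_tendsto[OF Ut U convU ibb])
      have r: "(\<lambda>n. (LBINT x. prim (Et n) T x * u0 x) + 1 / 2 * (LBINT x. prim (Et n) T x * G' j x)
        + 1 / 4 * Gs j + (\<Sum>k\<le>m n. a n k * lam k) * C1) \<longlonglongrightarrow>
        (LBINT x. P x * u0 x) + 1 / 2 * (LBINT x. P x * G' j x) + 1 / 4 * Gs j + 0 * C1"
        unfolding P_def
        by (intro tendsto_intros sl prim_mult_tendsto[OF Et E convE u0] prim_mult_tendsto[OF Et E convE iG' bG'])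
      have "(LINT p|?P. aa p * E p) + (LINT p|?P. bb p * U p) - (LINT p|?P. aa p * bb p) - 0 * C2
        \<le> (LBINT x. P x * u0 x) + 1 / 2 * (LBINT x. P x * G' j x) + 1 / 4 * Gs j + 0 * C1"
        by (rule LIMSEQ_le[OF l r]) (use SL SU order_trans in blast)
      \<comment> \<open>At the limit the linearization is exact: - 1/2 + 1/4 gives the coefficient -
        1/4 of the energy.\<close>
      moreover have "(LBINT x. P x * G' j x) = - Gs j"
        using dq[OF iP, of j] by (simp add: Gs_def power2_eq_square flip: G_def)
      ultimately show ?thesis by simp
    qed
    \<comment> \<open>Next \<open>j\<close> tends to infinity, and the energy identity evaluates the
      limit of \<open>Gs\<close>. Since \<open>z\<close> is \<open>U\<close> minus the initial
      datum, the datum term cancels against \<open>P\<close> tested with \<open>u0\<close>, and the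
      integral of \<open>U * E\<close> remains.\<close>
    define z where "z = (\<lambda>p. U p - indicator {0..T} (fst p) * u0 (snd p))"
    note zw = weak_solution_sub_initial[OF U E u0 equation, folded z_def]
    have "(\<lambda>j. LBINT x. (diff_quot (h j) (prim E T) x)\<^sup>2)
       \<longlonglongrightarrow> - 4 * (LBINT s. indicator {0..T} s * (LBINT x. z (s, x) * E (s, x)))"
    proof (rule energy_identity[OF zw(1) _ zw(2)])
      show "bdd_integrable T (K + M) E" using E M0 by (auto intro: bdd_integrable_mono)
      show "h j \<noteq> 0" for j using h[of j] by simp
    qed (use T h_lim in auto)
    then have Gs_lim: "Gs \<longlonglongrightarrow> - 4 * (LBINT s. indicator {0..T} s * (LBINT x. z (s, x) * E (s, x)))"
      by (simp add: Gs_def[abs_def] G_def P_def)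
    have zE: "(LBINT s. indicator {0..T} s * (LBINT x. z (s, x) * E (s, x))) = (LINT p|?P. z p * E p)"
    proof -
      have i: "integrable ?P (\<lambda>p. z p * E p)" by (rule ifu[OF bdd_integrableD(1)[OF zw(1)] E])
      have "(LBINT s. indicator {0..T} s * (LBINT x. z (s, x) * E (s, x))) = (LBINT s. LBINT x. z (s, x) * E (s, x))"
        using bdd_integrableD(4)[OF E] by (intro Bochner_Integration.integral_cong) (auto split: split_indicator)
      then show ?thesis using lborel_pair.integral_fst'[OF i] by simp
    qed
    have Pu0: "(LBINT x. P x * u0 x) = (LINT p|?P. indicator {0..T} (fst p) * E p * u0 (snd p))"
      unfolding P_def by (rule prim_mult_eq_pair[OF E _ u0(2)]) simp
    have iU0: "integrable ?P (\<lambda>p. U p * E p)" by (rule ifu[OF iU E])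
    have izE: "integrable ?P (\<lambda>p. z p * E p)" by (rule ifu[OF bdd_integrableD(1)[OF zw(1)] E])
    have eq: "indicator {0..T} (fst p) * E p * u0 (snd p) = U p * E p - z p * E p" for p
      by (simp add: z_def algebra_simps)
    have "(\<lambda>j. (LBINT x. P x * u0 x) - 1 / 4 * Gs j) \<longlonglongrightarrow> (LBINT x. P x * u0 x) - 1 / 4 * (- 4 * (LINT p|?P. z p * E p))"
      using Gs_lim unfolding zE by (intro tendsto_intros)
    then have "(LINT p|?P. aa p * E p) + (LINT p|?P. bb p * U p) - (LINT p|?P. aa p * bb p)
        \<le> (LBINT x. P x * u0 x) - 1 / 4 * (- 4 * (LINT p|?P. z p * E p))"
      by (rule LIMSEQ_le_const) (use bound in blast)
    also have "\<dots> = (LINT p|?P. U p * E p)"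
      unfolding Pu0 eq using iU0 izE by simp
    finally have fin: "(LINT p|?P. aa p * E p) + (LINT p|?P. bb p * U p) - (LINT p|?P. aa p * bb p) \<le> (LINT p|?P. U p * E p)" .
    \<comment> \<open>As \<open>aa + bb = U + E\<close>, the factor \<open>E - bb\<close> equals
      \<open>- (U - aa)\<close>, so Minty's product \<open>(U - aa) * (E - bb)\<close> is minus a
      square. Its integral is nonnegative by \<open>fin\<close>, so it vanishes almost
      everywhere.\<close>
    have sq: "(U p - aa p)\<^sup>2 = aa p * E p + bb p * U p - aa p * bb p - U p * E p" for p
      by (simp add: aa_def power2_eq_square algebra_simps)
    have isq: "integrable ?P (\<lambda>p. (U p - aa p)\<^sup>2)"
      unfolding sq using ifu[OF iaa E] ifu[OF ibb U] iab iU0 by auto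
    have "(LINT p|?P. (U p - aa p)\<^sup>2) = (LINT p|?P. aa p * E p) + (LINT p|?P. bb p * U p) - (LINT p|?P. aa p * bb p) - (LINT p|?P. U p * E p)"
      unfolding sq using ifu[OF iaa E] ifu[OF ibb U] iab iU0 by simp
    then have "(LINT p|?P. (U p - aa p)\<^sup>2) \<le> 0" using fin by linarith
    moreover have "(LINT p|?P. (U p - aa p)\<^sup>2) \<ge> 0" by simp
    ultimately have "(LINT p|?P. (U p - aa p)\<^sup>2) = 0" by linarith
    then have "AE p in ?P. (U p - aa p)\<^sup>2 = 0"
      using isq by (subst (asm) integral_nonneg_eq_0_iff_AE) auto
    then show ?thesis
    proof eventually_elim
      case (elim p)
      then have "U p = aa p" "E p = bb p" by (auto simp: aa_def)
      then show ?case using bb_in[of p] by simp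
    qed
  qed
  have "limit_solution T \<beta> c M u0 U E"
    unfolding limit_solution_def
    using U E equation graph Ushift EL1 UM by (simp add: K_def A_def)
  then show ?thesis by blast
qed

section \<open>Continuity in time\<close>

lemma L1_shift_small:
  assumes f: "integrable lborel f" and e: "e > 0"
  obtains d where "d > 0" "\<And>y. \<bar>y\<bar> \<le> d \<Longrightarrow> L1_shift f y \<le> e"
proof (rule ccontr)
  assume n: "\<not> thesis"
  have "\<exists>y. \<bar>y\<bar> \<le> 1 / real (Suc n) \<and> L1_shift f y > e" for n
    using n that[of "1 / real (Suc n)"] by (force simp: not_le)
  then obtain Y where Y: "\<And>n. \<bar>Y n\<bar> \<le> 1 / real (Suc n)" "\<And>n. L1_shift f (Y n) > e" by metis
  have "Y \<longlonglongrightarrow> 0"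
    by (rule Lim_null_comparison[of _ "\<lambda>n. 1 / real (Suc n)"]) (use Y(1) LIMSEQ_Suc[OF lim_1_over_n] in auto)
  from L1_shift_tendsto[OF f this] have "(\<lambda>n. L1_shift f (Y n)) \<longlonglongrightarrow> 0" .
  then have "0 \<ge> e" by (rule LIMSEQ_le_const) (use Y(2) in \<open>auto intro: less_imp_le\<close>)
  then show False using e by simp
qed

lemma L1_second_diff_le:
  assumes f: "integrable lborel f" and d: "d \<noteq> 0"
  shows "(LBINT x. \<bar>second_diff d f x\<bar>) \<le> 4 / d\<^sup>2 * (LBINT x. \<bar>f x\<bar>)"
proof -
  have "(LBINT x. \<bar>second_diff d f x\<bar>) \<le> (LBINT x. (\<bar>f (x + d)\<bar> + \<bar>f (x + - d)\<bar> + 2 * \<bar>f x\<bar>) / d\<^sup>2)"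
  proof (rule integral_mono)
    show "\<bar>second_diff d f x\<bar> \<le> (\<bar>f (x + d)\<bar> + \<bar>f (x + - d)\<bar> + 2 * \<bar>f x\<bar>) / d\<^sup>2" for x
      unfolding second_diff_def abs_divide by (simp add: divide_right_mono)
  qed (use f integrable_second_diff[OF f] integrable_shift[OF f, of d] integrable_shift[OF f, of "- d"] in auto)
  also have "\<dots> = ((LBINT x. \<bar>f (x + d)\<bar>) + (LBINT x. \<bar>f (x + - d)\<bar>) + 2 * (LBINT x. \<bar>f x\<bar>)) / d\<^sup>2"
    using f integrable_shift[OF f, of d] integrable_shift[OF f, of "- d"] by simp
  also have "\<dots> = 4 / d\<^sup>2 * (LBINT x. \<bar>f x\<bar>)"
    using integral_shift[of "\<lambda>x. \<bar>f x\<bar>" d] integral_shift[of "\<lambda>x. \<bar>f x\<bar>" "- d"] by simp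
  finally show ?thesis .
qed

text \<open>Here \<open>2 * L\<close> pays for the two averages that turn \<open>D\<close> into a
  second difference of \<open>g\<close>, and \<open>4 / d\<^sup>2\<close> bounds the L1 operator
  norm of that second difference.\<close>

lemma weak_second_derivative_L1_le:
  assumes D: "integrable lborel D" and g: "integrable lborel g"
    and eq: "\<And>\<phi>. \<phi> \<in> schwartz \<Longrightarrow> (LBINT x. D x * \<phi> x) = (LBINT x. g x * (deriv ^^ 2) \<phi> x)"
    and d: "d > 0" and L: "\<And>y. \<bar>y\<bar> \<le> d \<Longrightarrow> L1_shift D y \<le> L"
  shows "(LBINT x. \<bar>D x\<bar>) \<le> 2 * L + 4 / d\<^sup>2 * (LBINT x. \<bar>g x\<bar>)"
proof -
  let ?S = "stek d (stek (- d) D)"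
  have iS: "integrable lborel ?S" by (intro integrable_stek D)
  have 1: "(LBINT x. \<bar>stek d' D x - D x\<bar>) \<le> L" if "\<bar>d'\<bar> = d" for d'
  proof (rule stek_minus_L1_le[OF D])
    show "AE r in unit_uniform. L1_shift D (d' * r) \<le> L"
      using AE_unit_uniform
    proof eventually_elim
      case (elim r)
      then have "\<bar>d' * r\<bar> \<le> d" using that by (simp add: abs_mult mult_left_le)
      then show ?case by (rule L)
    qed
  qed
  have "(LBINT x. \<bar>D x\<bar>) \<le> (LBINT x. \<bar>?S x - D x\<bar> + \<bar>?S x\<bar>)"
    using D iS by (intro integral_mono) auto
  also have "\<dots> = (LBINT x. \<bar>?S x - D x\<bar>) + (LBINT x. \<bar>?S x\<bar>)"
    using D iS by simp
  also have "(LBINT x. \<bar>?S x\<bar>) = (LBINT x. \<bar>second_diff d g x\<bar>)"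
  proof (rule integral_cong_AE)
    show "AE x in lborel. \<bar>?S x\<bar> = \<bar>second_diff d g x\<bar>"
      using weak_second_derivative_stek[OF D g eq, of d] d by auto
  qed (use iS integrable_second_diff[OF g] in auto)
  also have "\<dots> \<le> 4 / d\<^sup>2 * (LBINT x. \<bar>g x\<bar>)" using L1_second_diff_le[OF g, of d] d by simp
  also have "(LBINT x. \<bar>?S x - D x\<bar>) \<le> L + L"
    using stek_stek_minus_L1[OF D, of d] 1[of d] 1[of "- d"] d by auto
  finally show ?thesis by simp
qed

lemma prim_diff_L1_le:
  assumes f: "bdd_integrable T K f" and B: "AE t in lborel. (LBINT x. \<bar>f (t, x)\<bar>) \<le> B"
    and st: "0 \<le> s" "s \<le> t"
  shows "(LBINT x. \<bar>prim f t x - prim f s x\<bar>) \<le> B * (t - s)"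
proof -
  note [measurable] = bdd_integrableD(2)[OF f]
  have i: "integrable plane (\<lambda>(r, x). indicator {s..t} r * \<bar>f (r, x)\<bar>)"
    by (rule Bochner_Integration.integrable_bound[OF bdd_integrableD(1)[OF f]]) (auto split: split_indicator)
  have "(LBINT x. \<bar>prim f t x - prim f s x\<bar>) \<le> (LBINT x. LBINT r. indicator {s..t} r * \<bar>f (r, x)\<bar>)"
  proof (rule integral_mono)
    fix x
    have "\<bar>prim f t x - prim f s x\<bar> = \<bar>LBINT r. indicator {0..t} r * f (r, x) - indicator {0..s} r * f (r, x)\<bar>"
      using integrable_time_section_ind[OF f] by (simp add: prim_def)
    also have "\<dots> \<le> (LBINT r. \<bar>indicator {0..t} r * f (r, x) - indicator {0..s} r * f (r, x)\<bar>)"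
      by (rule integral_abs_bound)
    also have "\<dots> \<le> (LBINT r. indicator {s..t} r * \<bar>f (r, x)\<bar>)"
    proof (rule integral_mono)
      show "\<bar>indicator {0..t} r * f (r, x) - indicator {0..s} r * f (r, x)\<bar> \<le> indicator {s..t} r * \<bar>f (r, x)\<bar>" for r
        using st by (auto split: split_indicator)
      show "integrable lborel (\<lambda>r. indicator {s..t} r * \<bar>f (r, x)\<bar>)"
        using integrable_mult_indicator[OF _ integrable_abs[OF integrable_time_section[OF f]], of "{s..t}"] by auto
    qed (use integrable_time_section_ind[OF f] in auto)
    finally show "\<bar>prim f t x - prim f s x\<bar> \<le> (LBINT r. indicator {s..t} r * \<bar>f (r, x)\<bar>)" .
  qed (use integrable_prim[OF f] lborel_pair.integrable_snd[OF i] in auto)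
  also have "\<dots> = (LBINT r. indicator {s..t} r * (LBINT x. \<bar>f (r, x)\<bar>))"
    using lborel_pair.Fubini_integral[OF i] by simp
  also have "\<dots> \<le> (LBINT r. B * indicator {s..t} r)"
  proof (rule integral_mono_AE)
    show "AE r in lborel. indicator {s..t} r * (LBINT x. \<bar>f (r, x)\<bar>) \<le> B * indicator {s..t} r"
      using B by eventually_elim (auto split: split_indicator)
    show "integrable lborel (\<lambda>r. B * indicator {s..t} r)"
      by (intro integrable_mult_right integrable_real_indicator) (auto simp: emeasure_lborel_Icc_eq)
  qed (use lborel_pair.integrable_fst[OF i] in simp)
  also have "\<dots> = B * (t - s)" using st by simp
  finally show ?thesis .
qed

lemma conull_dense_Icc:
  fixes T t d :: real
  assumes T: "T > 0" and G: "AE t in lborel. t \<in> {0..T} \<longrightarrow> t \<in> G" and t: "t \<in> {0..T}" and d: "d > 0"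
  shows "\<exists>s\<in>G \<inter> {0..T}. \<bar>s - t\<bar> < d"
proof (rule ccontr)
  assume n: "\<not> ?thesis"
  define p where "p = max 0 (t - d / 2)"
  define q where "q = min T (t + d / 2)"
  have pq: "p < q" "{p..q} \<subseteq> {0..T}" "\<And>s. s \<in> {p..q} \<Longrightarrow> \<bar>s - t\<bar> < d" using t d T by (auto simp: p_def q_def)
  have "AE s in lborel. s \<notin> {p..q}"
    using G by eventually_elim (use n pq in blast)
  then have "emeasure lborel {p..q} = 0" by (subst (asm) AE_iff_measurable[of "{p..q}"]) auto
  then show False using pq(1) by simp
qed

lemma L1_triangle:
  assumes "integrable N f" "integrable N g" "integrable N (h :: 'a \<Rightarrow> real)"
  shows "(LINT x|N. \<bar>f x - h x\<bar>) \<le> (LINT x|N. \<bar>f x - g x\<bar>) + (LINT x|N. \<bar>g x - h x\<bar>)"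
proof -
  have "(LINT x|N. \<bar>f x - h x\<bar>) \<le> (LINT x|N. \<bar>f x - g x\<bar> + \<bar>g x - h x\<bar>)"
    using assms by (intro integral_mono) auto
  then show ?thesis using assms by simp
qed

lemma limit_solution_L1_modulus:
  assumes T: "T > 0" and c: "c > 0" and u0: "integrable lborel u0"
    and sol: "limit_solution T \<beta> c M u0 U E"
  obtains G where "AE t in lborel. t \<in> {0..T} \<longrightarrow> t \<in> G"
    "\<And>t. t \<in> G \<Longrightarrow> t \<in> {0..T} \<and> integrable lborel (\<lambda>x. U (t, x)) \<and> (AE x in lborel. \<bar>U (t, x)\<bar> \<le> M)"
    "\<And>e. e > 0 \<Longrightarrow> \<exists>d>0. \<forall>s\<in>G. \<forall>t\<in>G. \<bar>s - t\<bar> < d \<longrightarrow> (LBINT x. \<bar>U (s, x) - U (t, x)\<bar>) \<le> e"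
proof -
  define A where "A = (LBINT x. \<bar>u0 x\<bar>)"
  have A0: "A \<ge> 0" by (simp add: A_def)
  have U: "bdd_integrable T (M + c * M) U" and E: "bdd_integrable T (M + c * M) E"
    and eq: "AE t in lborel. t \<in> {0..T} \<longrightarrow> (\<forall>\<phi>\<in>schwartz. (LBINT x. U (t, x) * \<phi> x) =
      (LBINT x. u0 x * \<phi> x) + 1 / 2 * (LBINT x. prim E t x * (deriv ^^ 2) \<phi> x))"
    and sh: "AE t in lborel. \<forall>y. L1_shift (\<lambda>x. U (t, x)) y \<le> L1_shift u0 y"
    and EL: "AE t in lborel. (LBINT x. \<bar>E (t, x)\<bar>) \<le> c * A"
    and UM: "AE p in plane. \<bar>U p\<bar> \<le> M"
    using sol unfolding limit_solution_def A_def by auto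
  define G where "G = {t \<in> {0..T}. integrable lborel (\<lambda>x. U (t, x)) \<and> (AE x in lborel. \<bar>U (t, x)\<bar> \<le> M) \<and>
      (\<forall>y. L1_shift (\<lambda>x. U (t, x)) y \<le> L1_shift u0 y) \<and>
      (\<forall>\<phi>\<in>schwartz. (LBINT x. U (t, x) * \<phi> x) =
      (LBINT x. u0 x * \<phi> x) + 1 / 2 * (LBINT x. prim E t x * (deriv ^^ 2) \<phi> x))}"
  show ?thesis
  proof (rule that[of G])
    show "AE t in lborel. t \<in> {0..T} \<longrightarrow> t \<in> G"
      using eq sh bdd_integrable_section[OF U] lborel_pair.AE_pair[OF UM] by eventually_elim (simp add: G_def)
    show "t \<in> {0..T} \<and> integrable lborel (\<lambda>x. U (t, x)) \<and> (AE x in lborel. \<bar>U (t, x)\<bar> \<le> M)" if "t \<in> G" for t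
      using that by (simp add: G_def)
    fix e :: real assume e: "e > 0"
    \<comment> \<open>Two sections enter the difference and two averages enter the estimate, so that
      e / 8 adds up to e / 2.\<close>
    obtain d where d: "d > 0" "\<And>y. \<bar>y\<bar> \<le> d \<Longrightarrow> L1_shift u0 y \<le> e / 8"
      using L1_shift_small[OF u0, of "e / 8"] e by auto
    \<comment> \<open>The 2 is the 4 of the second difference times the factor 1/2 of the equation;
      the summand 1 keeps \<open>C\<close> positive when the datum is zero.\<close>
    define C where "C = 2 / d\<^sup>2 * (c * A) + 1"
    have C: "C > 0" using c A0 by (auto simp: C_def intro!: add_nonneg_pos mult_nonneg_nonneg)
    have main: "(LBINT x. \<bar>U (t, x) - U (s, x)\<bar>) \<le> e" if s: "s \<in> G" and t: "t \<in> G" and st: "s \<le> t" "t - s < e / (2 * C)" for s t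
    proof -
      let ?D = "\<lambda>x. U (t, x) - U (s, x)" and ?g = "\<lambda>x. 1 / 2 * (prim E t x - prim E s x)"
      have iU: "integrable lborel (\<lambda>x. U (t, x))" "integrable lborel (\<lambda>x. U (s, x))" using s t by (auto simp: G_def)
      have iD: "integrable lborel ?D" using iU by auto
      have ig: "integrable lborel ?g" using integrable_prim[OF E] by auto
      have "(LBINT x. \<bar>?D x\<bar>) \<le> 2 * (e / 8 + e / 8) + 4 / d\<^sup>2 * (LBINT x. \<bar>?g x\<bar>)"
      proof (rule weak_second_derivative_L1_le[OF iD ig _ d(1)])
        fix \<phi> :: "real \<Rightarrow> real" assume \<phi>: "\<phi> \<in> schwartz"
        note \<phi>2 = schwartz_funpow_deriv[OF \<phi>, of 2]
        obtain B where B: "\<And>x. \<bar>\<phi> x\<bar> \<le> B" using schwartz_bounded[OF \<phi>] by blast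
        obtain B2 where B2: "\<And>x. \<bar>(deriv ^^ 2) \<phi> x\<bar> \<le> B2" using schwartz_bounded[OF \<phi>2] by blast
        note i1 = integrable_mult_bdd[OF iU(1) _ B] integrable_mult_bdd[OF iU(2) _ B]
        note i2 = integrable_mult_bdd[OF integrable_prim[OF E, of t] _ B2] integrable_mult_bdd[OF integrable_prim[OF E, of s] _ B2]
        have "(LBINT x. ?D x * \<phi> x) = (LBINT x. U (t, x) * \<phi> x) - (LBINT x. U (s, x) * \<phi> x)"
          using i1 schwartz_measurable[OF \<phi>] by (simp add: left_diff_distrib)
        also have "\<dots> = 1 / 2 * ((LBINT x. prim E t x * (deriv ^^ 2) \<phi> x) - (LBINT x. prim E s x * (deriv ^^ 2) \<phi> x))"
          using s t \<phi> by (simp add: G_def)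
        also have "\<dots> = (LBINT x. 1 / 2 * (prim E t x * (deriv ^^ 2) \<phi> x - prim E s x * (deriv ^^ 2) \<phi> x))"
          using i2 schwartz_measurable[OF \<phi>2] by simp
        also have "\<dots> = (LBINT x. ?g x * (deriv ^^ 2) \<phi> x)"
          by (simp add: left_diff_distrib)
        finally show "(LBINT x. ?D x * \<phi> x) = (LBINT x. ?g x * (deriv ^^ 2) \<phi> x)" .
      next
        fix y :: real assume y: "\<bar>y\<bar> \<le> d"
        have iUm: "integrable lborel (\<lambda>x. - U (s, x))" using iU by auto
        have "L1_shift (\<lambda>x. - U (s, x)) y = L1_shift (\<lambda>x. U (s, x)) y"
          unfolding L1_shift_def by (intro Bochner_Integration.integral_cong) auto
        then have "L1_shift ?D y \<le> L1_shift (\<lambda>x. U (t, x)) y + L1_shift (\<lambda>x. U (s, x)) y"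
          using L1_shift_add[OF iU(1) iUm, of y] by simp
        also have "\<dots> \<le> L1_shift u0 y + L1_shift u0 y" using s t by (intro add_mono) (auto simp: G_def)
        also have "\<dots> \<le> e / 8 + e / 8" using d(2)[OF y] by simp
        finally show "L1_shift ?D y \<le> e / 8 + e / 8" .
      qed
      also have "(LBINT x. \<bar>?g x\<bar>) = 1 / 2 * (LBINT x. \<bar>prim E t x - prim E s x\<bar>)"
        by (simp add: abs_mult)
      also have "4 / d\<^sup>2 * (1 / 2 * (LBINT x. \<bar>prim E t x - prim E s x\<bar>)) \<le> 4 / d\<^sup>2 * (1 / 2 * ((c * A) * (t - s)))"
        using prim_diff_L1_le[OF E EL _ st(1)] s by (intro mult_left_mono) (auto simp: G_def)
      also have "\<dots> = 2 / d\<^sup>2 * (c * A) * (t - s)" by simp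
      also have "\<dots> \<le> C * (t - s)" using st(1) by (intro mult_right_mono) (auto simp: C_def)
      also have "\<dots> \<le> C * (e / (2 * C))" using st(2) C by (intro mult_left_mono) auto
      also have "\<dots> = e / 2" using C by simp
      finally show ?thesis by simp
    qed
    show "\<exists>d>0. \<forall>s\<in>G. \<forall>t\<in>G. \<bar>s - t\<bar> < d \<longrightarrow> (LBINT x. \<bar>U (s, x) - U (t, x)\<bar>) \<le> e"
    proof (intro exI[of _ "e / (2 * C)"] conjI ballI impI)
      fix s t assume "s \<in> G" "t \<in> G" "\<bar>s - t\<bar> < e / (2 * C)"
      then show "(LBINT x. \<bar>U (s, x) - U (t, x)\<bar>) \<le> e"
        using main[of s t] main[of t s] by (cases "s \<le> t") (auto simp: abs_minus_commute)
    qed (use e C in simp)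
  qed
qed

text \<open>Completeness of L1 extends a uniformly continuous map from a dense set of times. The
  limit is taken almost everywhere along a subsequence, so that the bound \<open>M\<close> passes to
  it, and Fatou's lemma turns the uniform modulus into closeness to \<open>g\<close>.\<close>

lemma L1_extension_point:
  fixes U :: "real \<times> real \<Rightarrow> real"
  assumes dense: "\<And>d. d > 0 \<Longrightarrow> \<exists>s\<in>G. \<bar>s - t\<bar> < d"
    and G: "\<And>s. s \<in> G \<Longrightarrow> integrable lborel (\<lambda>x. U (s, x)) \<and> (AE x in lborel. \<bar>U (s, x)\<bar> \<le> M)"
    and unif: "\<And>e. e > 0 \<Longrightarrow> \<exists>d>0. \<forall>s\<in>G. \<forall>t\<in>G. \<bar>s - t\<bar> < d \<longrightarrow> (LBINT x. \<bar>U (s, x) - U (t, x)\<bar>) \<le> e"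
  shows "\<exists>g. integrable lborel g \<and> (AE x in lborel. \<bar>g x\<bar> \<le> M) \<and>
    (\<forall>e>0. \<exists>d>0. \<forall>s\<in>G. \<bar>s - t\<bar> < d \<longrightarrow> (LBINT x. \<bar>U (s, x) - g x\<bar>) \<le> e)"
proof -
  have "\<exists>s\<in>G. \<bar>s - t\<bar> < 1 / real (Suc n)" for n by (rule dense) simp
  then obtain s where s: "\<And>n. s n \<in> G" "\<And>n. \<bar>s n - t\<bar> < 1 / real (Suc n)" by metis
  have close: "\<exists>n0. \<forall>n\<ge>n0. \<bar>s n - t\<bar> < d" if d: "d > 0" for d
  proof -
    obtain n0 where n0: "1 / real (Suc n0) < d" using nat_approx_posE[OF d] by metis
    have "\<bar>s n - t\<bar> < d" if "n \<ge> n0" for n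
    proof -
      have "1 / real (Suc n) \<le> 1 / real (Suc n0)" using that by (intro divide_left_mono) auto
      then show ?thesis using s(2)[of n] n0 by linarith
    qed
    then show ?thesis by blast
  qed
  obtain r where r: "strict_mono r" "AE x in lborel. Cauchy (\<lambda>i. U (s (r i), x))"
  proof (rule cauchy_L1_AE_cauchy_subseq[of lborel "\<lambda>n x. U (s n, x)"])
    fix e :: real assume e: "e > 0"
    obtain d where d: "d > 0" "\<forall>s\<in>G. \<forall>t\<in>G. \<bar>s - t\<bar> < d \<longrightarrow> (LBINT x. \<bar>U (s, x) - U (t, x)\<bar>) \<le> e / 2"
      using unif[of "e / 2"] e by auto
    obtain n0 where n0: "\<forall>n\<ge>n0. \<bar>s n - t\<bar> < d / 2" using close[of "d / 2"] d by auto
    have "(LBINT x. norm (U (s i, x) - U (s j, x))) < e" if "i \<ge> n0" "j \<ge> n0" for i j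
    proof -
      have "\<bar>s i - s j\<bar> < d" using n0[rule_format, OF that(1)] n0[rule_format, OF that(2)] by linarith
      then have "(LBINT x. \<bar>U (s i, x) - U (s j, x)\<bar>) \<le> e / 2" using d(2) s(1) by blast
      then show ?thesis using e by simp
    qed
    then show "\<exists>N. \<forall>i\<ge>N. \<forall>j\<ge>N. (LBINT x. norm (U (s i, x) - U (s j, x))) < e" by blast
  qed (use G s in auto)
  have iU: "integrable lborel (\<lambda>x. U (s n, x))" for n using G s(1) by blast
  have [measurable]: "(\<lambda>x. U (s n, x)) \<in> borel_measurable lborel" for n using iU[of n] by auto
  define g where "g x = lim (\<lambda>i. U (s (r i), x))" for x
  have [measurable]: "g \<in> borel_measurable lborel"
    unfolding g_def[abs_def] by (rule borel_measurable_lim_metric) measurable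
  have lim: "AE x in lborel. (\<lambda>i. U (s (r i), x)) \<longlonglongrightarrow> g x"
    using r(2) by eventually_elim (simp add: g_def Cauchy_convergent_iff convergent_LIMSEQ_iff)
  have est: "integrable lborel (\<lambda>x. U (p, x) - g x) \<and> (LBINT x. \<bar>U (p, x) - g x\<bar>) \<le> e"
    if p: "p \<in> G" and e: "e > 0" and d: "d > 0" "\<forall>s\<in>G. \<forall>t\<in>G. \<bar>s - t\<bar> < d \<longrightarrow> (LBINT x. \<bar>U (s, x) - U (t, x)\<bar>) \<le> e"
      and pt: "\<bar>p - t\<bar> < d / 2" for p e d
  proof -
    have ip: "integrable lborel (\<lambda>x. U (p, x))" using G p by blast
    have [measurable]: "(\<lambda>x. U (p, x)) \<in> borel_measurable lborel" using ip by auto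
    obtain n0 where n0: "\<forall>n\<ge>n0. \<bar>s n - t\<bar> < d / 2" using close[of "d / 2"] d by auto
    have ev: "\<forall>\<^sub>F i in sequentially. (LBINT x. \<bar>U (p, x) - U (s (r i), x)\<bar>) \<le> e"
    proof (rule eventually_sequentiallyI[of n0])
      fix i assume "n0 \<le> i"
      then have "n0 \<le> r i" using seq_suble[OF r(1), of i] by linarith
      then have "\<bar>p - s (r i)\<bar> < d" using n0 pt by (smt (verit) field_sum_of_halves)
      then show "(LBINT x. \<bar>U (p, x) - U (s (r i), x)\<bar>) \<le> e" using d(2) p s(1) by blast
    qed
    have l: "AE x in lborel. (\<lambda>i. U (p, x) - U (s (r i), x)) \<longlonglongrightarrow> U (p, x) - g x"
      using lim by eventually_elim (intro tendsto_intros)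
    have "integrable lborel (\<lambda>x. U (p, x) - U (s (r i), x))" for i using ip iU by auto
    from L1_Fatou[OF this ev _ l] show ?thesis by simp
  qed
  have "integrable lborel g"
  proof -
    obtain d where d: "d > 0" "\<forall>s\<in>G. \<forall>t\<in>G. \<bar>s - t\<bar> < d \<longrightarrow> (LBINT x. \<bar>U (s, x) - U (t, x)\<bar>) \<le> 1"
      using unif[of 1] by auto
    obtain p where p: "p \<in> G" "\<bar>p - t\<bar> < d / 2" using dense[of "d / 2"] d by auto
    have "integrable lborel (\<lambda>x. U (p, x) - (U (p, x) - g x))"
      by (rule Bochner_Integration.integrable_diff[OF conjunct1[OF G[OF p(1)]] conjunct1[OF est[OF p(1) zero_less_one d p(2)]]])
    then show ?thesis by simp
  qed
  moreover have "AE x in lborel. \<bar>g x\<bar> \<le> M"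
  proof -
    have "AE x in lborel. \<forall>i. \<bar>U (s (r i), x)\<bar> \<le> M" using G s(1) by (auto simp: AE_all_countable)
    then show ?thesis using lim
    proof eventually_elim
      case (elim x)
      show ?case by (rule LIMSEQ_le_const2[OF tendsto_rabs[OF elim(2)]]) (use elim(1) in auto)
    qed
  qed
  moreover have "\<exists>d>0. \<forall>s\<in>G. \<bar>s - t\<bar> < d \<longrightarrow> (LBINT x. \<bar>U (s, x) - g x\<bar>) \<le> e" if e: "e > 0" for e
  proof -
    obtain d where d: "d > 0" "\<forall>s\<in>G. \<forall>t\<in>G. \<bar>s - t\<bar> < d \<longrightarrow> (LBINT x. \<bar>U (s, x) - U (t, x)\<bar>) \<le> e"
      using unif[OF e] by auto
    show ?thesis using est[OF _ e d] d(1) by (intro exI[of _ "d / 2"]) auto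
  qed
  ultimately show ?thesis by blast
qed

lemma AE_pair_fst:
  assumes "AE t in lborel. P t"
  shows "AE p in plane. P (fst p)"
proof -
  obtain N where N: "N \<in> null_sets lborel" "{t. \<not> P t} \<subseteq> N"
    using assms by (auto elim!: AE_E simp: null_sets_def)
  have "N \<times> (UNIV :: real set) \<in> null_sets plane"
    using N(1) by (auto simp: null_sets_def lborel.emeasure_pair_measure_Times)
  then show ?thesis by (rule AE_I') (use N(2) in auto)
qed

lemma limit_solution_L1_version:
  assumes T: "T > 0" and c: "c > 0" and u0: "integrable lborel u0"
    and sol: "limit_solution T \<beta> c M u0 U E"
  obtains v where "continuous_L1_version T U v" "\<And>t. t \<in> {0..T} \<Longrightarrow> AE x in lborel. \<bar>v (t, x)\<bar> \<le> M"
proof -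
  obtain G where G: "AE t in lborel. t \<in> {0..T} \<longrightarrow> t \<in> G"
    "\<And>t. t \<in> G \<Longrightarrow> t \<in> {0..T} \<and> integrable lborel (\<lambda>x. U (t, x)) \<and> (AE x in lborel. \<bar>U (t, x)\<bar> \<le> M)"
    "\<And>e. e > 0 \<Longrightarrow> \<exists>d>0. \<forall>s\<in>G. \<forall>t\<in>G. \<bar>s - t\<bar> < d \<longrightarrow> (LBINT x. \<bar>U (s, x) - U (t, x)\<bar>) \<le> e"
    by (rule limit_solution_L1_modulus[OF assms]) (rule that)
  have dense: "\<exists>s\<in>G. \<bar>s - t\<bar> < d" if "t \<in> {0..T}" "d > 0" for t d
    using conull_dense_Icc[OF T G(1) that] by blast
  \<comment> \<open>The last condition keeps \<open>U (t, \<cdot>)\<close> itself at good times.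
    Almost all times are good, so the chosen family agrees with \<open>U\<close> almost everywhere
    on the strip.\<close>
  define Q where "Q t g \<longleftrightarrow> integrable lborel g \<and> (AE x in lborel. \<bar>g x\<bar> \<le> M) \<and>
    (\<forall>e>0. \<exists>d>0. \<forall>s\<in>G. \<bar>s - t\<bar> < d \<longrightarrow> (LBINT x. \<bar>U (s, x) - g x\<bar>) \<le> e) \<and> (t \<in> G \<longrightarrow> g = (\<lambda>x. U (t, x)))" for t g
  have "\<exists>g. Q t g" if t: "t \<in> {0..T}" for t
  proof (cases "t \<in> G")
    case True
    then have "\<exists>d>0. \<forall>s\<in>G. \<bar>s - t\<bar> < d \<longrightarrow> (LBINT x. \<bar>U (s, x) - U (t, x)\<bar>) \<le> e" if "e > 0" for e
      using G(3)[OF that] by blast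
    then show ?thesis unfolding Q_def using G(2)[OF True] by (intro exI[of _ "\<lambda>x. U (t, x)"]) auto
  next
    case False
    have G2: "integrable lborel (\<lambda>x. U (s, x)) \<and> (AE x in lborel. \<bar>U (s, x)\<bar> \<le> M)" if "s \<in> G" for s
      using G(2)[OF that] by simp
    from L1_extension_point[of G t U M, OF dense[OF t] G2 G(3)] False show ?thesis unfolding Q_def by auto
  qed
  then have "\<exists>V. \<forall>t\<in>{0..T}. Q t (V t)" by (intro bchoice ballI)
  then obtain V where V': "\<And>t. t \<in> {0..T} \<Longrightarrow> Q t (V t)" by blast
  have V: "\<And>t. t \<in> {0..T} \<Longrightarrow> integrable lborel (V t)" "\<And>t. t \<in> {0..T} \<Longrightarrow> AE x in lborel. \<bar>V t x\<bar> \<le> M"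
    "\<And>t e. t \<in> {0..T} \<Longrightarrow> e > 0 \<Longrightarrow> \<exists>d>0. \<forall>s\<in>G. \<bar>s - t\<bar> < d \<longrightarrow> (LBINT x. \<bar>U (s, x) - V t x\<bar>) \<le> e"
    "\<And>t. t \<in> {0..T} \<Longrightarrow> t \<in> G \<Longrightarrow> V t = (\<lambda>x. U (t, x))"
    using V' unfolding Q_def by simp_all
  have cont: "((\<lambda>s. LBINT x. \<bar>V s x - V t x\<bar>) \<longlongrightarrow> 0) (at t within {0..T})" if t: "t \<in> {0..T}" for t
    unfolding tendsto_iff
  proof (intro allI impI)
    fix e :: real assume e: "e > 0"
    obtain d where d: "d > 0" "\<forall>s\<in>G. \<bar>s - t\<bar> < d \<longrightarrow> (LBINT x. \<bar>U (s, x) - V t x\<bar>) \<le> e / 3"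
      using V(3)[OF t, of "e / 3"] e by auto
    have "(LBINT x. \<bar>V s x - V t x\<bar>) < e" if s: "s \<in> {0..T}" "\<bar>s - t\<bar> < d" for s
    proof -
      obtain d' where d': "d' > 0" "\<forall>p\<in>G. \<bar>p - s\<bar> < d' \<longrightarrow> (LBINT x. \<bar>U (p, x) - V s x\<bar>) \<le> e / 3"
        using V(3)[OF s(1), of "e / 3"] e by auto
      \<comment> \<open>The minimum makes the good time \<open>p\<close> close to \<open>s\<close>
        and keeps it within \<open>d\<close> of \<open>t\<close>.\<close>
      obtain p where p: "p \<in> G" "\<bar>p - s\<bar> < min d' (d - \<bar>s - t\<bar>)"
        using dense[OF s(1), of "min d' (d - \<bar>s - t\<bar>)"] d' s(2) by auto
      have 1: "(LBINT x. \<bar>U (p, x) - V s x\<bar>) \<le> e / 3" using d'(2) p by auto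
      have "\<bar>p - t\<bar> < d" using p(2) by auto
      then have 2: "(LBINT x. \<bar>U (p, x) - V t x\<bar>) \<le> e / 3" using d(2) p(1) by blast
      have "(LBINT x. \<bar>V s x - V t x\<bar>) \<le> (LBINT x. \<bar>V s x - U (p, x)\<bar>) + (LBINT x. \<bar>U (p, x) - V t x\<bar>)"
        using V(1) s(1) t G(2)[OF p(1)] by (intro L1_triangle) auto
      then show ?thesis using 1 2 e by (simp add: abs_minus_commute)
    qed
    then show "\<forall>\<^sub>F s in at t within {0..T}. dist (LBINT x. \<bar>V s x - V t x\<bar>) 0 < e"
      unfolding eventually_at using d(1) by (intro exI[of _ d]) (auto simp: dist_real_def)
  qed
  define v where "v = (\<lambda>(t, x). V t x)"
  show ?thesis
  proof (rule that[of v])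
    show "AE x in lborel. \<bar>v (t, x)\<bar> \<le> M" if "t \<in> {0..T}" for t using V(2)[OF that] by (simp add: v_def)
    have "AE p in strip T. v p = U p"
      unfolding AE_strip using AE_pair_fst[OF G(1)]
    proof eventually_elim
      case (elim p)
      then show ?case using V(4)[of "fst p"] by (cases p) (auto simp: v_def)
    qed
    then show "continuous_L1_version T U v"
      unfolding continuous_L1_version_def continuous_L1_def using V(1) cont by (simp add: v_def)
  qed
qed

text \<open>Two versions agree at almost every time, hence on a dense set of times, and both are
  continuous into L1.\<close>

lemma continuous_L1_unique:
  assumes T: "T > 0" and v: "continuous_L1 T v" and v': "continuous_L1 T v'"
    and eq: "AE p in strip T. v' p = v p" and t: "t \<in> {0..T}"
  shows "AE x in lborel. v' (t, x) = v (t, x)"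
proof -
  define G where "G = {s. AE x in lborel. v' (s, x) = v (s, x)}"
  have G: "AE s in lborel. s \<in> {0..T} \<longrightarrow> s \<in> G" using AE_strip_section[OF eq] by (simp add: G_def)
  have i: "integrable lborel (\<lambda>x. v (s, x))" "integrable lborel (\<lambda>x. v' (s, x))" if "s \<in> {0..T}" for s
    using v v' that unfolding continuous_L1_def by auto
  have "(LBINT x. \<bar>v' (t, x) - v (t, x)\<bar>) \<le> 0 + e" if e: "e > 0" for e
  proof -
    have c: "\<exists>d>0. \<forall>s\<in>{0..T}. s \<noteq> t \<longrightarrow> \<bar>s - t\<bar> < d \<longrightarrow> (LBINT x. \<bar>f (s, x) - f (t, x)\<bar>) < e / 2"
      if f: "continuous_L1 T f" for f
    proof -
      have "((\<lambda>s. LBINT x. \<bar>f (s, x) - f (t, x)\<bar>) \<longlongrightarrow> 0) (at t within {0..T})"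
        using f t unfolding continuous_L1_def by auto
      then have "\<forall>\<^sub>F s in at t within {0..T}. dist (LBINT x. \<bar>f (s, x) - f (t, x)\<bar>) 0 < e / 2"
        using e by (intro tendstoD) auto
      then show ?thesis unfolding eventually_at by (auto simp: dist_real_def)
    qed
    obtain d1 where d1: "d1 > 0" "\<forall>s\<in>{0..T}. s \<noteq> t \<longrightarrow> \<bar>s - t\<bar> < d1 \<longrightarrow> (LBINT x. \<bar>v (s, x) - v (t, x)\<bar>) < e / 2"
      using c[OF v] by blast
    obtain d2 where d2: "d2 > 0" "\<forall>s\<in>{0..T}. s \<noteq> t \<longrightarrow> \<bar>s - t\<bar> < d2 \<longrightarrow> (LBINT x. \<bar>v' (s, x) - v' (t, x)\<bar>) < e / 2"
      using c[OF v'] by blast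
    obtain s where s: "s \<in> G \<inter> {0..T}" "\<bar>s - t\<bar> < min d1 d2"
      using conull_dense_Icc[OF T G t, of "min d1 d2"] d1 d2 by auto
    have z: "(LBINT x. \<bar>v' (s, x) - v (s, x)\<bar>) = 0"
    proof -
      have "(LBINT x. \<bar>v' (s, x) - v (s, x)\<bar>) = (LINT x::real|lborel. 0)"
        using s i[of s] by (intro integral_cong_AE) (auto simp: G_def)
      then show ?thesis by simp
    qed
    show ?thesis
    \<comment> \<open>The limit at \<open>t\<close> ignores the time \<open>t\<close> itself; if
      \<open>s = t\<close>, then \<open>t\<close> is a good time and the versions agree there
      already.\<close>
    proof (cases "s = t")
      case True then show ?thesis using z e by simp
    next
      case False
      have "(LBINT x. \<bar>v' (t, x) - v (t, x)\<bar>) \<le> (LBINT x. \<bar>v' (t, x) - v' (s, x)\<bar>) + (LBINT x. \<bar>v' (s, x) - v (t, x)\<bar>)"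
        using i[OF t] i[of s] s by (intro L1_triangle) auto
      also have "(LBINT x. \<bar>v' (s, x) - v (t, x)\<bar>) \<le> (LBINT x. \<bar>v' (s, x) - v (s, x)\<bar>) + (LBINT x. \<bar>v (s, x) - v (t, x)\<bar>)"
        using i[OF t] i[of s] s by (intro L1_triangle) auto
      also have "(LBINT x. \<bar>v' (t, x) - v' (s, x)\<bar>) = (LBINT x. \<bar>v' (s, x) - v' (t, x)\<bar>)"
        by (simp add: abs_minus_commute)
      finally have "(LBINT x. \<bar>v' (t, x) - v (t, x)\<bar>) \<le> (LBINT x. \<bar>v' (s, x) - v' (t, x)\<bar>)
          + ((LBINT x. \<bar>v' (s, x) - v (s, x)\<bar>) + (LBINT x. \<bar>v (s, x) - v (t, x)\<bar>))" by simp
      moreover have "(LBINT x. \<bar>v (s, x) - v (t, x)\<bar>) < e / 2" using d1(2) s False by auto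
      moreover have "(LBINT x. \<bar>v' (s, x) - v' (t, x)\<bar>) < e / 2" using d2(2) s False by auto
      ultimately show ?thesis using z by linarith
    qed
  qed
  then have "(LBINT x. \<bar>v' (t, x) - v (t, x)\<bar>) \<le> 0" by (rule field_le_epsilon)
  moreover have "(LBINT x. \<bar>v' (t, x) - v (t, x)\<bar>) \<ge> 0" by simp
  ultimately have "(LBINT x. \<bar>v' (t, x) - v (t, x)\<bar>) = 0" by linarith
  then show ?thesis using i[OF t] by (subst (asm) integral_nonneg_eq_0_iff_AE) auto
qed

section \<open>Bounded representative of the datum and conclusion\<close>

lemma bounded_representative:
  fixes u0 :: "real \<Rightarrow> real"
  assumes "u0 \<in> L1_Linf lborel"
  obtains f M where "integrable lborel f" "\<And>x. \<bar>f x\<bar> \<le> M" "AE x in lborel. f x = u0 x" "Linf_norm lborel u0 = ereal M"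
proof -
  have i: "integrable lborel u0" and fin: "Linf_norm lborel u0 < \<infinity>" using assms unfolding L1_Linf_def by auto
  have ae: "AE x in lborel. ereal \<bar>u0 x\<bar> \<le> Linf_norm lborel u0"
    unfolding Linf_norm_def by (rule esssup_AE)
  \<comment> \<open>The essential supremum of a nonnegative function can be negative only for the
    zero measure.\<close>
  have nn: "Linf_norm lborel u0 \<ge> 0"
  proof (rule ccontr)
    assume "\<not> Linf_norm lborel u0 \<ge> 0"
    then have neg: "Linf_norm lborel u0 < 0" by simp
    have "AE x in lborel. ereal \<bar>u0 x\<bar> < 0"
      using ae by eventually_elim (rule le_less_trans[OF _ neg])
    then have "AE x::real in lborel. False" by simp
    then show False by (simp add: AE_iff_measurable[of UNIV])
  qed
  then obtain M where M: "Linf_norm lborel u0 = ereal M" "M \<ge> 0"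
    using fin by (cases "Linf_norm lborel u0") auto
  \<comment> \<open>Cutting at the essential bound itself, not at a larger constant, makes the bound
    \<open>M\<close> of the scheme equal to the norm of the datum.\<close>
  define f where "f x = max (- M) (min M (u0 x))" for x
  show ?thesis
  proof (rule that[of f M])
    show "integrable lborel f"
      by (rule Bochner_Integration.integrable_bound[OF i]) (use i M(2) in \<open>auto simp: f_def[abs_def]\<close>)
    show "\<bar>f x\<bar> \<le> M" for x using M(2) by (auto simp: f_def)
    show "AE x in lborel. f x = u0 x" using ae unfolding M(1) by eventually_elim (auto simp: f_def)
  qed (rule M(1))
qed

theorem proposition3p4:
  fixes T :: real and \<beta> :: "(real \<times> real) set" and u0 :: "real \<Rightarrow> real"
  assumes "T > 0"
    and "m_accretive \<beta>"
    and "\<exists>c>0. \<forall>u w. w \<in> \<beta> `` {u} \<longrightarrow> \<bar>w\<bar> \<le> c * \<bar>u\<bar>"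
    and "u0 \<in> L1_Linf lborel"
  shows "\<exists>u \<eta>. distributional_solution T \<beta> u0 u \<eta> \<and>
           (\<forall>u' \<eta>'. distributional_solution T \<beta> u0 u' \<eta>' \<longrightarrow>
              (AE p in strip T. u' p = u p \<and> \<eta>' p = \<eta> p)) \<and>
           (\<exists>v. continuous_L1_version T u v \<and>
              (\<forall>t\<in>{0..T}. Linf_norm lborel (\<lambda>x. v (t, x)) \<le> Linf_norm lborel u0) \<and>
              (\<forall>v'. continuous_L1_version T u v' \<longrightarrow>
                 (\<forall>t\<in>{0..T}. AE x in lborel. v' (t, x) = v (t, x))))"
proof -
  obtain c where c: "c > 0" and growth: "\<And>u w. w \<in> \<beta> `` {u} \<Longrightarrow> \<bar>w\<bar> \<le> c * \<bar>u\<bar>" using assms(3) by blast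
  obtain f M where f: "integrable lborel f" "\<And>x. \<bar>f x\<bar> \<le> M" "AE x in lborel. f x = u0 x" "Linf_norm lborel u0 = ereal M"
    using bounded_representative[OF assms(4)] by blast
  have u0: "integrable lborel u0" using assms(4) unfolding L1_Linf_def by auto
  obtain U E where sol: "limit_solution T \<beta> c M f U E"
    using limit_solution_exists[OF assms(1,2) c growth f(1,2)] by blast
  \<comment> \<open>The scheme starts from the bounded representative; the equation sees the datum
    only through these pairings.\<close>
  have eq0: "(LBINT x. f x * \<phi> x) = (LBINT x. u0 x * \<phi> x)" if "\<phi> \<in> schwartz" for \<phi>
  proof (rule integral_cong_AE)
    note [measurable] = schwartz_measurable[OF that]
    have [measurable]: "f \<in> borel_measurable borel" "u0 \<in> borel_measurable borel" using f(1) u0 by auto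
    show "(\<lambda>x. f x * \<phi> x) \<in> borel_measurable lborel" "(\<lambda>x. u0 x * \<phi> x) \<in> borel_measurable lborel" by measurable
    show "AE x in lborel. f x * \<phi> x = u0 x * \<phi> x" using f(3) by eventually_elim simp
  qed
  have ds: "distributional_solution T \<beta> u0 U E"
  proof (rule distributional_solutionI)
    show "bdd_integrable T (M + c * M) U" "bdd_integrable T (M + c * M) E"
      using sol unfolding limit_solution_def by auto
    show "AE t in lborel. t \<in> {0..T} \<longrightarrow> (\<forall>\<phi>\<in>schwartz. (LBINT x. U (t, x) * \<phi> x) =
      (LBINT x. u0 x * \<phi> x) + 1 / 2 * (LBINT x. prim E t x * (deriv ^^ 2) \<phi> x))"
      using sol eq0 unfolding limit_solution_def by auto
    show "AE p in plane. p \<in> {0..T} \<times> UNIV \<longrightarrow> E p \<in> \<beta> `` {U p}"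
      using sol unfolding limit_solution_def by (auto elim: eventually_mono)
  qed
  have mono: "monotone_graph \<beta>" using assms(2) unfolding m_accretive_def by blast
  obtain v where v: "continuous_L1_version T U v" "\<And>t. t \<in> {0..T} \<Longrightarrow> AE x in lborel. \<bar>v (t, x)\<bar> \<le> M"
    by (rule limit_solution_L1_version[OF assms(1) c f(1) sol]) (rule that)
  have "Linf_norm lborel (\<lambda>x. v (t, x)) \<le> Linf_norm lborel u0" if t: "t \<in> {0..T}" for t
    unfolding f(4)
  proof (rule Linf_norm_le[OF _ v(2)[OF t]])
    have "integrable lborel (\<lambda>x. v (t, x))"
      using v(1) t unfolding continuous_L1_version_def continuous_L1_def by auto
    then show "(\<lambda>x. v (t, x)) \<in> borel_measurable lborel" by (rule borel_measurable_integrable)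
  qed
  moreover have "AE x in lborel. v' (t, x) = v (t, x)" if v': "continuous_L1_version T U v'" and t: "t \<in> {0..T}" for v' t
  proof (rule continuous_L1_unique[OF assms(1) _ _ _ t])
    show "AE p in strip T. v' p = v p"
      using v(1) v' unfolding continuous_L1_version_def by (auto elim: eventually_elim2)
  qed (use v(1) v' in \<open>auto simp: continuous_L1_version_def\<close>)
  ultimately show ?thesis
    using ds distributional_solution_unique[OF less_imp_le[OF assms(1)] mono ds] v(1) by blast
qed

end
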